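(* Let $\Omega$ be an open subset of the Heisenberg group $\mathbb{H}^n$, let $\rho$ be a homogeneous distance on $\mathbb{H}^n$, let $\Sigma$ be a $p$-dimensional $C^1$ submanifold of $\Omega$ and let $x\in\Sigma$ be a transverse point of $\Sigma$. Then $$\lim_{r\to0^+}\frac{\mathrm{vol}_p(\Sigma\cap B_{x,r})}{r^{p+1}}=\frac{\theta_p^\rho\big(\tau_{\Sigma,\mathcal V}(x)\big)}{|\tau_{\Sigma,\mathcal V}(x)|},$$ where $B_{x,r}$ is the open $\rho$-ball of center $x$ and radius $r$, $\tau_{\Sigma,\mathcal V}(x)$ is a vertical tangent $p$-vector to $\Sigma$ at $x$ and $\theta_p^\rho$ is the metric factor of $\rho$.
   Context: Heisenberg group: $\mathbb{H}^n$ is the simply connected Lie group of dimension $2n+1$ whose Lie algebra $\mathfrak h^n$ (identified with left invariant vector fields) has a basis $(X_1,\dots,X_{2n},Z)$ whose only nontrivial brackets are $[X_k,X_{k+n}]=2Z$, $k=1,\dots,n$. Standard coordinates are given by the diffeomorphism $F:\mathbb{R}^{2n+1}\to\mathbb{H}^n$, $F(y)=\exp\big(y_{2n+1}Z+\sum_{j=1}^{2n}y_jX_j\big)$; in them the group law is $x\cdot y=\big(x_1+y_1,\dots,x_{2n}+y_{2n},\,x_{2n+1}+y_{2n+1}+\sum_{k=1}^n(x_ky_{k+n}-x_{k+n}y_k)\big)$. Dilations are $\delta_r(x)=(rx_1,\dots,rx_{2n},r^2x_{2n+1})$, $r>0$. The horizontal space is $H_x\mathbb{H}^n=\mathrm{span}\{X_1(x),\dots,X_{2n}(x)\}$.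 The Riemannian metric $g$ is the left invariant one making $(X_1,\dots,X_{2n},Z)$ orthonormal; $\mathrm{vol}_p$ is the $p$-dimensional Riemannian (Hausdorff) measure of $g$. A homogeneous distance $\rho$ on $\mathbb{H}^n$ is a distance that is continuous for the topology of $\mathbb{H}^n$, left invariant ($\rho(xy,xz)=\rho(y,z)$) and satisfies $\rho(\delta_ry,\delta_rz)=r\rho(y,z)$ for all $r>0$. $B_1$ is the open $\rho$-ball of radius $1$ centered at the unit element. The spaces $\Lambda_p(T_x\mathbb{H}^n)$ carry the scalar product $\langle v_1\wedge\dots\wedge v_p,w_1\wedge\dots\wedge w_p\rangle=\det\big(g(x)(v_i,w_j)\big)$. Vertical $p$-vectors at $x$ are linear combinations of $X_{j_1}(x)\wedge\dots\wedge X_{j_{p-1}}(x)\wedge Z(x)$, $1\le j_s\le 2n$; they form the orthogonal complement $\mathcal V_p(T_x\mathbb{H}^n)$ of $\Lambda_p(H_x\mathbb{H}^n)$ in $\Lambda_p(T_x\mathbb{H}^n)$, and $\pi_{\mathcal V}$ is the orthogonal projection onto $\mathcal V_p(T_x\mathbb{H}^n)$. For a $p$-dimensional $C^1$ submanifold $\Sigma$ and $x\in\Sigma$, a tangent $p$-vector is $\tau_\Sigma(x)=t_1\wedge\dots\wedge t_p$ with $(t_1,\dots,t_p)$ an orthonormal basis of $T_x\Sigma$ (defined up to sign), and the vertical tangent $p$-vector is $\tau_{\Sigma,\mathcal V}(x)=\pi_{\mathcal V}(\tau_\Sigma(x))$. The point $x$ is transverse if $T_x\Sigma\not\subset H_x\mathbb{H}^n$.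 Metric factor: for a nonzero vertical simple $p$-vector $\tau\in\Lambda_p(\mathfrak h^n)$ let $\mathcal L(\tau)=\{v\in\mathfrak h^n: v\wedge\tau=0\}$; then $\theta_p^\rho(\tau)=\mathcal H^p_{|\cdot|}\big(F^{-1}(\exp\mathcal L(\tau)\cap B_1)\big)$, where $\mathcal H^p_{|\cdot|}$ is the Euclidean $p$-dimensional Hausdorff measure on $\mathbb{R}^{2n+1}$. Here $p$-vectors at $x$ are identified with elements of $\Lambda_p(\mathfrak h^n)$ through left invariant vector fields. *)

theory Defs
  imports "HOL-Analysis.Analysis"
begin

section \<open>Hausdorff measures\<close>

text \<open>The measures are normalised so that the \<open>p\<close>-dimensional one of a Euclidean space is
  Lebesgue measure on \<open>p\<close>-dimensional subspaces. Since \<open>0 ^ 0 = 1\<close>, the guard in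
  \<open>hausdorff_gauge\<close> matters only for \<open>p = 0\<close>.\<close>

definition diam :: "('a \<Rightarrow> 'a \<Rightarrow> real) \<Rightarrow> 'a set \<Rightarrow> ennreal" where
  "diam d S = (SUP x\<in>S. SUP y\<in>S. ennreal (d x y))"

definition hausdorff_gauge :: "('a \<Rightarrow> 'a \<Rightarrow> real) \<Rightarrow> nat \<Rightarrow> 'a set \<Rightarrow> ennreal" where
  "hausdorff_gauge d p S =
     (if S = {} then 0 else ennreal (unit_ball_vol (real p) / 2 ^ p) * diam d S ^ p)"

definition hausdorff_pre :: "('a \<Rightarrow> 'a \<Rightarrow> real) \<Rightarrow> nat \<Rightarrow> real \<Rightarrow> 'a set \<Rightarrow> ennreal" where
  "hausdorff_pre d p \<delta> E =
     (INF C\<in>{C :: nat \<Rightarrow> 'a set. E \<subseteq> (\<Union>k. C k) \<and> (\<forall>k. diam d (C k) \<le> ennreal \<delta>)}.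
        \<Sum>k. hausdorff_gauge d p (C k))"

definition hausdorff :: "('a \<Rightarrow> 'a \<Rightarrow> real) \<Rightarrow> nat \<Rightarrow> 'a set \<Rightarrow> ennreal" where
  "hausdorff d p E = (SUP \<delta>\<in>{0<..}. hausdorff_pre d p \<delta> E)"


section \<open>Submanifolds of class C1\<close>

definition C1_on :: "'a::euclidean_space set \<Rightarrow> ('a \<Rightarrow> 'b::euclidean_space) \<Rightarrow> bool" where
  "C1_on U f \<longleftrightarrow>
     (\<exists>f' :: 'a \<Rightarrow> ('a \<Rightarrow>\<^sub>L 'b).
        (\<forall>x\<in>U. (f has_derivative blinfun_apply (f' x)) (at x)) \<and> continuous_on U f')"

definition C1_submanifold :: "nat \<Rightarrow> 'a::euclidean_space set \<Rightarrow> 'a set \<Rightarrow> bool" where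
  "C1_submanifold p \<Omega> M \<longleftrightarrow>
     M \<subseteq> \<Omega> \<and>
     (\<forall>x\<in>M. \<exists>U V \<phi> \<psi> S.
        open U \<and> x \<in> U \<and> U \<subseteq> \<Omega> \<and> open V \<and>
        homeomorphism U V \<phi> \<psi> \<and> C1_on U \<phi> \<and> C1_on V \<psi> \<and>
        subspace (S :: 'a set) \<and> dim S = p \<and> \<phi> ` (U \<inter> M) = V \<inter> S)"

definition tangent_space :: "'a::euclidean_space set \<Rightarrow> 'a \<Rightarrow> 'a set" where
  "tangent_space M x =
     {v. \<exists>\<gamma> e. e > 0 \<and> \<gamma> C1_differentiable_on {-e<..<e} \<and> \<gamma> ` {-e<..<e} \<subseteq> M \<and>
               \<gamma> 0 = x \<and> (\<gamma> has_vector_derivative v) (at 0)}"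


section \<open>The exterior algebra of a coordinate space\<close>

text \<open>For a finite linearly ordered index type \<open>'i\<close>, the exterior algebra of \<open>real ^ 'i\<close> is
  realised as \<open>real ^ 'i set\<close>: the unit vector \<open>axis S 1\<close> with \<open>S = {i\<^sub>1 < \<dots> < i\<^sub>p}\<close> stands for
  \<open>e\<^bsub>i\<^sub>1\<^esub> \<and> \<dots> \<and> e\<^bsub>i\<^sub>p\<^esub>\<close>, so \<open>p\<close>-vectors are supported on sets of cardinality \<open>p\<close>.
  By \<open>inner_wedges\<close> below, the inner product of \<open>real ^ 'i set\<close> is the determinant one.\<close>

definition wedge :: "real ^ ('i::{finite,linorder}) \<Rightarrow> real ^ 'i set \<Rightarrow> real ^ 'i set" where
  "wedge v \<alpha> = (\<chi> S. \<Sum>i\<in>S. (-1) ^ card {j\<in>S. j < i} * v $ i * \<alpha> $ (S - {i}))"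

definition wedges :: "(real ^ ('i::{finite,linorder})) list \<Rightarrow> real ^ 'i set" where
  "wedges vs = foldr wedge vs (axis {} 1)"

definition orth_proj :: "'a::real_inner set \<Rightarrow> 'a \<Rightarrow> 'a" where
  "orth_proj V a = (THE u. u \<in> V \<and> (\<forall>w\<in>V. inner (a - u) w = 0))"

definition contract :: "real ^ ('i::{finite,linorder}) \<Rightarrow> real ^ 'i set \<Rightarrow> real ^ 'i set" where
  "contract v \<beta> = (\<chi> S. \<Sum>i\<in>-S. (-1) ^ card {j\<in>S. j < i} * v $ i * \<beta> $ (insert i S))"

lemma inner_wedge_contract: "inner (wedge v \<alpha>) \<beta> = inner \<alpha> (contract v \<beta>)"
proof -
  define f where "f S i = (-1) ^ card {j\<in>S. j < i} * v $ i * \<alpha> $ (S - {i}) * \<beta> $ S" for S i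
  have "inner (wedge v \<alpha>) \<beta> = (\<Sum>S\<in>UNIV. \<Sum>i\<in>S. f S i)"
    by (simp add: inner_vec_def wedge_def f_def sum_distrib_right)
  also have "\<dots> = (\<Sum>(S, i)\<in>(SIGMA S:UNIV. S). f S i)"
    by (simp add: sum.Sigma)
  also have "\<dots> = (\<Sum>(S, i)\<in>(SIGMA S:UNIV. -S). f (insert i S) i)"
    by (rule sum.reindex_bij_witness[where i = "\<lambda>(S, i). (insert i S, i)"
          and j = "\<lambda>(S, i). (S - {i}, i)"]) (auto simp: insert_absorb)
  also have "\<dots> = (\<Sum>S\<in>UNIV. \<Sum>i\<in>-S. f (insert i S) i)"
    by (simp add: sum.Sigma)
  also have "\<dots> = inner \<alpha> (contract v \<beta>)"
  proof -
    have "f (insert i S) i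
        = \<alpha> $ S * ((-1) ^ card {j\<in>S. j < i} * v $ i * \<beta> $ (insert i S))" if "i \<in> -S" for i S
    proof -
      have "{j \<in> insert i S. j < i} = {j\<in>S. j < i}" "insert i S - {i} = S"
        using that by auto
      then show ?thesis by (simp add: f_def)
    qed
    then show ?thesis
      by (auto simp: inner_vec_def contract_def sum_distrib_left intro!: sum.cong)
  qed
  finally show ?thesis .
qed

definition ext1 :: "'i::{finite,linorder} \<Rightarrow> real ^ 'i set \<Rightarrow> real ^ 'i set" where
  "ext1 i \<alpha> = (\<chi> S. if i \<in> S then (-1) ^ card {j\<in>S. j < i} * \<alpha> $ (S - {i}) else 0)"

definition int1 :: "'i::{finite,linorder} \<Rightarrow> real ^ 'i set \<Rightarrow> real ^ 'i set" where
  "int1 i \<alpha> = (\<chi> S. if i \<in> S then 0 else (-1) ^ card {j\<in>S. j < i} * \<alpha> $ (insert i S))"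

lemma wedge_ext1: "wedge v \<alpha> = (\<Sum>i\<in>UNIV. v $ i *\<^sub>R ext1 i \<alpha>)"
proof -
  have "(\<Sum>i\<in>S. (-1) ^ card {j\<in>S. j < i} * v $ i * \<alpha> $ (S - {i}))
     = (\<Sum>i\<in>UNIV. v $ i * (if i \<in> S then (-1) ^ card {j\<in>S. j < i} * \<alpha> $ (S - {i}) else 0))" for S
    by (rule sum.mono_neutral_cong_left) auto
  then show ?thesis by (simp add: vec_eq_iff wedge_def ext1_def)
qed

lemma contract_int1: "contract v \<alpha> = (\<Sum>i\<in>UNIV. v $ i *\<^sub>R int1 i \<alpha>)"
proof -
  have "(\<Sum>i\<in>-S. (-1) ^ card {j\<in>S. j < i} * v $ i * \<alpha> $ (insert i S))
     = (\<Sum>i\<in>UNIV. v $ i * (if i \<in> S then 0 else (-1) ^ card {j\<in>S. j < i} * \<alpha> $ (insert i S)))" for S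
    by (rule sum.mono_neutral_cong_left) auto
  then show ?thesis by (simp add: vec_eq_iff contract_def int1_def)
qed

lemma linear_ext1: "linear (ext1 i)"
  by (rule linearI) (auto simp: vec_eq_iff ext1_def algebra_simps)

lemma linear_int1: "linear (int1 i)"
  by (rule linearI) (auto simp: vec_eq_iff int1_def algebra_simps)

lemma linear_wedge: "linear (wedge v)"
  by (rule linearI)
    (simp_all add: vec_eq_iff wedge_def algebra_simps sum.distrib sum_distrib_left)

lemma card_less_insert:
  fixes i k :: "'i::{finite,linorder}"
  assumes "k \<notin> S"
  shows "card {j\<in>insert k S. j < i} = (if k < i then Suc (card {j\<in>S. j < i}) else card {j\<in>S. j < i})"
proof -
  have "{j\<in>insert k S. j < i} = (if k < i then insert k {j\<in>S. j < i} else {j\<in>S. j < i})"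
    by auto
  then show ?thesis using assms by simp
qed

lemma card_less_remove:
  fixes i k :: "'i::{finite,linorder}"
  assumes "k \<in> S"
  shows "card {j\<in>S. j < i} =
    (if k < i then Suc (card {j\<in>S - {k}. j < i}) else card {j\<in>S - {k}. j < i})"
  using card_less_insert[of k "S - {k}" i] assms by (simp add: insert_absorb)

lemma ext1_ext1: "ext1 i (ext1 k \<alpha>) = - ext1 k (ext1 i \<alpha>)"
proof -
  have "ext1 i (ext1 k \<alpha>) $ S = - ext1 k (ext1 i \<alpha>) $ S" for S
  proof (cases "i \<in> S \<and> k \<in> S \<and> i \<noteq> k")
    case True
    then have "S - {i} - {k} = S - {k} - {i}" by auto
    moreover have "i < k \<longleftrightarrow> \<not> k < i" using True by auto
    moreover have "card {j\<in>S. j < i} =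
        (if k < i then Suc (card {j\<in>S - {k}. j < i}) else card {j\<in>S - {k}. j < i})"
      "card {j\<in>S. j < k} =
        (if i < k then Suc (card {j\<in>S - {i}. j < k}) else card {j\<in>S - {i}. j < k})"
      using True card_less_remove by blast+
    ultimately show ?thesis
      using True unfolding ext1_def by (cases "k < i") simp_all
  qed (auto simp: ext1_def)
  then show ?thesis by (simp add: vec_eq_iff)
qed

lemma int1_ext1: "int1 i (ext1 k \<alpha>) = (if i = k then \<alpha> else 0) - ext1 k (int1 i \<alpha>)"
proof -
  have "int1 i (ext1 k \<alpha>) $ S = (if i = k then \<alpha> else 0) $ S - ext1 k (int1 i \<alpha>) $ S" for S
  proof (cases "i = k")
    case True
    show ?thesis
    proof (cases "k \<in> S")
      case k: True
      then have eq: "insert k S = S" "insert k (S - {k}) = S" by auto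
      show ?thesis using True k card_less_remove[of k S k]
        by (simp add: int1_def ext1_def eq flip: power_add mult.assoc)
    next
      case False
      then have eq: "insert k S - {k} = S" by auto
      show ?thesis using True False card_less_insert[of k S k]
        by (simp add: int1_def ext1_def eq flip: power_add mult.assoc)
    qed
  next
    case False
    show ?thesis
    proof (cases "k \<in> S \<and> i \<notin> S")
      case True
      then have eq: "insert i S - {k} = insert i (S - {k})" using False by auto
      show ?thesis
        using True False card_less_remove[of k S i] card_less_insert[of i S k]
        by (cases "k < i") (auto simp: int1_def ext1_def eq)
    qed (use False in \<open>auto simp: int1_def ext1_def\<close>)
  qed
  then show ?thesis by (simp add: vec_eq_iff)
qed

lemma wedge_wedge: "wedge v (wedge w \<alpha>) = - wedge w (wedge v \<alpha>)"
proof -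
  have "wedge v (wedge w \<alpha>) = (\<Sum>i\<in>UNIV. \<Sum>k\<in>UNIV. (v $ i * w $ k) *\<^sub>R ext1 i (ext1 k \<alpha>))"
    by (simp add: wedge_ext1 linear_sum[OF linear_ext1] linear_scale[OF linear_ext1] scaleR_sum_right)
  also have "\<dots> = - (\<Sum>k\<in>UNIV. \<Sum>i\<in>UNIV. (w $ k * v $ i) *\<^sub>R ext1 k (ext1 i \<alpha>))"
    unfolding sum_negf[symmetric]
    by (subst sum.swap, intro sum.cong refl, subst ext1_ext1) (simp add: mult.commute)
  also have "\<dots> = - wedge w (wedge v \<alpha>)"
    by (simp add: wedge_ext1 linear_sum[OF linear_ext1] linear_scale[OF linear_ext1] scaleR_sum_right)
  finally show ?thesis .
qed

lemma contract_wedge: "contract v (wedge w \<alpha>) = inner v w *\<^sub>R \<alpha> - wedge w (contract v \<alpha>)"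
proof -
  have "contract v (wedge w \<alpha>) = (\<Sum>i\<in>UNIV. \<Sum>k\<in>UNIV. (v $ i * w $ k) *\<^sub>R int1 i (ext1 k \<alpha>))"
    by (simp add: wedge_ext1 contract_int1 linear_sum[OF linear_int1] linear_scale[OF linear_int1]
        scaleR_sum_right)
  also have "\<dots> = (\<Sum>i\<in>UNIV. \<Sum>k\<in>UNIV. if i = k then (v $ i * w $ k) *\<^sub>R \<alpha> else 0)
      - (\<Sum>i\<in>UNIV. \<Sum>k\<in>UNIV. (v $ i * w $ k) *\<^sub>R ext1 k (int1 i \<alpha>))"
    unfolding sum_subtractf[symmetric]
    by (intro sum.cong refl) (simp add: int1_ext1 algebra_simps)
  also have "(\<Sum>i\<in>UNIV. \<Sum>k\<in>UNIV. (v $ i * w $ k) *\<^sub>R ext1 k (int1 i \<alpha>)) = wedge w (contract v \<alpha>)"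
    by (subst sum.swap) (simp add: wedge_ext1 contract_int1 linear_sum[OF linear_ext1]
        linear_scale[OF linear_ext1] scaleR_sum_right mult.commute)
  also have "(\<Sum>i\<in>UNIV. \<Sum>k\<in>UNIV. if i = k then (v $ i * w $ k) *\<^sub>R \<alpha> else 0) = inner v w *\<^sub>R \<alpha>"
    by (simp add: inner_vec_def scaleR_sum_left)
  finally show ?thesis .
qed

lemma wedge_contract_wedges:
  assumes "distinct ks"
  shows "wedge w (contract v (wedges (map b ks)))
    = (\<Sum>j\<in>set ks. inner v (b j) *\<^sub>R wedges (map (b(j := w)) ks))"
  using assms
proof (induction ks)
  case Nil
  have "contract v (axis {} 1) = 0"
    by (simp add: vec_eq_iff contract_def axis_def)
  then show ?case by (simp add: wedges_def linear_0[OF linear_wedge])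
next
  case (Cons k ks)
  have *: "map (b(k := w)) ks = map b ks"
    using Cons.prems by auto
  have "wedge w (contract v (wedges (map b (k # ks))))
      = wedge w (inner v (b k) *\<^sub>R wedges (map b ks) - wedge (b k) (contract v (wedges (map b ks))))"
    by (simp add: wedges_def contract_wedge)
  also have "\<dots> = inner v (b k) *\<^sub>R wedge w (wedges (map b ks))
      + wedge (b k) (wedge w (contract v (wedges (map b ks))))"
    by (simp add: linear_diff[OF linear_wedge] linear_scale[OF linear_wedge] wedge_wedge[of w "b k"])
  also have "wedge w (contract v (wedges (map b ks)))
      = (\<Sum>j\<in>set ks. inner v (b j) *\<^sub>R wedges (map (b(j := w)) ks))"
    using Cons.prems by (intro Cons.IH) simp
  also have "wedge (b k) \<dots>
      = (\<Sum>j\<in>set ks. inner v (b j) *\<^sub>R wedges (map (b(j := w)) (k # ks)))"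
    unfolding linear_sum[OF linear_wedge] linear_scale[OF linear_wedge]
    using Cons.prems by (intro sum.cong refl) (auto simp: wedges_def)
  also have "wedge w (wedges (map b ks)) = wedges (map (b(k := w)) (k # ks))"
    using * by (simp add: wedges_def del: map_eq_conv)
  finally have "wedge w (contract v (wedges (map b (k # ks))))
      = inner v (b k) *\<^sub>R wedges (map (b(k := w)) (k # ks))
        + (\<Sum>j\<in>set ks. inner v (b j) *\<^sub>R wedges (map (b(j := w)) (k # ks)))" .
  moreover have "(\<Sum>j\<in>set (k # ks). inner v (b j) *\<^sub>R wedges (map (b(j := w)) (k # ks)))
      = inner v (b k) *\<^sub>R wedges (map (b(k := w)) (k # ks))
        + (\<Sum>j\<in>set ks. inner v (b j) *\<^sub>R wedges (map (b(j := w)) (k # ks)))"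
    unfolding list.set using Cons.prems by (intro sum.insert) auto
  ultimately show ?case by (rule trans[OF _ sym])
qed

lemma inner_wedges_aux:
  assumes "distinct ks"
  shows "inner (wedges (map a ks)) (wedges (map b ks))
    = (\<Sum>\<pi> | \<pi> permutes set ks. of_int (sign \<pi>) * (\<Prod>i\<in>set ks. inner (a i) (b (\<pi> i))))"
  using assms
proof (induction ks arbitrary: b)
  case Nil
  show ?case by (simp add: wedges_def inner_axis_axis)
next
  case (Cons k ks)
  let ?S = "set ks"
  have k: "k \<notin> ?S" and d: "distinct ks" using Cons.prems by auto
  define F where "F b \<pi> = of_int (sign \<pi>) * (\<Prod>i\<in>?S. inner (a i) (b (\<pi> i)))" for b \<pi>
  have IH: "inner (wedges (map a ks)) (wedges (map b ks)) = (\<Sum>\<pi> | \<pi> permutes ?S. F b \<pi>)" for b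
    using Cons.IH[OF d] by (simp add: F_def)
  have "(\<Sum>\<pi> | \<pi> permutes set (k # ks).
          of_int (sign \<pi>) * (\<Prod>i\<in>set (k # ks). inner (a i) (b (\<pi> i))))
      = (\<Sum>j\<in>insert k ?S. \<Sum>q | q permutes ?S. of_int (sign (Transposition.transpose k j \<circ> q)) *
          (\<Prod>i\<in>insert k ?S. inner (a i) (b ((Transposition.transpose k j \<circ> q) i))))"
    unfolding list.set by (rule sum_over_permutations_insert) (use k in auto)
  also have "\<dots> = (\<Sum>j\<in>insert k ?S. \<Sum>q | q permutes ?S.
      (if j = k then 1 else -1) * inner (a k) (b j) * F (b \<circ> Transposition.transpose k j) q)"
  proof (intro sum.cong refl)
    fix j q assume "j \<in> insert k ?S" and "q \<in> {q. q permutes ?S}"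
    then have q: "q permutes ?S" by simp
    have "permutation q" using q by (auto simp: permutation_permutes)
    then have "sign (Transposition.transpose k j \<circ> q) = (if j = k then 1 else -1) * sign q"
      by (simp add: sign_compose permutation_swap_id sign_swap_id)
    moreover have "q k = k" using q k by (rule permutes_not_in)
    ultimately show "of_int (sign (Transposition.transpose k j \<circ> q)) *
          (\<Prod>i\<in>insert k ?S. inner (a i) (b ((Transposition.transpose k j \<circ> q) i)))
        = (if j = k then 1 else -1) * inner (a k) (b j) * F (b \<circ> Transposition.transpose k j) q"
      using k by (simp add: F_def)
  qed
  also have "\<dots> = (\<Sum>j\<in>insert k ?S. (if j = k then 1 else -1) * inner (a k) (b j) *
      inner (wedges (map a ks)) (wedges (map (b \<circ> Transposition.transpose k j) ks)))"
    unfolding IH by (simp add: sum_distrib_left)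
  also have "\<dots> = inner (a k) (b k) * inner (wedges (map a ks)) (wedges (map b ks)) -
      (\<Sum>j\<in>?S. inner (a k) (b j) *
        inner (wedges (map a ks)) (wedges (map (b(j := b k)) ks)))"
  proof -
    have 1: "map (b \<circ> Transposition.transpose k j) ks = map (b(j := b k)) ks" if "j \<in> ?S" for j
      using k by (auto simp: Transposition.transpose_def)
    have 2: "j \<noteq> k" if "j \<in> ?S" for j using k that by auto
    have "(\<Sum>j\<in>?S. (if j = k then 1 else -1) * inner (a k) (b j) *
        inner (wedges (map a ks)) (wedges (map (b \<circ> Transposition.transpose k j) ks)))
      = (\<Sum>j\<in>?S. - (inner (a k) (b j) *
        inner (wedges (map a ks)) (wedges (map (b(j := b k)) ks))))"
      by (intro sum.cong refl) (simp only: 1 2 if_False mult_minus_left mult_1_left)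
    then show ?thesis
      using k by (simp add: sum_negf del: map_eq_conv)
  qed
  also have "\<dots> = inner (wedges (map a ks))
      (inner (a k) (b k) *\<^sub>R wedges (map b ks) - wedge (b k) (contract (a k) (wedges (map b ks))))"
    unfolding wedge_contract_wedges[OF d] by (simp add: inner_diff_right inner_sum_right)
  also have "\<dots> = inner (wedges (map a (k # ks))) (wedges (map b (k # ks)))"
    by (simp add: wedges_def inner_wedge_contract contract_wedge)
  finally show ?case by simp
qed

theorem inner_wedges:
  assumes "length vs = p" and "length ws = p"
  shows "inner (wedges vs) (wedges ws)
    = (\<Sum>\<pi> | \<pi> permutes {..<p}. of_int (sign \<pi>) * (\<Prod>i<p. inner (vs ! i) (ws ! \<pi> i)))"
proof -
  have "map ((!) vs) [0..<p] = vs" "map ((!) ws) [0..<p] = ws"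
    using map_nth[of vs] map_nth[of ws] assms by simp_all
  with inner_wedges_aux[of "[0..<p]" "(!) vs" "(!) ws"] show ?thesis
    by (simp add: lessThan_atLeast0)
qed


section \<open>The Heisenberg group in standard coordinates\<close>

text \<open>The points of the Heisenberg group are identified with their standard coordinates, that is,
  the diffeomorphism \<open>F\<close> becomes the identity, and for \<open>n = CARD('n)\<close> the coordinates
  \<open>x\<^sub>k\<close>, \<open>x\<^bsub>k+n\<^esub>\<close>, \<open>x\<^bsub>2n+1\<^esub>\<close> are \<open>x $ HX k\<close>, \<open>x $ HY k\<close>, \<open>x $ HZ\<close>. Likewise the Lie algebra is
  identified with \<open>real ^ 'n hidx\<close>, the basis \<open>(X\<^sub>1, \<dots>, X\<^sub>2\<^sub>n, Z)\<close> being the standard one;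
  so \<open>exp\<close> is the identity as well.\<close>

datatype 'n hidx = HX 'n | HY 'n | HZ

lemma UNIV_hidx: "(UNIV :: 'a hidx set) = insert HZ (range HX \<union> range HY)"
proof -
  have "x = HZ \<or> x \<in> range HX \<or> x \<in> range HY" for x :: "'a hidx"
    by (cases x) simp_all
  then show ?thesis by blast
qed

instance hidx :: (finite) finite
  by standard (simp add: UNIV_hidx)

instantiation hidx :: (linorder) linorder
begin

fun less_eq_hidx :: "'a hidx \<Rightarrow> 'a hidx \<Rightarrow> bool" where
  "less_eq_hidx (HX j) (HX k) = (j \<le> k)"
| "less_eq_hidx (HX _) (HY _) = True"
| "less_eq_hidx (HY j) (HY k) = (j \<le> k)"
| "less_eq_hidx (HY _) (HX _) = False"
| "less_eq_hidx _ HZ = True"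
| "less_eq_hidx HZ (HX _) = False"
| "less_eq_hidx HZ (HY _) = False"

definition less_hidx :: "'a hidx \<Rightarrow> 'a hidx \<Rightarrow> bool" where
  "less_hidx i j \<longleftrightarrow> i \<le> j \<and> \<not> j \<le> i"

instance
proof
  fix i j k :: "'a hidx"
  show "i < j \<longleftrightarrow> i \<le> j \<and> \<not> j \<le> i" by (rule less_hidx_def)
  show "i \<le> i" by (cases i) auto
  show "i \<le> j \<Longrightarrow> j \<le> k \<Longrightarrow> i \<le> k" by (cases i; cases j; cases k) auto
  show "i \<le> j \<Longrightarrow> j \<le> i \<Longrightarrow> i = j" by (cases i; cases j) auto
  show "i \<le> j \<or> j \<le> i" by (cases i; cases j) auto
qed

end

lemma card_hidx: "CARD('n::finite hidx) = 2 * CARD('n) + 1"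
proof -
  have "card (range HX \<union> range HY :: 'n hidx set) = card (range HX :: 'n hidx set) + card (range HY :: 'n hidx set)"
    by (rule card_Un_disjoint) auto
  moreover have "HZ \<notin> (range HX \<union> range HY :: 'n hidx set)" by auto
  ultimately show ?thesis
    unfolding UNIV_hidx by (simp add: card_image inj_def)
qed

type_synonym 'n heis = "real ^ 'n hidx"

definition hmul :: "'n::finite heis \<Rightarrow> 'n heis \<Rightarrow> 'n heis" where
  "hmul x y = (\<chi> i. case i of
       HX k \<Rightarrow> x $ HX k + y $ HX k
     | HY k \<Rightarrow> x $ HY k + y $ HY k
     | HZ \<Rightarrow> x $ HZ + y $ HZ + (\<Sum>k\<in>UNIV. x $ HX k * y $ HY k - x $ HY k * y $ HX k))"

definition hdil :: "real \<Rightarrow> 'n::finite heis \<Rightarrow> 'n heis" where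
  "hdil r x = (\<chi> i. case i of
       HX k \<Rightarrow> r * x $ HX k
     | HY k \<Rightarrow> r * x $ HY k
     | HZ \<Rightarrow> r\<^sup>2 * x $ HZ)"

text \<open>The value at \<open>x\<close> of the left invariant vector field with value \<open>v\<close> at the unit element.\<close>

definition left_field :: "'n::finite heis \<Rightarrow> 'n heis \<Rightarrow> 'n heis" where
  "left_field v x = frechet_derivative (hmul x) (at 0) v"

lemma hidx_all: "(\<forall>i. P i) \<longleftrightarrow> (\<forall>k. P (HX k)) \<and> (\<forall>k. P (HY k)) \<and> P HZ"
  by (metis hidx.exhaust)

lemma hmul_nth:
  "hmul x y $ HX k = x $ HX k + y $ HX k"
  "hmul x y $ HY k = x $ HY k + y $ HY k"
  "hmul x y $ HZ = x $ HZ + y $ HZ + (\<Sum>k\<in>UNIV. x $ HX k * y $ HY k - x $ HY k * y $ HX k)"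
  by (simp_all add: hmul_def)

lemma linear_hmul_right: "linear (\<lambda>y. hmul x y - x)"
proof (rule linearI)
  fix y z :: "'a heis" and c :: real
  have "(\<Sum>k\<in>UNIV. x $ HX k * (y + z) $ HY k - x $ HY k * (y + z) $ HX k)
      = (\<Sum>k\<in>UNIV. x $ HX k * y $ HY k - x $ HY k * y $ HX k)
        + (\<Sum>k\<in>UNIV. x $ HX k * z $ HY k - x $ HY k * z $ HX k)"
    unfolding sum.distrib[symmetric] by (intro sum.cong refl) (simp add: distrib_left)
  then show "hmul x (y + z) - x = (hmul x y - x) + (hmul x z - x)"
    by (simp add: vec_eq_iff hidx_all hmul_nth)
  have "(\<Sum>k\<in>UNIV. x $ HX k * (c *\<^sub>R y) $ HY k - x $ HY k * (c *\<^sub>R y) $ HX k)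
      = c * (\<Sum>k\<in>UNIV. x $ HX k * y $ HY k - x $ HY k * y $ HX k)"
    unfolding sum_distrib_left by (intro sum.cong refl) (simp add: right_diff_distrib)
  then show "hmul x (c *\<^sub>R y) - x = c *\<^sub>R (hmul x y - x)"
    by (simp add: vec_eq_iff hidx_all hmul_nth distrib_left)
qed

lemma linear_hmul_left: "linear (\<lambda>x. hmul x y - y)"
proof (rule linearI)
  fix x z :: "'a heis" and c :: real
  have "(\<Sum>k\<in>UNIV. (x + z) $ HX k * y $ HY k - (x + z) $ HY k * y $ HX k)
      = (\<Sum>k\<in>UNIV. x $ HX k * y $ HY k - x $ HY k * y $ HX k)
        + (\<Sum>k\<in>UNIV. z $ HX k * y $ HY k - z $ HY k * y $ HX k)"
    unfolding sum.distrib[symmetric] by (intro sum.cong refl) (simp add: distrib_right)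
  then show "hmul (x + z) y - y = (hmul x y - y) + (hmul z y - y)"
    by (simp add: vec_eq_iff hidx_all hmul_nth)
  have "(\<Sum>k\<in>UNIV. (c *\<^sub>R x) $ HX k * y $ HY k - (c *\<^sub>R x) $ HY k * y $ HX k)
      = c * (\<Sum>k\<in>UNIV. x $ HX k * y $ HY k - x $ HY k * y $ HX k)"
    unfolding sum_distrib_left by (intro sum.cong refl) (simp add: right_diff_distrib)
  then show "hmul (c *\<^sub>R x) y - y = c *\<^sub>R (hmul x y - y)"
    by (simp add: vec_eq_iff hidx_all hmul_nth distrib_left)
qed

lemma has_derivative_affine:
  fixes f :: "'a::euclidean_space \<Rightarrow> 'b::real_normed_vector"
  assumes "linear (\<lambda>y. f y - c)"
  shows "(f has_derivative (\<lambda>y. f y - c)) (at y)"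
proof -
  have "((\<lambda>y. (f y - c) + c) has_derivative (\<lambda>y. f y - c)) (at y)"
    using assms by (intro has_derivative_add_const linear_imp_has_derivative)
  then show ?thesis by simp
qed

lemma left_field_eq: "left_field v x = hmul x v - x"
  unfolding left_field_def
  by (simp flip: frechet_derivative_at[OF has_derivative_affine[OF linear_hmul_right]])

lemma left_field_nth:
  "left_field v x $ HX k = v $ HX k"
  "left_field v x $ HY k = v $ HY k"
  "left_field v x $ HZ = v $ HZ + (\<Sum>k\<in>UNIV. x $ HX k * v $ HY k - x $ HY k * v $ HX k)"
  by (simp_all add: left_field_eq hmul_nth)

lemma left_field_bracket:
  fixes k l :: "'n::finite"
  defines "bracket \<equiv> \<lambda>V W (x::'n heis).
    frechet_derivative W (at x) (V x) - frechet_derivative V (at x) (W x)"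
  shows "bracket (left_field (axis (HX k) 1)) (left_field (axis (HY l) 1)) x
         = (if k = l then 2 *\<^sub>R left_field (axis HZ 1) x else 0)"
    and "bracket (left_field (axis (HX k) 1)) (left_field (axis (HX l) 1)) x = 0"
    and "bracket (left_field (axis (HY k) 1)) (left_field (axis (HY l) 1)) x = 0"
    and "bracket (left_field (axis HZ 1)) (left_field v) x = 0"
proof -
  have "linear (\<lambda>y. left_field v y - v)" for v :: "'n heis"
  proof -
    have "(\<lambda>y. left_field v y - v) = (\<lambda>y. (hmul y v - v) - y)"
      by (simp add: fun_eq_iff left_field_eq)
    then show ?thesis
      using linear_compose_sub[OF linear_hmul_left linear_ident] by simp
  qed
  then have D: "frechet_derivative (left_field v) (at y) = (\<lambda>h. left_field v h - v)"
    for v y :: "'n heis"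
    using frechet_derivative_at[OF has_derivative_affine] by metis
  have B: "bracket (left_field v) (left_field w) x =
      (2 * (\<Sum>k\<in>UNIV. v $ HX k * w $ HY k - v $ HY k * w $ HX k)) *\<^sub>R axis HZ 1"
    for v w :: "'n heis"
  proof -
    have "(\<Sum>k\<in>UNIV. w $ HX k * v $ HY k - w $ HY k * v $ HX k)
        = - (\<Sum>k\<in>UNIV. v $ HX k * w $ HY k - v $ HY k * w $ HX k)"
      unfolding sum_negf[symmetric] by (intro sum.cong refl) simp
    then show ?thesis
      by (simp add: bracket_def D vec_eq_iff hidx_all left_field_nth axis_def)
  qed
  have Z: "left_field (axis HZ 1) x = axis HZ 1"
    by (simp add: vec_eq_iff hidx_all left_field_nth axis_def)
  have *: "(\<Sum>j\<in>UNIV. (if j = k then 1 else 0) * (if j = l then 1 else 0 :: real))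
      = (if k = l then 1 else 0)"
    by (subst sum.mono_neutral_right[of UNIV "{k}"]) auto
  show "bracket (left_field (axis (HX k) 1)) (left_field (axis (HY l) 1)) x
         = (if k = l then 2 *\<^sub>R left_field (axis HZ 1) x else 0)"
    unfolding B Z by (simp add: axis_def * cong: if_cong)
  show "bracket (left_field (axis (HX k) 1)) (left_field (axis (HX l) 1)) x = 0"
    "bracket (left_field (axis (HY k) 1)) (left_field (axis (HY l) 1)) x = 0"
    "bracket (left_field (axis HZ 1)) (left_field v) x = 0"
    unfolding B by (simp_all add: axis_def)
qed

text \<open>The coordinates, in the frame \<open>(X\<^sub>1, \<dots>, X\<^sub>2\<^sub>n, Z)\<close>, of a vector tangent at \<open>x\<close>: this is the
  identification of the tangent space at \<open>x\<close> with the Lie algebra.\<close>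

definition left_coords :: "'n::finite heis \<Rightarrow> 'n heis \<Rightarrow> 'n heis" where
  "left_coords x = inv (\<lambda>v. left_field v x)"

lemma bij_left_field: "bij (\<lambda>v. left_field v x)"
proof (rule o_bij)
  define g where "g w = (\<chi> i. if i = HZ
    then w $ HZ - (\<Sum>k\<in>UNIV. x $ HX k * w $ HY k - x $ HY k * w $ HX k) else w $ i)" for w
  show "g \<circ> (\<lambda>v. left_field v x) = id" "(\<lambda>v. left_field v x) \<circ> g = id"
    by (simp_all add: fun_eq_iff vec_eq_iff hidx_all g_def left_field_nth)
qed

lemma left_coords_left_field: "left_coords x (left_field v x) = v"
  unfolding left_coords_def using bij_left_field by (metis bij_inv_eq_iff)

definition riem_metric :: "'n::finite heis \<Rightarrow> 'n heis \<Rightarrow> 'n heis \<Rightarrow> real" where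
  "riem_metric x v w = inner (left_coords x v) (left_coords x w)"

text \<open>The length is required to exist as an integral: a path that is \<open>valid_path\<close> may have
  unbounded speed near its finitely many exceptional points.\<close>

definition riem_dist :: "'n::finite heis \<Rightarrow> 'n heis \<Rightarrow> real" where
  "riem_dist x y = Inf {L. \<exists>\<gamma>. valid_path \<gamma> \<and> pathstart \<gamma> = x \<and> pathfinish \<gamma> = y \<and>
     ((\<lambda>t. sqrt (riem_metric (\<gamma> t) (vector_derivative \<gamma> (at t)) (vector_derivative \<gamma> (at t))))
        has_integral L) {0..1}}"

definition vol :: "nat \<Rightarrow> 'n::finite heis set \<Rightarrow> ennreal" where
  "vol p E = hausdorff riem_dist p E"

definition horizontal :: "'n::finite heis \<Rightarrow> 'n heis set" where
  "horizontal x = span {left_field (axis i 1) x | i. i \<noteq> HZ}"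

definition transverse_at :: "'n::finite heis set \<Rightarrow> 'n heis \<Rightarrow> bool" where
  "transverse_at M x \<longleftrightarrow> \<not> tangent_space M x \<subseteq> horizontal x"

definition homogeneous_distance :: "('n::finite heis \<Rightarrow> 'n heis \<Rightarrow> real) \<Rightarrow> bool" where
  "homogeneous_distance \<rho> \<longleftrightarrow>
     Metric_space UNIV \<rho> \<and>
     continuous_on UNIV (\<lambda>(x, y). \<rho> x y) \<and>
     (\<forall>x y z. \<rho> (hmul x y) (hmul x z) = \<rho> y z) \<and>
     (\<forall>r>0. \<forall>y z. \<rho> (hdil r y) (hdil r z) = r * \<rho> y z)"

abbreviation hball :: "('n::finite heis \<Rightarrow> 'n heis \<Rightarrow> real) \<Rightarrow> 'n heis \<Rightarrow> real \<Rightarrow> 'n heis set" where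
  "hball \<rho> \<equiv> Metric_space.mball UNIV \<rho>"


section \<open>Vertical tangent p-vectors and the metric factor\<close>

text \<open>The spaces of \<open>p\<close>-vectors at the points of the group are identified with the one of the Lie
  algebra, which sits in \<open>real ^ 'n hidx set\<close>.\<close>

definition vertical :: "nat \<Rightarrow> (real ^ ('n::{finite,linorder}) hidx set) set" where
  "vertical p = span {wedges (map (\<lambda>j. axis j 1) js @ [axis HZ 1]) | js.
     HZ \<notin> set js \<and> length js + 1 = p}"

definition tangent_pvector ::
    "nat \<Rightarrow> 'n heis set \<Rightarrow> 'n heis \<Rightarrow> real ^ ('n::{finite,linorder}) hidx set \<Rightarrow> bool" where
  "tangent_pvector p M x \<tau> \<longleftrightarrow>
     (\<exists>ts. length ts = p \<and> span (set ts) = tangent_space M x \<and>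
           (\<forall>i<p. \<forall>j<p. riem_metric x (ts ! i) (ts ! j) = (if i = j then 1 else 0)) \<and>
           \<tau> = wedges (map (left_coords x) ts))"

definition vertical_tangent_pvector ::
    "nat \<Rightarrow> 'n heis set \<Rightarrow> 'n heis \<Rightarrow> real ^ ('n::{finite,linorder}) hidx set \<Rightarrow> bool" where
  "vertical_tangent_pvector p M x \<tau> \<longleftrightarrow>
     (\<exists>\<sigma>. tangent_pvector p M x \<sigma> \<and> \<tau> = orth_proj (vertical p) \<sigma>)"

definition metric_factor ::
    "('n heis \<Rightarrow> 'n heis \<Rightarrow> real) \<Rightarrow> nat \<Rightarrow> real ^ ('n::{finite,linorder}) hidx set \<Rightarrow> ennreal" where
  "metric_factor \<rho> p \<tau> = hausdorff dist p ({v. wedge v \<tau> = 0} \<inter> hball \<rho> 0 1)"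

end

theory Submission
  imports Defs
begin

text \<open>Why the theorem holds. Write \<open>\<xi> q = x\<^bsup>-1\<^esup> q\<close>, an affine map whose linear part
  \<open>left_coords x\<close> is an isometry from the metric at \<open>x\<close> to the Euclidean one. Near \<open>x\<close> the
  Riemannian distance of \<open>q\<close> and \<open>q'\<close> is \<open>\<bar>\<xi> q - \<xi> q'\<bar>\<close> up to a factor close to \<open>1\<close>
  (\<open>riem_dist_near\<close>), so the Riemannian measure of a small piece of the submanifold may be replaced
  by the Euclidean Hausdorff measure of its image under \<open>\<xi>\<close>. A point of the ball \<open>B\<^bsub>x,r\<^esub>\<close> is one
  with \<open>\<rho> 0 (\<xi> q) < r\<close>.

  Let \<open>T\<close> be the tangent space in these coordinates, \<open>Z\<close> the vertical unit vector, \<open>y\<close> the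
  orthogonal projection of \<open>Z\<close> to \<open>T\<close> and \<open>\<kappa> = \<bar>y\<bar>\<close>; transversality means \<open>\<kappa> > 0\<close>. With \<open>W\<close>
  the horizontal part of \<open>T\<close> one has \<open>T = W + \<real>y\<close>, and computing with exterior and interior
  multiplication gives \<open>\<bar>\<tau>\<bar> = \<kappa>\<close> and \<open>{v. v \<and> \<tau> = 0} = L\<close> where \<open>L = W + \<real>Z\<close>
  (\<open>norm_wedge_contract\<close>, \<open>kernel_wedge_contract\<close>, \<open>orth_proj_vertical\<close>). So the limit has to
  be \<open>\<kappa>\<^bsup>-1\<^esup>\<close> times the measure of the unit ball of \<open>L\<close>.

  The submanifold is viewed as a graph over \<open>L\<close>, not over \<open>T\<close>. Since \<open>Z\<close> lies in \<open>L\<close>, the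
  orthogonal projection to \<open>L\<close> moves points in horizontal directions only. A horizontal
  displacement of size \<open>o(r)\<close> tends to \<open>0\<close> under the dilation by \<open>1 / r\<close>, whereas a vertical one would have
  to be \<open>o(r\<^sup>2)\<close>, which is more than a graph of class \<open>C\<^sup>1\<close> provides. Hence the projection of
  the part of the submanifold in \<open>B\<^bsub>x,r\<^esub>\<close> lies between the balls of \<open>L\<close> of radii \<open>r / l\<close> and \<open>l r\<close>, for each
  \<open>l > 1\<close> and all small \<open>r\<close> (\<open>proj_ball_sandwich\<close>). On \<open>T\<close> this projection sends \<open>y\<close>
  to \<open>\<kappa>\<^sup>2 Z\<close> and fixes \<open>W\<close>; following it by the stretch of the direction \<open>Z\<close> by \<open>1 / \<kappa>\<close> yields an
  isometry of \<open>T\<close>, hence a map that is almost isometric on the submanifold near \<open>x\<close>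
  (\<open>flat_almost_isometric\<close>).

  It remains to know how the Hausdorff measure of an open subset of \<open>L\<close> changes when one direction is
  stretched by \<open>s\<close>: it is multiplied by \<open>s\<close> (\<open>hausdorff_stretch\<close>). This accounts for the factor
  \<open>1 / \<kappa>\<close>, and, as a dilation by \<open>r\<close> is a homothety after a stretch, both of ratio \<open>r\<close>, for the
  exponent \<open>p + 1\<close>. The reason is that disjoint half-open boxes become separated when shrunk a little
  towards their centres, so that the measure is additive on them; a rational stretch of a cube is a matter of counting, a real one of
  monotonicity, and a relatively open set is a disjoint union of dyadic cubes.\<close>

section \<open>Hausdorff measures under Lipschitz maps and unions\<close>

lemma diam_mono: "S \<subseteq> T \<Longrightarrow> diam d S \<le> diam d T"
  unfolding diam_def by (intro SUP_mono) (meson SUP_mono order_refl subset_eq)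

lemma diam_image_le:
  assumes "\<And>x y. x \<in> S \<Longrightarrow> y \<in> S \<Longrightarrow> d' (f x) (f y) \<le> K * d x y" and "K \<ge> 0"
  shows "diam d' (f ` S) \<le> ennreal K * diam d S"
proof -
  have "ennreal (d' (f x) (f y)) \<le> ennreal K * diam d S" if "x \<in> S" "y \<in> S" for x y
  proof -
    have "ennreal (d' (f x) (f y)) \<le> ennreal (K * d x y)"
      using assms(1)[OF that] by (rule ennreal_leI)
    also have "\<dots> = ennreal K * ennreal (d x y)"
      using assms(2) by (rule ennreal_mult')
    also have "ennreal (d x y) \<le> diam d S"
      unfolding diam_def using that by (meson SUP_upper2 order_refl)
    finally show ?thesis by (simp add: mult_left_mono)
  qed
  then show ?thesis
    unfolding diam_def[of d'] by (auto intro!: SUP_least)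
qed

lemma hausdorff_gauge_mono: "S \<subseteq> T \<Longrightarrow> hausdorff_gauge d p S \<le> hausdorff_gauge d p T"
  unfolding hausdorff_gauge_def
  by (auto intro!: mult_left_mono power_mono diam_mono)

lemma hausdorff_pre_mono: "E \<subseteq> F \<Longrightarrow> hausdorff_pre d p \<delta> E \<le> hausdorff_pre d p \<delta> F"
  unfolding hausdorff_pre_def by (rule INF_superset_mono) auto

lemma hausdorff_pre_antimono: "\<delta> \<le> \<delta>' \<Longrightarrow> hausdorff_pre d p \<delta>' E \<le> hausdorff_pre d p \<delta> E"
  unfolding hausdorff_pre_def
  by (rule INF_superset_mono) (auto intro: order_trans ennreal_leI)

lemma hausdorff_mono: "E \<subseteq> F \<Longrightarrow> hausdorff d p E \<le> hausdorff d p F"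
  unfolding hausdorff_def by (intro SUP_mono) (auto intro: hausdorff_pre_mono)

lemma hausdorff_empty: "hausdorff d p {} = 0"
proof -
  have "hausdorff_pre d p \<delta> {} \<le> (\<Sum>k::nat. hausdorff_gauge d p {})" if "\<delta> > 0" for \<delta>
    unfolding hausdorff_pre_def
    by (rule INF_lower2[where i = "\<lambda>_. {}"]) (auto simp: diam_def bot_ennreal)
  then have "hausdorff d p {} \<le> 0"
    unfolding hausdorff_def by (intro SUP_least) (auto simp: hausdorff_gauge_def)
  then show ?thesis by simp
qed

text \<open>Multiplication by a positive real is invertible on \<open>ennreal\<close>, so it commutes with infima.\<close>

lemma le_mult_INF_ennreal:
  assumes c: "c > 0" and le: "\<And>i. i \<in> I \<Longrightarrow> a \<le> ennreal c * f i"
  shows "a \<le> ennreal c * (INF i\<in>I. f i)"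
proof -
  have inv: "ennreal (1 / c) * ennreal c = 1" "ennreal c * ennreal (1 / c) = 1"
    using c by (simp_all flip: ennreal_mult)
  have "ennreal (1 / c) * a \<le> f i" if "i \<in> I" for i
  proof -
    have "ennreal (1 / c) * a \<le> ennreal (1 / c) * (ennreal c * f i)"
      using le[OF that] by (rule mult_left_mono) simp
    also have "\<dots> = f i" using inv(1) by (metis mult.assoc mult_1)
    finally show ?thesis .
  qed
  then have "ennreal (1 / c) * a \<le> (INF i\<in>I. f i)"
    by (rule INF_greatest)
  then have "ennreal c * (ennreal (1 / c) * a) \<le> ennreal c * (INF i\<in>I. f i)"
    by (rule mult_left_mono) simp
  moreover have "ennreal c * (ennreal (1 / c) * a) = a"
    using inv(2) by (metis mult.assoc mult_1)
  ultimately show ?thesis by simp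
qed

text \<open>A cover of \<open>E\<close> is cut down to \<open>E\<close> before \<open>f\<close> is applied, because the Lipschitz bound is assumed
  on \<open>E\<close> alone. The two distances are arbitrary, as one of them will be Riemannian.\<close>

lemma hausdorff_lipschitz_image:
  assumes lip: "\<And>x y. x \<in> E \<Longrightarrow> y \<in> E \<Longrightarrow> d' (f x) (f y) \<le> K * d x y" and K: "K > 0"
  shows "hausdorff d' p (f ` E) \<le> ennreal (K ^ p) * hausdorff d p E"
proof -
  have gauge: "hausdorff_gauge d' p (f ` (C \<inter> E)) \<le> ennreal (K ^ p) * hausdorff_gauge d p C" for C
  proof (cases "C \<inter> E = {}")
    case False
    have "diam d' (f ` (C \<inter> E)) \<le> ennreal K * diam d (C \<inter> E)"
      by (rule diam_image_le) (use lip K in auto)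
    also have "\<dots> \<le> ennreal K * diam d C"
      by (intro mult_left_mono diam_mono) auto
    finally have "diam d' (f ` (C \<inter> E)) ^ p \<le> (ennreal K * diam d C) ^ p"
      by (rule power_mono) simp
    also have "\<dots> = ennreal (K ^ p) * diam d C ^ p"
      using K by (simp add: power_mult_distrib ennreal_power)
    finally have "ennreal (unit_ball_vol (real p) / 2 ^ p) * diam d' (f ` (C \<inter> E)) ^ p
        \<le> ennreal (unit_ball_vol (real p) / 2 ^ p) * (ennreal (K ^ p) * diam d C ^ p)"
      by (rule mult_left_mono) simp
    then show ?thesis
      using False unfolding hausdorff_gauge_def by (auto simp: mult.left_commute)
  qed (simp add: hausdorff_gauge_def)
  have pre: "hausdorff_pre d' p \<delta> (f ` E) \<le> ennreal (K ^ p) * hausdorff_pre d p (\<delta> / K) E"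
    if "\<delta> > 0" for \<delta>
  proof -
    have "hausdorff_pre d' p \<delta> (f ` E) \<le> ennreal (K ^ p) * (\<Sum>k. hausdorff_gauge d p (C k))"
      if C: "E \<subseteq> (\<Union>k. C k)" "\<forall>k. diam d (C k) \<le> ennreal (\<delta> / K)" for C :: "nat \<Rightarrow> _"
    proof -
      have "diam d' (f ` (C k \<inter> E)) \<le> ennreal \<delta>" for k
      proof -
        have "diam d' (f ` (C k \<inter> E)) \<le> ennreal K * diam d (C k \<inter> E)"
          by (rule diam_image_le) (use lip K in auto)
        also have "\<dots> \<le> ennreal K * diam d (C k)"
          by (intro mult_left_mono diam_mono) auto
        also have "\<dots> \<le> ennreal K * ennreal (\<delta> / K)"
          using C(2) by (intro mult_left_mono) auto
        also have "\<dots> = ennreal \<delta>"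
          using K \<open>\<delta> > 0\<close> by (simp flip: ennreal_mult)
        finally show ?thesis .
      qed
      moreover have "f ` E \<subseteq> (\<Union>k. f ` (C k \<inter> E))" using C(1) by blast
      ultimately have "hausdorff_pre d' p \<delta> (f ` E) \<le> (\<Sum>k. hausdorff_gauge d' p (f ` (C k \<inter> E)))"
        unfolding hausdorff_pre_def by (intro INF_lower) blast
      also have "\<dots> \<le> (\<Sum>k. ennreal (K ^ p) * hausdorff_gauge d p (C k))"
        using gauge by (intro suminf_le) auto
      finally show ?thesis by simp
    qed
    then show ?thesis
      unfolding hausdorff_pre_def[of d] using K by (intro le_mult_INF_ennreal) simp_all
  qed
  show ?thesis
    unfolding hausdorff_def[of d']
  proof (rule SUP_least)
    fix \<delta> :: real assume "\<delta> \<in> {0<..}"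
    then have "\<delta> > 0" by simp
    then have "hausdorff_pre d p (\<delta> / K) E \<le> hausdorff d p E"
      unfolding hausdorff_def using K by (intro SUP_upper) simp
    then have "ennreal (K ^ p) * hausdorff_pre d p (\<delta> / K) E \<le> ennreal (K ^ p) * hausdorff d p E"
      by (rule mult_left_mono) simp
    with pre[OF \<open>\<delta> > 0\<close>] show "hausdorff_pre d' p \<delta> (f ` E) \<le> ennreal (K ^ p) * hausdorff d p E"
      by (rule order_trans)
  qed
qed

lemma hausdorff_le_of_expanding:
  assumes "\<And>x y. x \<in> E \<Longrightarrow> y \<in> E \<Longrightarrow> d x y \<le> K * d' (f x) (f y)" and "inj_on f E" and "K > 0"
  shows "hausdorff d p E \<le> ennreal (K ^ p) * hausdorff d' p (f ` E)"
proof -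
  have "hausdorff d p (inv_into E f ` f ` E) \<le> ennreal (K ^ p) * hausdorff d' p (f ` E)"
    using assms by (intro hausdorff_lipschitz_image) (auto simp: inv_into_f_f)
  then show ?thesis
    using inv_into_image_cancel[OF assms(2) subset_refl] by simp
qed

lemma hausdorff_scaled_isometry:
  assumes d: "\<And>x y. x \<in> E \<Longrightarrow> y \<in> E \<Longrightarrow> dist (f x) (f y) = K * dist x y" and K: "K > 0"
  shows "hausdorff dist p (f ` E) = ennreal (K ^ p) * hausdorff dist p E"
proof (rule antisym)
  show "hausdorff dist p (f ` E) \<le> ennreal (K ^ p) * hausdorff dist p E"
    using d K by (intro hausdorff_lipschitz_image) auto
  have inj: "inj_on f E"
  proof (rule inj_onI)
    fix x y assume "x \<in> E" "y \<in> E" "f x = f y"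
    then show "x = y" using d[of x y] K by simp
  qed
  have "hausdorff dist p E \<le> ennreal ((1 / K) ^ p) * hausdorff dist p (f ` E)"
    using d K inj by (intro hausdorff_le_of_expanding) auto
  then have "ennreal (K ^ p) * hausdorff dist p E
      \<le> ennreal (K ^ p) * (ennreal ((1 / K) ^ p) * hausdorff dist p (f ` E))"
    by (rule mult_left_mono) simp
  also have "\<dots> = ennreal (K ^ p * (1 / K) ^ p) * hausdorff dist p (f ` E)"
    using K by (simp add: ennreal_mult mult.assoc)
  also have "K ^ p * (1 / K) ^ p = 1"
    using K by (simp flip: power_mult_distrib)
  finally show "ennreal (K ^ p) * hausdorff dist p E \<le> hausdorff dist p (f ` E)" by simp
qed

text \<open>Covers of the \<open>E i\<close> that are optimal up to \<open>e / 2 ^ Suc i\<close> are merged into one sequence.\<close>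

lemma hausdorff_pre_countable_Un:
  fixes E :: "nat \<Rightarrow> 'a set"
  shows "hausdorff_pre d p \<delta> (\<Union>i. E i) \<le> (\<Sum>i. hausdorff_pre d p \<delta> (E i))"
proof (rule ennreal_le_epsilon)
  fix e :: real
  assume fin: "(\<Sum>i. hausdorff_pre d p \<delta> (E i)) < top" and e: "e > 0"
  let ?cov = "\<lambda>i C. E i \<subseteq> (\<Union>k. C k) \<and> (\<forall>k. diam d (C k) \<le> ennreal \<delta>)"
  have "\<exists>C::nat \<Rightarrow> 'a set. ?cov i C \<and> (\<Sum>k. hausdorff_gauge d p (C k))
      \<le> hausdorff_pre d p \<delta> (E i) + ennreal (e * (1/2) ^ Suc i)" for i
  proof -
    have fin_i: "hausdorff_pre d p \<delta> (E i) \<noteq> \<infinity>"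
      using ennreal_suminf_lessD[OF fin, of i] by simp
    have pos: "0 < e * (1/2) ^ Suc i" using e by simp
    obtain C :: "nat \<Rightarrow> 'a set" where C: "C \<in> {C. ?cov i C}" and less: "(\<Sum>k. hausdorff_gauge d p (C k))
        < hausdorff_pre d p \<delta> (E i) + ennreal (e * (1/2) ^ Suc i)"
      using INF_approx_ennreal[OF pos hausdorff_pre_def fin_i] by (elim bexE)
    show ?thesis
      by (rule exI[of _ C]) (use C less_imp_le[OF less] in simp)
  qed
  then have "\<forall>i. \<exists>C. ?cov i C \<and> (\<Sum>k. hausdorff_gauge d p (C k))
      \<le> hausdorff_pre d p \<delta> (E i) + ennreal (e * (1/2) ^ Suc i)" by (rule allI)
  from choice[OF this] obtain C where C: "\<forall>i. ?cov i (C i) \<and> (\<Sum>k. hausdorff_gauge d p (C i k))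
      \<le> hausdorff_pre d p \<delta> (E i) + ennreal (e * (1/2) ^ Suc i)" ..
  then have C: "E i \<subseteq> (\<Union>k. C i k)" "diam d (C i k) \<le> ennreal \<delta>"
    "(\<Sum>k. hausdorff_gauge d p (C i k)) \<le> hausdorff_pre d p \<delta> (E i) + ennreal (e * (1/2) ^ Suc i)" for i k
    by (simp_all del: power_Suc)
  define D where "D n = case_prod C (prod_decode n)" for n
  have "(\<Union>i. E i) \<subseteq> (\<Union>n. D n)"
  proof
    fix x assume "x \<in> (\<Union>i. E i)"
    then obtain i where "x \<in> E i" by blast
    with C(1)[of i] have "x \<in> (\<Union>k. C i k)" by (rule subsetD)
    then obtain k where "x \<in> C i k" by blast
    then have "x \<in> D (prod_encode (i, k))" by (simp add: D_def)
    then show "x \<in> (\<Union>n. D n)" by blast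
  qed
  moreover have "diam d (D n) \<le> ennreal \<delta>" for n
    using C(2) by (simp add: D_def case_prod_beta)
  ultimately have "D \<in> {C. (\<Union>i. E i) \<subseteq> (\<Union>k. C k) \<and> (\<forall>k. diam d (C k) \<le> ennreal \<delta>)}"
    by (simp only: mem_Collect_eq simp_thms)
  then have "hausdorff_pre d p \<delta> (\<Union>i. E i) \<le> (\<Sum>n. hausdorff_gauge d p (D n))"
    unfolding hausdorff_pre_def by (rule INF_lower)
  also have "\<dots> = (\<Sum>i. \<Sum>k. hausdorff_gauge d p (C i k))"
    using suminf_ennreal_2dimen[where f = "\<lambda>(i, k). hausdorff_gauge d p (C i k)"]
    by (simp add: comp_def D_def case_prod_beta)
  also have "\<dots> \<le> (\<Sum>i. hausdorff_pre d p \<delta> (E i) + ennreal (e * (1/2) ^ Suc i))"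
    by (rule suminf_le[OF C(3)]) auto
  also have "\<dots> = (\<Sum>i. hausdorff_pre d p \<delta> (E i)) + (\<Sum>i. ennreal (e * (1/2) ^ Suc i))"
    by (intro suminf_add[symmetric]) auto
  also have "(\<Sum>i. ennreal (e * (1/2) ^ Suc i)) = ennreal e"
    using e sums_mult[OF power_half_series, of e] by (intro suminf_ennreal_eq) auto
  finally show "hausdorff_pre d p \<delta> (\<Union>i. E i) \<le> (\<Sum>i. hausdorff_pre d p \<delta> (E i)) + ennreal e" .
qed

lemma hausdorff_countable_Un:
  fixes E :: "nat \<Rightarrow> 'a set"
  shows "hausdorff d p (\<Union>i. E i) \<le> (\<Sum>i. hausdorff d p (E i))"
  unfolding hausdorff_def[of d p "\<Union>i. E i"]
proof (rule SUP_least)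
  fix \<delta> :: real assume "\<delta> \<in> {0<..}"
  then have "hausdorff_pre d p \<delta> (E i) \<le> hausdorff d p (E i)" for i
    unfolding hausdorff_def by (rule SUP_upper)
  then have "(\<Sum>i. hausdorff_pre d p \<delta> (E i)) \<le> (\<Sum>i. hausdorff d p (E i))"
    by (intro suminf_le) auto
  then show "hausdorff_pre d p \<delta> (\<Union>i. E i) \<le> (\<Sum>i. hausdorff d p (E i))"
    using hausdorff_pre_countable_Un order_trans by blast
qed

text \<open>A set of diameter less than \<open>\<eta>\<close> meets at most one of the two pieces, so a fine cover of the union
  splits into covers of the pieces.\<close>

lemma hausdorff_Un_separated:
  assumes \<eta>: "\<eta> > 0" and sep: "\<And>x y. x \<in> E \<Longrightarrow> y \<in> F \<Longrightarrow> \<eta> \<le> d x y"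
  shows "hausdorff d p E + hausdorff d p F \<le> hausdorff d p (E \<union> F)"
proof -
  have pre: "hausdorff_pre d p \<delta> E + hausdorff_pre d p \<delta> F \<le> hausdorff_pre d p \<delta> (E \<union> F)"
    if \<delta>: "\<delta> < \<eta>" for \<delta>
    unfolding hausdorff_pre_def[of d p \<delta> "E \<union> F"]
  proof (rule INF_greatest, safe)
    fix C :: "nat \<Rightarrow> 'a set"
    assume C: "E \<union> F \<subseteq> (\<Union>k. C k)" "\<forall>k. diam d (C k) \<le> ennreal \<delta>"
    have sub: "diam d (C k \<inter> S) \<le> ennreal \<delta>" for k S
      using C(2) diam_mono[of "C k \<inter> S" "C k" d] by (meson Int_lower1 order_trans)
    have "hausdorff_pre d p \<delta> E + hausdorff_pre d p \<delta> F
      \<le> (\<Sum>k. hausdorff_gauge d p (C k \<inter> E)) + (\<Sum>k. hausdorff_gauge d p (C k \<inter> F))"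
      unfolding hausdorff_pre_def
      by (intro add_mono; rule INF_lower2[where i = "\<lambda>k. C k \<inter> _"]) (use C(1) sub in auto)
    also have "\<dots> = (\<Sum>k. hausdorff_gauge d p (C k \<inter> E) + hausdorff_gauge d p (C k \<inter> F))"
      by (intro suminf_add) auto
    also have "\<dots> \<le> (\<Sum>k. hausdorff_gauge d p (C k))"
    proof (intro suminf_le)
      fix k
      have "C k \<inter> E = {} \<or> C k \<inter> F = {}"
      proof (rule ccontr)
        assume "\<not> ?thesis"
        then obtain x y where xy: "x \<in> C k" "x \<in> E" "y \<in> C k" "y \<in> F" by blast
        then have "ennreal (d x y) \<le> diam d (C k)"
          unfolding diam_def by (meson SUP_upper2 order_refl)
        also have "\<dots> \<le> ennreal \<delta>" using C(2) by blast
        also have "\<dots> < ennreal \<eta>" using \<delta> \<eta> by (simp add: ennreal_lessI)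
        finally show False using sep[OF xy(2,4)] by (simp add: ennreal_leI leD)
      qed
      then show "hausdorff_gauge d p (C k \<inter> E) + hausdorff_gauge d p (C k \<inter> F) \<le> hausdorff_gauge d p (C k)"
        using hausdorff_gauge_mono[of "C k \<inter> E" "C k" d p] hausdorff_gauge_mono[of "C k \<inter> F" "C k" d p]
        by (auto simp: hausdorff_gauge_def[of _ _ "{}"])
    qed auto
    finally show "hausdorff_pre d p \<delta> E + hausdorff_pre d p \<delta> F \<le> (\<Sum>k. hausdorff_gauge d p (C k))" .
  qed
  have both: "hausdorff_pre d p \<delta> E + hausdorff_pre d p \<delta>' F \<le> hausdorff d p (E \<union> F)"
    if "\<delta> > 0" "\<delta>' > 0" for \<delta> \<delta>'
  proof -
    define m where "m = min (\<eta> / 2) (min \<delta> \<delta>')"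
    have m: "m > 0" "m < \<eta>" "m \<le> \<delta>" "m \<le> \<delta>'" using that \<eta> by (auto simp: m_def)
    have "hausdorff_pre d p \<delta> E + hausdorff_pre d p \<delta>' F \<le> hausdorff_pre d p m E + hausdorff_pre d p m F"
      using m by (intro add_mono hausdorff_pre_antimono)
    also have "\<dots> \<le> hausdorff_pre d p m (E \<union> F)" by (rule pre[OF m(2)])
    also have "\<dots> \<le> hausdorff d p (E \<union> F)"
      unfolding hausdorff_def using m by (intro SUP_upper) simp
    finally show ?thesis .
  qed
  have ne: "{0::real<..} \<noteq> {}" using zero_less_one by blast
  have 1: "hausdorff_pre d p \<delta> E + hausdorff d p F \<le> hausdorff d p (E \<union> F)" if "\<delta> > 0" for \<delta>
    unfolding hausdorff_def[of d p F] ennreal_SUP_add_right[OF ne]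
    using both that by (intro SUP_least) auto
  show ?thesis
    unfolding hausdorff_def[of d p E] ennreal_SUP_add_left[OF ne, symmetric]
    using 1 by (intro SUP_least) auto
qed

section \<open>Additivity on boxes and the effect of a stretch\<close>

text \<open>Homothetic images of ratio below \<open>1\<close> have compact closure inside the set. So disjoint sets of this
  kind are at positive distance once shrunk, which makes the Hausdorff measure additive on them.\<close>

definition shrinkable :: "'a::real_normed_vector set \<Rightarrow> bool" where
  "shrinkable S \<longleftrightarrow> (\<exists>c. \<forall>t\<in>{0<..<1}.
     compact (closure ((\<lambda>x. c + t *\<^sub>R (x - c)) ` S)) \<and> closure ((\<lambda>x. c + t *\<^sub>R (x - c)) ` S) \<subseteq> S)"

lemma shrinkable_empty: "shrinkable {}"
  by (simp add: shrinkable_def)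

lemma sum_hausdorff_compact_le:
  fixes K :: "'i \<Rightarrow> 'a::heine_borel set"
  assumes "finite I" and "\<And>i. i \<in> I \<Longrightarrow> compact (closure (K i))"
    and "disjoint_family_on (\<lambda>i. closure (K i)) I"
  shows "(\<Sum>i\<in>I. hausdorff dist p (K i)) \<le> hausdorff dist p (\<Union>i\<in>I. K i)"
  using assms
proof (induction I rule: finite_induct)
  case (insert j I)
  have "closure (K j) \<inter> (\<Union>i\<in>I. closure (K i)) = {}"
    using insert.hyps insert.prems by (force simp: disjoint_family_on_def)
  moreover have "closed (\<Union>i\<in>I. closure (K i))"
    using insert.hyps by auto
  ultimately obtain \<eta> where "\<eta> > 0" and \<eta>: "\<forall>x\<in>closure (K j). \<forall>y\<in>(\<Union>i\<in>I. closure (K i)). \<eta> \<le> dist x y"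
    using separate_compact_closed insert.prems(1) by (metis insertI1)
  have "\<eta> \<le> dist x y" if "x \<in> K j" "y \<in> (\<Union>i\<in>I. K i)" for x y
    using \<eta> that closure_subset by blast
  then have "hausdorff dist p (K j) + hausdorff dist p (\<Union>i\<in>I. K i)
      \<le> hausdorff dist p (K j \<union> (\<Union>i\<in>I. K i))"
    using \<open>\<eta> > 0\<close> by (intro hausdorff_Un_separated) auto
  moreover have "(\<Sum>i\<in>I. hausdorff dist p (K i)) \<le> hausdorff dist p (\<Union>i\<in>I. K i)"
    using insert.prems by (intro insert.IH) (auto simp: disjoint_family_on_def)
  ultimately have "hausdorff dist p (K j) + (\<Sum>i\<in>I. hausdorff dist p (K i))
      \<le> hausdorff dist p (K j \<union> (\<Union>i\<in>I. K i))"
    by (meson add_left_mono order_trans)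
  then show ?case using insert.hyps by simp
qed (simp add: hausdorff_empty)

lemma ennreal_le_of_scaled_le:
  fixes a b :: ennreal
  assumes "\<And>t. 0 < t \<Longrightarrow> t < 1 \<Longrightarrow> ennreal (t ^ p) * a \<le> b"
  shows "a \<le> b"
proof -
  have "((\<lambda>t::real. ennreal (t ^ p) * a) \<longlongrightarrow> ennreal (1 ^ p) * a) (at_left 1)"
    by (intro tendsto_mult_ennreal tendsto_ennrealI tendsto_intros) auto
  moreover have "\<forall>\<^sub>F t in at_left (1::real). ennreal (t ^ p) * a \<le> b"
    using eventually_at_left_real[of 0 "1::real"] by (auto elim!: eventually_mono intro: assms)
  ultimately show ?thesis
    by (intro tendsto_upperbound[of _ a "at_left (1::real)"]) auto
qed

text \<open>Shrinking by \<open>t\<close> costs only the factor \<open>t ^ p\<close> and makes the sets separated; then \<open>t\<close> tends to \<open>1\<close>.\<close>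

lemma sum_hausdorff_shrinkable_le:
  fixes S :: "'i \<Rightarrow> 'a::euclidean_space set"
  assumes "finite I" and sh: "\<And>i. i \<in> I \<Longrightarrow> shrinkable (S i)" and disj: "disjoint_family_on S I"
  shows "(\<Sum>i\<in>I. hausdorff dist p (S i)) \<le> hausdorff dist p (\<Union>i\<in>I. S i)"
proof (rule ennreal_le_of_scaled_le)
  fix t :: real assume t: "0 < t" "t < 1"
  from sh obtain c where c: "\<And>i. i \<in> I \<Longrightarrow> compact (closure ((\<lambda>x. c i + t *\<^sub>R (x - c i)) ` S i))"
    "\<And>i. i \<in> I \<Longrightarrow> closure ((\<lambda>x. c i + t *\<^sub>R (x - c i)) ` S i) \<subseteq> S i"
    using t unfolding shrinkable_def by (metis greaterThanLessThan_iff)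
  define K where "K i = (\<lambda>x. c i + t *\<^sub>R (x - c i)) ` S i" for i
  have H: "hausdorff dist p (K i) = ennreal (t ^ p) * hausdorff dist p (S i)" for i
    unfolding K_def using t
    by (intro hausdorff_scaled_isometry) (simp_all add: dist_norm flip: scaleR_diff_right)
  have "ennreal (t ^ p) * (\<Sum>i\<in>I. hausdorff dist p (S i)) = (\<Sum>i\<in>I. hausdorff dist p (K i))"
    by (simp add: H sum_distrib_left)
  also have "\<dots> \<le> hausdorff dist p (\<Union>i\<in>I. K i)"
  proof (rule sum_hausdorff_compact_le[OF \<open>finite I\<close>])
    show "compact (closure (K i))" if "i \<in> I" for i
      using c(1)[OF that] by (simp add: K_def)
    have "closure (K i) \<inter> closure (K j) \<subseteq> S i \<inter> S j" if "i \<in> I" "j \<in> I" for i j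
      using c(2)[OF that(1)] c(2)[OF that(2)] by (auto simp: K_def)
    then show "disjoint_family_on (\<lambda>i. closure (K i)) I"
      using disj unfolding disjoint_family_on_def by blast
  qed
  also have "\<dots> \<le> hausdorff dist p (\<Union>i\<in>I. S i)"
  proof (intro hausdorff_mono UN_mono)
    show "K i \<subseteq> S i" if "i \<in> I" for i
      using c(2)[OF that] closure_subset[of "K i"] by (simp add: K_def)
  qed simp
  finally show "ennreal (t ^ p) * (\<Sum>i\<in>I. hausdorff dist p (S i)) \<le> hausdorff dist p (\<Union>i\<in>I. S i)" .
qed

lemma hausdorff_UN_shrinkable:
  fixes S :: "nat \<Rightarrow> 'a::euclidean_space set"
  assumes "\<And>i. shrinkable (S i)" and "disjoint_family S"
  shows "hausdorff dist p (\<Union>i. S i) = (\<Sum>i. hausdorff dist p (S i))"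
proof (rule antisym[OF hausdorff_countable_Un])
  show "(\<Sum>i. hausdorff dist p (S i)) \<le> hausdorff dist p (\<Union>i. S i)"
  proof (rule suminf_le_const)
    fix n
    have "(\<Sum>i<n. hausdorff dist p (S i)) \<le> hausdorff dist p (\<Union>i<n. S i)"
      using assms by (intro sum_hausdorff_shrinkable_le) (auto simp: disjoint_family_on_def)
    also have "\<dots> \<le> hausdorff dist p (\<Union>i. S i)"
      by (intro hausdorff_mono) auto
    finally show "(\<Sum>i<n. hausdorff dist p (S i)) \<le> hausdorff dist p (\<Union>i. S i)" .
  qed auto
qed

definition orthonormal :: "'a::real_inner set \<Rightarrow> bool" where
  "orthonormal B \<longleftrightarrow> finite B \<and> (\<forall>b\<in>B. \<forall>c\<in>B. b \<bullet> c = (if b = c then 1 else 0))"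

lemma orthonormal_coords:
  assumes "orthonormal B" "b \<in> B"
  shows "(\<Sum>c\<in>B. x c *\<^sub>R c) \<bullet> b = x b"
proof -
  have "(\<Sum>c\<in>B. x c *\<^sub>R c) \<bullet> b = (\<Sum>c\<in>B. if c = b then x b else 0)"
    unfolding inner_sum_left using assms by (intro sum.cong) (auto simp: orthonormal_def)
  then show ?thesis using assms by (simp add: orthonormal_def)
qed

lemma sum_scaleR_in_span: "(\<Sum>c\<in>B. x c *\<^sub>R c) \<in> span B"
  by (intro span_sum span_scale span_base)

lemma orthonormal_expansion:
  assumes "orthonormal B" "v \<in> span B"
  shows "v = (\<Sum>b\<in>B. (v \<bullet> b) *\<^sub>R b)"
proof -
  obtain x where x: "v = (\<Sum>b\<in>B. x b *\<^sub>R b)"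
    using assms by (auto simp: orthonormal_def span_finite)
  show ?thesis
    unfolding x by (intro sum.cong refl) (simp add: orthonormal_coords[OF assms(1)])
qed

lemma orthonormal_eqI:
  assumes "orthonormal B" "v \<in> span B" "w \<in> span B" "\<And>b. b \<in> B \<Longrightarrow> v \<bullet> b = w \<bullet> b"
  shows "v = w"
  using orthonormal_expansion[OF assms(1,2)] orthonormal_expansion[OF assms(1,3)] assms(4) by simp

lemma orthonormal_norm_le:
  assumes "orthonormal B" "v \<in> span B"
  shows "norm v \<le> (\<Sum>b\<in>B. \<bar>v \<bullet> b\<bar>)"
proof -
  have 1: "norm b = 1" if "b \<in> B" for b
    using assms(1) that by (simp add: orthonormal_def norm_eq_1)
  have "norm (\<Sum>b\<in>B. (v \<bullet> b) *\<^sub>R b) \<le> (\<Sum>b\<in>B. \<bar>v \<bullet> b\<bar>)"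
    by (rule order_trans[OF norm_sum]) (simp add: 1)
  then show ?thesis using orthonormal_expansion[OF assms] by simp
qed

text \<open>Half-open, so that boxes tile.\<close>

definition obox :: "'a::real_inner set \<Rightarrow> ('a \<Rightarrow> real) \<Rightarrow> ('a \<Rightarrow> real) \<Rightarrow> 'a set" where
  "obox B l u = {v \<in> span B. \<forall>b\<in>B. l b \<le> v \<bullet> b \<and> v \<bullet> b < u b}"

lemma shrinkable_obox:
  fixes B :: "'a::euclidean_space set"
  assumes B: "orthonormal B"
  shows "shrinkable (obox B l u)"
proof (cases "obox B l u = {}")
  case False
  then have lu: "l b < u b" if "b \<in> B" for b
    using that by (force simp: obox_def)
  define m where "m b = (l b + u b) / 2" for b
  define c where "c = (\<Sum>b\<in>B. m b *\<^sub>R b)"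
  have c: "c \<in> span B" "\<And>b. b \<in> B \<Longrightarrow> c \<bullet> b = m b"
    using orthonormal_coords[OF B] by (auto simp: c_def sum_scaleR_in_span)
  have "compact (closure ((\<lambda>x. c + t *\<^sub>R (x - c)) ` obox B l u)) \<and>
        closure ((\<lambda>x. c + t *\<^sub>R (x - c)) ` obox B l u) \<subseteq> obox B l u" if t: "0 < t" "t < 1" for t
  proof -
    define K where "K = span B \<inter> (\<Inter>b\<in>B. {v. m b + t * (l b - m b) \<le> v \<bullet> b \<and> v \<bullet> b \<le> m b + t * (u b - m b)})"
    have "closed {v. m b + t * (l b - m b) \<le> v \<bullet> b \<and> v \<bullet> b \<le> m b + t * (u b - m b)}" for b
      by (intro closed_Collect_conj closed_Collect_le continuous_intros)
    then have "closed K"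
      unfolding K_def by (intro closed_Int closed_span closed_INT ballI)
    have "K \<subseteq> obox B l u"
    proof
      fix v assume v: "v \<in> K"
      have "l b \<le> v \<bullet> b \<and> v \<bullet> b < u b" if b: "b \<in> B" for b
      proof -
        have "(1 - t) * l b < (1 - t) * m b" "(1 - t) * m b < (1 - t) * u b"
          using lu[OF b] t by (auto simp: m_def)
        then show ?thesis using v b by (auto simp: K_def algebra_simps)
      qed
      then show "v \<in> obox B l u" using v by (auto simp: obox_def K_def)
    qed
    moreover have "(\<lambda>x. c + t *\<^sub>R (x - c)) ` obox B l u \<subseteq> K"
    proof safe
      fix x assume x: "x \<in> obox B l u"
      have "t * (l b - m b) \<le> t * (x \<bullet> b - m b)" "t * (x \<bullet> b - m b) \<le> t * (u b - m b)" if "b \<in> B" for b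
        using x t that by (auto simp: obox_def less_imp_le)
      then show "c + t *\<^sub>R (x - c) \<in> K"
        using x c by (auto simp: K_def obox_def inner_add_left inner_diff_left
            intro!: span_add span_scale span_diff)
    qed
    moreover have "bounded K"
    proof (rule boundedI)
      fix v assume v: "v \<in> K"
      then have "norm v \<le> (\<Sum>b\<in>B. \<bar>v \<bullet> b\<bar>)"
        by (intro orthonormal_norm_le[OF B]) (simp add: K_def)
      also have "\<dots> \<le> (\<Sum>b\<in>B. \<bar>m b + t * (l b - m b)\<bar> + \<bar>m b + t * (u b - m b)\<bar>)"
        using v by (intro sum_mono) (auto simp: K_def)
      finally show "norm v \<le> (\<Sum>b\<in>B. \<bar>m b + t * (l b - m b)\<bar> + \<bar>m b + t * (u b - m b)\<bar>)" .
    qed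
    ultimately show ?thesis
      using \<open>closed K\<close> by (meson bounded_subset closure_minimal compact_closure order_trans)
  qed
  then show ?thesis unfolding shrinkable_def by (intro exI[of _ c] ballI) auto
qed (simp add: shrinkable_empty)

lemma hausdorff_obox_scale:
  fixes B :: "'a::euclidean_space set"
  assumes B: "orthonormal B" and h: "h > 0"
  shows "hausdorff dist p (obox B l (\<lambda>b. l b + h * w b))
       = ennreal (h ^ p) * hausdorff dist p (obox B (\<lambda>_. 0) w)"
proof -
  define a where "a = (\<Sum>b\<in>B. l b *\<^sub>R b)"
  have a: "a \<in> span B" "\<And>b. b \<in> B \<Longrightarrow> a \<bullet> b = l b"
    using orthonormal_coords[OF B] by (auto simp: a_def sum_scaleR_in_span)
  have "obox B l (\<lambda>b. l b + h * w b) = (\<lambda>v. a + h *\<^sub>R v) ` obox B (\<lambda>_. 0) w"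
  proof safe
    fix v assume v: "v \<in> obox B l (\<lambda>b. l b + h * w b)"
    have "v = a + h *\<^sub>R ((1 / h) *\<^sub>R (v - a))" using h by simp
    moreover have "(1 / h) *\<^sub>R (v - a) \<in> obox B (\<lambda>_. 0) w"
      using v a h unfolding obox_def
      by (auto simp: inner_diff_left field_simps intro!: span_scale span_diff)
    ultimately show "v \<in> (\<lambda>v. a + h *\<^sub>R v) ` obox B (\<lambda>_. 0) w" by blast
  next
    fix v assume "v \<in> obox B (\<lambda>_. 0) w"
    then show "a + h *\<^sub>R v \<in> obox B l (\<lambda>b. l b + h * w b)"
      using a h by (auto simp: obox_def inner_add_left intro!: span_scale span_add)
  qed
  then show ?thesis
    using h by (simp add: hausdorff_scaled_isometry dist_norm flip: scaleR_diff_right)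
qed

text \<open>The functional equation of Cauchy for monotone functions, with values that may be infinite.\<close>

lemma additive_mono_linear:
  fixes f :: "real \<Rightarrow> ennreal"
  assumes mono: "\<And>s t. 0 < s \<Longrightarrow> s \<le> t \<Longrightarrow> f s \<le> f t"
    and add: "\<And>k s. 0 < s \<Longrightarrow> 0 < k \<Longrightarrow> f (real k * s) = of_nat k * f s"
    and s: "s > 0"
  shows "f s = ennreal s * f 1"
proof -
  have rat: "f (real k / real n) = ennreal (real k / real n) * f 1" if "k > 0" "n > 0" for k n
  proof -
    have "of_nat n * f (real k / real n) = f (real k)"
      using add[of "real k / real n" n] that by simp
    also have "\<dots> = of_nat k * f 1"
      using add[of 1 k] that by simp
    finally have "ennreal (1 / real n) * (of_nat n * f (real k / real n)) = ennreal (1 / real n) * (of_nat k * f 1)"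
      by simp
    moreover have "ennreal (1 / real n) * of_nat n = 1" "ennreal (1 / real n) * of_nat k = ennreal (real k / real n)"
      using that unfolding ennreal_of_nat_eq_real_of_nat by (simp_all flip: ennreal_mult)
    ultimately show ?thesis by (simp flip: mult.assoc)
  qed
  have lower: "\<forall>\<^sub>F n in sequentially. ennreal (s - 1 / real n) * f 1 \<le> f s"
  proof -
    have "\<forall>\<^sub>F n in sequentially. 1 / s < real n"
      using filterlim_at_top_dense filterlim_real_sequentially by blast
    then show ?thesis
    proof eventually_elim
      case (elim n)
      then have n: "n > 0" using s by (cases n) (auto simp: divide_less_0_iff)
      define k where "k = nat \<lfloor>s * real n\<rfloor>"
      have "s * real n > 1" using elim s by (simp add: field_simps)
      then have k: "real k \<le> s * real n" "s * real n - 1 \<le> real k" "k > 0"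
        unfolding k_def by linarith+
      have "s - 1 / real n = (s * real n - 1) / real n" using n by (simp add: field_simps)
      also have "\<dots> \<le> real k / real n" using k by (intro divide_right_mono) auto
      finally have "ennreal (s - 1 / real n) * f 1 \<le> ennreal (real k / real n) * f 1"
        by (intro mult_right_mono ennreal_leI) auto
      also have "\<dots> = f (real k / real n)" using rat k n by simp
      also have "\<dots> \<le> f s" using k n by (intro mono) (auto simp: field_simps)
      finally show ?case .
    qed
  qed
  have upper: "f s \<le> ennreal (s + 1 / real n) * f 1" if n: "n > 0" for n
  proof -
    define k where "k = nat \<lceil>s * real n\<rceil>"
    have "s * real n > 0" using s n by simp
    then have k: "s * real n \<le> real k" "real k \<le> s * real n + 1" "k > 0"
      unfolding k_def by linarith+
    have "f s \<le> f (real k / real n)" using k n s by (intro mono) (auto simp: field_simps)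
    also have "\<dots> = ennreal (real k / real n) * f 1" using rat k n by simp
    also have "\<dots> \<le> ennreal (s + 1 / real n) * f 1"
      using k n by (intro mult_right_mono ennreal_leI) (auto simp: field_simps)
    finally show ?thesis .
  qed
  have n0: "(\<lambda>n. 1 / real n) \<longlonglongrightarrow> 0" by (rule lim_1_over_n)
  have "(\<lambda>n. ennreal (s - 1 / real n) * f 1) \<longlonglongrightarrow> ennreal (s - 0) * f 1"
    using s by (intro tendsto_mult_ennreal tendsto_ennrealI tendsto_intros n0) auto
  then have "ennreal s * f 1 \<le> f s"
    using lower by (intro tendsto_upperbound[of _ "ennreal s * f 1"]) auto
  moreover have "(\<lambda>n. ennreal (s + 1 / real n) * f 1) \<longlonglongrightarrow> ennreal (s + 0) * f 1"
    using s by (intro tendsto_mult_ennreal tendsto_ennrealI tendsto_intros n0) auto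
  then have "f s \<le> ennreal s * f 1"
    using upper by (intro tendsto_lowerbound[of _ "ennreal s * f 1"])
      (auto intro: eventually_mono[OF eventually_gt_at_top[of 0]])
  ultimately show ?thesis by (intro antisym)
qed

text \<open>A box of side \<open>k s\<close> in the direction \<open>e\<close> is tiled by \<open>k\<close> translates of the one of side \<open>s\<close>.\<close>

lemma hausdorff_obox_stretch:
  fixes B :: "'a::euclidean_space set"
  assumes B: "orthonormal B" and e: "e \<in> B" and s: "s > 0"
  shows "hausdorff dist p (obox B (\<lambda>_. 0) (\<lambda>b. if b = e then s else 1))
       = ennreal s * hausdorff dist p (obox B (\<lambda>_. 0) (\<lambda>_. 1))"
proof -
  define f where "f s = hausdorff dist p (obox B (\<lambda>_. 0) (\<lambda>b. if b = e then s else 1))" for s :: real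
  have "f s = ennreal s * f 1"
  proof (rule additive_mono_linear[OF _ _ s])
    fix s t :: real assume "s \<le> t"
    then show "f s \<le> f t" unfolding f_def
      by (intro hausdorff_mono) (fastforce simp: obox_def)
  next
    fix s :: real and k :: nat assume s: "s > 0" and k: "k > 0"
    define l where "l j b = (if b = e then real j * s else 0)" for j :: nat and b
    define Q where "Q j = (if j < k then obox B (l j) (\<lambda>b. l j b + 1 * (if b = e then s else 1)) else {})" for j
    have "disjoint_family Q"
    proof -
      have "i = j" if "v \<in> Q i" "v \<in> Q j" for v i j
      proof -
        have "real i * s \<le> v \<bullet> e" "v \<bullet> e < (real i + 1) * s" "real j * s \<le> v \<bullet> e" "v \<bullet> e < (real j + 1) * s"
          using that e by (auto simp: Q_def obox_def l_def algebra_simps split: if_splits)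
        then have "real i * s < (real j + 1) * s" "real j * s < (real i + 1) * s" by linarith+
        then show ?thesis using s by (simp add: mult_less_cancel_right)
      qed
      then show ?thesis by (auto simp: disjoint_family_on_def)
    qed
    moreover have "shrinkable (Q j)" for j
      using shrinkable_obox[OF B] by (simp add: Q_def shrinkable_empty)
    ultimately have "hausdorff dist p (\<Union>j. Q j) = (\<Sum>j. hausdorff dist p (Q j))"
      by (intro hausdorff_UN_shrinkable)
    also have "hausdorff dist p (Q j) = (if j < k then f s else 0)" for j
      using hausdorff_obox_scale[OF B, of 1 p "l j" "\<lambda>b. if b = e then s else 1"]
      by (simp add: Q_def f_def hausdorff_empty)
    then have "(\<Sum>j. hausdorff dist p (Q j)) = (\<Sum>j<k. f s)"
      by (subst suminf_finite[of "{..<k}"]) auto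
    also have "(\<Union>j. Q j) = obox B (\<lambda>_. 0) (\<lambda>b. if b = e then real k * s else 1)"
    proof safe
      fix v j assume "v \<in> Q j"
      then have v: "j < k" "v \<in> obox B (l j) (\<lambda>b. l j b + 1 * (if b = e then s else 1))"
        by (auto simp: Q_def split: if_splits)
      have "real j * s \<le> v \<bullet> e" "v \<bullet> e < (real j + 1) * s"
        using v e by (auto simp: obox_def l_def algebra_simps)
      moreover have "(real j + 1) * s \<le> real k * s" using v s by (intro mult_right_mono) auto
      moreover have "0 \<le> real j * s" using s by simp
      ultimately have "0 \<le> v \<bullet> e" "v \<bullet> e < real k * s" by linarith+
      then show "v \<in> obox B (\<lambda>_. 0) (\<lambda>b. if b = e then real k * s else 1)"
        using v by (auto simp: obox_def l_def)
    next
      fix v assume v: "v \<in> obox B (\<lambda>_. 0) (\<lambda>b. if b = e then real k * s else 1)"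
      define j where "j = nat \<lfloor>v \<bullet> e / s\<rfloor>"
      have ve: "0 \<le> v \<bullet> e / s" "v \<bullet> e / s < real k" using v e s by (auto simp: obox_def field_simps)
      then have jle: "real j \<le> v \<bullet> e / s" and "v \<bullet> e / s < real j + 1" unfolding j_def by linarith+
      with jle have j: "real j * s \<le> v \<bullet> e" "v \<bullet> e < real j * s + s"
        using s ve by (auto simp: field_simps)
      have "real j < real k" using ve jle by linarith
      then have "j < k" by simp
      then have "v \<in> Q j" using v j by (auto simp: Q_def obox_def l_def)
      then show "v \<in> (\<Union>j. Q j)" by blast
    qed
    finally show "f (real k * s) = of_nat k * f s" by (simp add: f_def)
  qed
  then show ?thesis by (simp add: f_def)
qed

lemma floor_power2_coarsen:
  fixes x y :: real
  assumes "\<lfloor>2 ^ k * x\<rfloor> = \<lfloor>2 ^ k * y\<rfloor>" and "m \<le> k"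
  shows "\<lfloor>2 ^ m * x\<rfloor> = \<lfloor>2 ^ m * y\<rfloor>"
proof -
  have "\<lfloor>2 ^ m * z\<rfloor> = \<lfloor>2 ^ k * z\<rfloor> div 2 ^ (k - m)" for z :: real
  proof -
    have "2 ^ m * z = (2 ^ k * z) / real_of_int (2 ^ (k - m))"
      using assms(2) by (simp add: field_simps flip: power_add)
    then show ?thesis by (simp only: floor_divide_real_eq_div zero_le_power zero_le_numeral)
  qed
  then show ?thesis using assms(1) by simp
qed

text \<open>The largest dyadic cubes of side at most \<open>1\<close> contained in \<open>A\<close> are disjoint. The dyadic cube of
  generation \<open>m\<close> through \<open>v\<close> is treated as an equivalence class \<open>C m v\<close>, which makes nesting and
  disjointness immediate.\<close>

lemma relatively_open_cube_decomposition:
  fixes B :: "'a::euclidean_space set"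
  assumes B: "orthonormal B" and A: "openin (top_of_set (span B)) A"
  obtains Q :: "nat \<Rightarrow> 'a set" where "disjoint_family Q" "(\<Union>i. Q i) = A"
    "\<And>i. Q i = {} \<or> (\<exists>l h. h > 0 \<and> Q i = obox B l (\<lambda>b. l b + h))"
proof -
  define C where "C m v = {w \<in> span B. \<forall>b\<in>B. \<lfloor>2 ^ m * (w \<bullet> b)\<rfloor> = \<lfloor>2 ^ m * (v \<bullet> b)\<rfloor>}" for m :: nat and v
  have fin: "finite B" using B by (simp add: orthonormal_def)
  have self: "v \<in> C m v" if "v \<in> span B" for m v
    using that by (simp add: C_def)
  have class_eq: "C m w = C m v" if "w \<in> C m v" for m v w
    using that by (auto simp: C_def)
  have coarsen: "C k v \<subseteq> C m v" if "m \<le> k" for m k v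
    unfolding C_def using floor_power2_coarsen[OF _ that] by blast
  have cube: "C m v = obox B (\<lambda>b. of_int \<lfloor>2 ^ m * (v \<bullet> b)\<rfloor> / 2 ^ m) (\<lambda>b. of_int \<lfloor>2 ^ m * (v \<bullet> b)\<rfloor> / 2 ^ m + 1 / 2 ^ m)"
    for m v
  proof -
    have "\<lfloor>2 ^ m * x\<rfloor> = z \<longleftrightarrow> of_int z / 2 ^ m \<le> x \<and> x < of_int z / 2 ^ m + 1 / 2 ^ m" for x :: real and z
      unfolding floor_eq_iff by (simp add: field_simps)
    then show ?thesis by (simp add: C_def obox_def)
  qed
  have small: "\<exists>m. C m v \<subseteq> A" if v: "v \<in> A" for v
  proof -
    have vB: "v \<in> span B" using v openin_imp_subset[OF A] by blast
    obtain r where r: "r > 0" "ball v r \<inter> span B \<subseteq> A"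
      using A v unfolding openin_contains_ball by blast
    obtain m where m: "real (card B) / r < 2 ^ m"
      using real_arch_pow[of 2] by auto
    have "C m v \<subseteq> A"
    proof
      fix w assume w: "w \<in> C m v"
      have "\<bar>(w - v) \<bullet> b\<bar> \<le> 1 / 2 ^ m" if "b \<in> B" for b
      proof -
        have "\<bar>2 ^ m * (w \<bullet> b) - 2 ^ m * (v \<bullet> b)\<bar> \<le> 1"
        proof -
          have "\<lfloor>2 ^ m * (w \<bullet> b)\<rfloor> = \<lfloor>2 ^ m * (v \<bullet> b)\<rfloor>" using w that by (simp add: C_def)
          then show ?thesis by linarith
        qed
        then have "2 ^ m * \<bar>(w - v) \<bullet> b\<bar> \<le> 1"
          by (simp add: inner_diff_left abs_mult flip: right_diff_distrib)
        then show ?thesis by (simp add: field_simps)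
      qed
      then have "(\<Sum>b\<in>B. \<bar>(w - v) \<bullet> b\<bar>) \<le> real (card B) * (1 / 2 ^ m)"
        by (intro sum_bounded_above) auto
      moreover have "norm (w - v) \<le> (\<Sum>b\<in>B. \<bar>(w - v) \<bullet> b\<bar>)"
        using w vB by (intro orthonormal_norm_le[OF B] span_diff) (auto simp: C_def)
      moreover have "real (card B) * (1 / 2 ^ m) < r"
        using m r(1) by (simp add: field_simps)
      ultimately have "w \<in> ball v r" by (simp add: dist_norm norm_minus_commute)
      then show "w \<in> A" using r(2) w by (auto simp: C_def)
    qed
    then show ?thesis ..
  qed
  define M where "M v = (LEAST m. C m v \<subseteq> A)" for v
  have M: "C (M v) v \<subseteq> A" if "v \<in> A" for v
    unfolding M_def using small[OF that] by (rule LeastI_ex)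
  define \<Q> where "\<Q> = (\<lambda>v. C (M v) v) ` A"
  have AB: "A \<subseteq> span B" by (rule openin_imp_subset[OF A])
  have "\<Union>\<Q> = A"
    using M self AB unfolding \<Q>_def by blast
  have le: "C (M v) v = C (M v') v'" if "v \<in> A" "v' \<in> A" "w \<in> C (M v) v" "w \<in> C (M v') v'" "M v \<le> M v'"
    for v v' w
  proof -
    have "w \<in> C (M v) v'" using that coarsen by blast
    then have eq: "C (M v) v' = C (M v) v" using that(3) class_eq by blast
    then have "M v' \<le> M v" unfolding M_def[of v'] using M[OF that(1)] by (intro Least_le) simp
    then show ?thesis using eq that(5) by simp
  qed
  have disj: "X = Y" if XY: "X \<in> \<Q>" "Y \<in> \<Q>" "X \<inter> Y \<noteq> {}" for X Y
  proof -
    obtain v where v: "X = C (M v) v" "v \<in> A" using XY(1) by (auto simp: \<Q>_def)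
    obtain v' where v': "Y = C (M v') v'" "v' \<in> A" using XY(2) by (auto simp: \<Q>_def)
    obtain w where "w \<in> X" "w \<in> Y" using XY(3) by blast
    with v v' show ?thesis using le[of v v' w] le[of v' v w] by (metis nat_le_linear)
  qed
  have "countable \<Q>"
  proof -
    define g where "g = (\<lambda>(m::nat, z). obox B (\<lambda>b. of_int (z b) / 2 ^ m) (\<lambda>b. of_int (z b) / 2 ^ m + 1 / 2 ^ m))"
    have "C m v = g (m, \<lambda>b\<in>B. \<lfloor>2 ^ m * (v \<bullet> b)\<rfloor>)" for m v
      unfolding cube g_def by (auto simp: obox_def)
    then have "C m v \<in> g ` (UNIV \<times> (B \<rightarrow>\<^sub>E UNIV))" for m v
      by (intro image_eqI) auto
    then have "\<Q> \<subseteq> g ` (UNIV \<times> (B \<rightarrow>\<^sub>E UNIV))"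
      unfolding \<Q>_def by (intro image_subsetI)
    moreover have "countable (UNIV \<times> (B \<rightarrow>\<^sub>E (UNIV :: int set)) :: (nat \<times> _) set)"
      using fin by (intro countable_SIGMA countable_PiE) auto
    ultimately show ?thesis by (meson countable_image countable_subset)
  qed
  define Q where "Q i = (if i \<in> to_nat_on \<Q> ` \<Q> then from_nat_into \<Q> i else {})" for i
  have Q: "Q (to_nat_on \<Q> X) = X" if "X \<in> \<Q>" for X
    using that \<open>countable \<Q>\<close> by (simp add: Q_def)
  have Q': "Q i = {} \<or> (Q i \<in> \<Q> \<and> to_nat_on \<Q> (Q i) = i)" for i
    using \<open>countable \<Q>\<close> by (auto simp: Q_def)
  show thesis
  proof
    show "disjoint_family Q"
      unfolding disjoint_family_on_def using Q' disj by (metis inf_bot_left inf_bot_right)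
    show "(\<Union>i. Q i) = A"
    proof
      show "(\<Union>i. Q i) \<subseteq> A" using Q' \<open>\<Union>\<Q> = A\<close> by blast
      show "A \<subseteq> (\<Union>i. Q i)" using Q \<open>\<Union>\<Q> = A\<close> by blast
    qed
    show "Q i = {} \<or> (\<exists>l h. h > 0 \<and> Q i = obox B l (\<lambda>b. l b + h))" for i
    proof (cases "Q i = {}")
      case False
      then obtain v where "Q i = C (M v) v" using Q' unfolding \<Q>_def by blast
      then have "0 < 1 / (2::real) ^ M v \<and> Q i = obox B (\<lambda>b. of_int \<lfloor>2 ^ M v * (v \<bullet> b)\<rfloor> / 2 ^ M v)
          (\<lambda>b. of_int \<lfloor>2 ^ M v * (v \<bullet> b)\<rfloor> / 2 ^ M v + 1 / 2 ^ M v)"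
        by (simp add: cube)
      then show ?thesis by metis
    qed simp
  qed
qed

definition stretch :: "'a::real_inner \<Rightarrow> real \<Rightarrow> 'a \<Rightarrow> 'a" where
  "stretch e s v = v + ((s - 1) * (v \<bullet> e)) *\<^sub>R e"

lemma stretch_inner:
  assumes "orthonormal B" "e \<in> B" "b \<in> B"
  shows "stretch e s v \<bullet> b = (if b = e then s else 1) * (v \<bullet> b)"
  using assms by (auto simp: stretch_def orthonormal_def inner_add_left algebra_simps)

lemma stretch_in_span: "e \<in> B \<Longrightarrow> v \<in> span B \<Longrightarrow> stretch e s v \<in> span B"
  by (simp add: stretch_def span_add span_scale span_base)

lemma stretch_obox:
  assumes B: "orthonormal B" and e: "e \<in> B" and s: "s > 0"
  shows "stretch e s ` obox B l u
       = obox B (\<lambda>b. (if b = e then s else 1) * l b) (\<lambda>b. (if b = e then s else 1) * u b)"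
proof safe
  fix v assume "v \<in> obox B l u"
  then show "stretch e s v \<in> obox B (\<lambda>b. (if b = e then s else 1) * l b) (\<lambda>b. (if b = e then s else 1) * u b)"
    using s by (auto simp: obox_def stretch_inner[OF B e] stretch_in_span[OF e])
next
  fix v assume v: "v \<in> obox B (\<lambda>b. (if b = e then s else 1) * l b) (\<lambda>b. (if b = e then s else 1) * u b)"
  have "stretch e s (stretch e (1 / s) v) = v"
    using v s by (intro orthonormal_eqI[OF B])
      (auto simp: obox_def stretch_inner[OF B e] intro!: stretch_in_span[OF e])
  moreover have "stretch e (1 / s) v \<in> obox B l u"
    using v s by (auto simp: obox_def stretch_inner[OF B e] stretch_in_span[OF e] field_simps split: if_splits)
  ultimately show "v \<in> stretch e s ` obox B l u" by (metis imageI)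
qed

text \<open>The stretch of each dyadic cube is a box, for which the claim is known, and both decompositions are
  disjoint.\<close>

theorem hausdorff_stretch:
  fixes B :: "'a::euclidean_space set"
  assumes B: "orthonormal B" and e: "e \<in> B" and s: "s > 0"
    and A: "openin (top_of_set (span B)) A"
  shows "hausdorff dist p (stretch e s ` A) = ennreal s * hausdorff dist p A"
proof -
  obtain Q where Q: "disjoint_family Q" "(\<Union>i. Q i) = A"
    "\<And>i::nat. Q i = {} \<or> (\<exists>l h. h > 0 \<and> Q i = obox B l (\<lambda>b. l b + h))"
    using relatively_open_cube_decomposition[OF B A] by metis
  have sub: "Q i \<subseteq> span B" for i
    using Q(2) openin_imp_subset[OF A] by blast
  have inj: "inj_on (stretch e s) (span B)"
  proof (rule inj_onI)
    fix v w assume vw: "v \<in> span B" "w \<in> span B" "stretch e s v = stretch e s w"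
    have pos: "(if b = e then s else 1) \<noteq> 0" for b using s by simp
    have "(if b = e then s else 1) * (v \<bullet> b) = (if b = e then s else 1) * (w \<bullet> b)" if "b \<in> B" for b
      unfolding stretch_inner[OF B e that, symmetric] vw(3) ..
    then have "v \<bullet> b = w \<bullet> b" if "b \<in> B" for b
      using that pos[of b] mult_left_cancel by blast
    then show "v = w" using vw by (intro orthonormal_eqI[OF B])
  qed
  have disj: "disjoint_family (\<lambda>i. stretch e s ` Q i)"
    using Q(1) sub inj unfolding disjoint_family_on_def by (metis image_empty inj_on_image_Int)
  have sh: "shrinkable (Q i)" "shrinkable (stretch e s ` Q i)" for i
    using Q(3)[of i] by (auto simp: shrinkable_empty stretch_obox[OF B e s] intro: shrinkable_obox[OF B])
  have each: "hausdorff dist p (stretch e s ` Q i) = ennreal s * hausdorff dist p (Q i)" for i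
  proof (cases "Q i = {}")
    case False
    then obtain l h where h: "h > 0" and Qi: "Q i = obox B l (\<lambda>b. l b + h * 1)"
      using Q(3)[of i] by auto
    have "stretch e s ` Q i = obox B (\<lambda>b. (if b = e then s else 1) * l b)
        (\<lambda>b. (if b = e then s else 1) * l b + h * (if b = e then s else 1))"
      unfolding Qi stretch_obox[OF B e s] by (simp add: algebra_simps)
    then have "hausdorff dist p (stretch e s ` Q i)
        = ennreal (h ^ p) * (ennreal s * hausdorff dist p (obox B (\<lambda>_. 0) (\<lambda>_. 1)))"
      by (simp only: hausdorff_obox_scale[OF B h] hausdorff_obox_stretch[OF B e s])
    also have "\<dots> = ennreal s * hausdorff dist p (Q i)"
      unfolding Qi hausdorff_obox_scale[OF B h] by (rule mult.left_commute)
    finally show ?thesis .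
  qed (simp add: hausdorff_empty)
  have "hausdorff dist p (\<Union>i. stretch e s ` Q i) = (\<Sum>i. hausdorff dist p (stretch e s ` Q i))"
    using sh disj by (intro hausdorff_UN_shrinkable)
  also have "\<dots> = ennreal s * (\<Sum>i. hausdorff dist p (Q i))"
    by (simp add: each)
  also have "(\<Sum>i. hausdorff dist p (Q i)) = hausdorff dist p (\<Union>i. Q i)"
    using sh Q(1) by (intro hausdorff_UN_shrinkable[symmetric])
  finally show ?thesis by (simp add: Q(2) flip: image_UN)
qed

section \<open>The Riemannian distance to first order\<close>

lemma one_minus_inverse_le:
  fixes K :: real
  assumes "K > 1"
  shows "1 - 1 / K \<le> K - 1"
proof -
  have "2 \<le> K + 1 / K"
    using assms sum_squares_bound[of 1 K] by (simp add: field_simps power2_eq_square)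
  then show ?thesis by simp
qed

text \<open>Left translation changes only the vertical coordinate of a tangent vector; the formula shows that
  the metric depends continuously on the base point.\<close>

lemma left_coords_eq:
  "left_coords x w = w - (\<Sum>k\<in>UNIV. x $ HX k * w $ HY k - x $ HY k * w $ HX k) *\<^sub>R axis HZ 1"
proof -
  let ?v = "w - (\<Sum>k\<in>UNIV. x $ HX k * w $ HY k - x $ HY k * w $ HX k) *\<^sub>R axis HZ 1"
  have "left_field ?v x = w"
    by (simp add: vec_eq_iff hidx_all left_field_nth axis_def)
  then show ?thesis using left_coords_left_field[of x ?v] by simp
qed

lemma left_field_left_coords: "left_field (left_coords x w) x = w"
  by (simp add: left_coords_eq vec_eq_iff hidx_all left_field_nth axis_def)

lemma linear_left_field: "linear (\<lambda>v. left_field v x)"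
  by (simp add: left_field_eq linear_hmul_right)

lemma linear_left_coords: "linear (left_coords x)"
proof (rule linearI)
  show "left_coords x (v + w) = left_coords x v + left_coords x w" for v w
    using linear_add[OF linear_left_field] left_field_left_coords left_coords_left_field by metis
  show "left_coords x (c *\<^sub>R v) = c *\<^sub>R left_coords x v" for c v
    using linear_scale[OF linear_left_field] left_field_left_coords left_coords_left_field by metis
qed

lemma norm_left_coords_diff:
  fixes x y w :: "'n::finite heis"
  shows "norm (left_coords y w - left_coords x w) \<le> 2 * real CARD('n) * norm (y - x) * norm w"
proof -
  let ?s = "\<lambda>k. (y - x) $ HX k * w $ HY k - (y - x) $ HY k * w $ HX k"
  have "(\<Sum>k\<in>UNIV. ?s k) = (\<Sum>k\<in>UNIV. y $ HX k * w $ HY k - y $ HY k * w $ HX k)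
      - (\<Sum>k\<in>UNIV. x $ HX k * w $ HY k - x $ HY k * w $ HX k)"
    by (simp add: left_diff_distrib sum_subtractf)
  then have "left_coords y w - left_coords x w = - (\<Sum>k\<in>UNIV. ?s k) *\<^sub>R axis HZ 1"
    by (simp only: left_coords_eq scaleR_diff_left minus_diff_eq scaleR_minus_left) simp
  then have "norm (left_coords y w - left_coords x w) = \<bar>\<Sum>k\<in>UNIV. ?s k\<bar>"
    by simp
  also have "\<dots> \<le> (\<Sum>k\<in>(UNIV::'n set). 2 * norm (y - x) * norm w)"
  proof (rule order_trans[OF sum_abs sum_mono])
    fix k
    have "\<bar>?s k\<bar> \<le> \<bar>(y - x) $ HX k\<bar> * \<bar>w $ HY k\<bar> + \<bar>(y - x) $ HY k\<bar> * \<bar>w $ HX k\<bar>"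
      unfolding abs_mult[symmetric] by (rule abs_triangle_ineq4)
    also have "\<dots> \<le> norm (y - x) * norm w + norm (y - x) * norm w"
      by (intro add_mono mult_mono component_le_norm_cart) auto
    finally show "\<bar>?s k\<bar> \<le> 2 * norm (y - x) * norm w" by (simp only: mult_2 distrib_right)
  qed
  finally show ?thesis by (simp add: mult_ac)
qed

lemma left_coords_bounded_below:
  obtains C where "C > 0" "\<And>w :: 'n::finite heis. norm w \<le> C * norm (left_coords x w)"
proof -
  obtain C where "C > 0" and C: "\<And>v. norm (left_field v x) \<le> C * norm v"
    using linear_bounded_pos[OF linear_left_field[of x]] by blast
  then show thesis using that[of C] by (metis left_field_left_coords)
qed

lemma left_coords_norm_near:
  fixes x :: "'n::finite heis"
  assumes K: "K > 1"
  obtains \<delta> where "\<delta> > 0" "\<And>y w. y \<in> ball x \<delta> \<Longrightarrow> norm (left_coords y w) \<le> K * norm (left_coords x w)"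
    "\<And>y w. y \<in> ball x \<delta> \<Longrightarrow> norm (left_coords x w) \<le> K * norm (left_coords y w)"
proof -
  obtain C where C: "C > 0" "\<And>w :: 'n heis. norm w \<le> C * norm (left_coords x w)"
    using left_coords_bounded_below by blast
  define c where "c = 2 * real CARD('n) * C"
  have c: "c > 0" using C by (simp add: c_def)
  define \<delta> where "\<delta> = (1 - 1 / K) / c"
  have "\<delta> > 0" using K c by (simp add: \<delta>_def)
  have close: "norm (left_coords y w - left_coords x w) \<le> (1 - 1 / K) * norm (left_coords x w)"
    if "y \<in> ball x \<delta>" for y w
  proof -
    have "norm (left_coords y w - left_coords x w) \<le> 2 * real CARD('n) * norm (y - x) * norm w"
      by (rule norm_left_coords_diff)
    also have "\<dots> \<le> 2 * real CARD('n) * \<delta> * (C * norm (left_coords x w))"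
      using that C \<open>\<delta> > 0\<close> by (intro mult_mono) (auto simp: dist_norm norm_minus_commute)
    also have "\<dots> = c * \<delta> * norm (left_coords x w)" by (simp add: c_def)
    also have "c * \<delta> = 1 - 1 / K" using c by (simp add: \<delta>_def)
    finally show ?thesis .
  qed
  show thesis
  proof (rule that[OF \<open>\<delta> > 0\<close>])
    fix y w assume y: "y \<in> ball x \<delta>"
    have "norm (left_coords y w) \<le> norm (left_coords x w) + norm (left_coords y w - left_coords x w)"
      by norm
    also have "\<dots> \<le> norm (left_coords x w) + (K - 1) * norm (left_coords x w)"
      using close[OF y, of w] mult_right_mono[OF one_minus_inverse_le[OF K], of "norm (left_coords x w)"] by simp
    finally show "norm (left_coords y w) \<le> K * norm (left_coords x w)" by (simp add: algebra_simps)
    have "norm (left_coords x w) \<le> norm (left_coords y w) + norm (left_coords y w - left_coords x w)"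
      by norm
    then have "(1 / K) * norm (left_coords x w) \<le> norm (left_coords y w)"
      using close[OF y, of w] by (simp add: algebra_simps)
    then show "norm (left_coords x w) \<le> K * norm (left_coords y w)"
      using K by (simp add: field_simps)
  qed
qed

text \<open>The length is an integral that need not exist, hence a relation.\<close>

definition riem_length :: "(real \<Rightarrow> 'n::finite heis) \<Rightarrow> real \<Rightarrow> bool" where
  "riem_length \<gamma> L \<longleftrightarrow> ((\<lambda>t. norm (left_coords (\<gamma> t) (vector_derivative \<gamma> (at t)))) has_integral L) {0..1}"

lemma riem_dist_riem_length:
  "riem_dist y z = Inf {L. \<exists>\<gamma>. valid_path \<gamma> \<and> pathstart \<gamma> = y \<and> pathfinish \<gamma> = z \<and> riem_length \<gamma> L}"
  by (simp add: riem_dist_def riem_length_def riem_metric_def norm_eq_sqrt_inner)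

lemma riem_length_segment:
  fixes y z :: "'n::finite heis"
  obtains L where "riem_length (linepath y z) L"
    "\<And>C. (\<And>u. u \<in> closed_segment y z \<Longrightarrow> norm (left_coords u (z - y)) \<le> C) \<Longrightarrow> L \<le> C"
proof -
  let ?f = "\<lambda>t. norm (left_coords (linepath y z t) (z - y))"
  have "continuous_on {0..1} ?f"
    unfolding left_coords_eq by (intro continuous_intros)
  then have int: "?f integrable_on {0..1}"
    by (rule integrable_continuous_real)
  show thesis
  proof
    show "riem_length (linepath y z) (integral {0..1} ?f)"
      using int by (simp add: riem_length_def has_integral_integral)
    fix C assume C: "\<And>u. u \<in> closed_segment y z \<Longrightarrow> norm (left_coords u (z - y)) \<le> C"
    have "integral {0..1} ?f \<le> integral {0..1} (\<lambda>_::real. C)"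
      using C by (intro integral_le int) (auto simp: linepath_in_path)
    then show "integral {0..1} ?f \<le> C" by simp
  qed
qed

text \<open>By integration of the velocity. It is used with \<open>s = 1\<close> for curves that stay near \<open>x\<close>, and with \<open>s\<close>
  the exit time for the others.\<close>

lemma riem_length_lower_bound:
  fixes \<gamma> :: "real \<Rightarrow> 'n::finite heis"
  assumes \<gamma>: "valid_path \<gamma>" and L: "riem_length \<gamma> L" and s: "0 \<le> s" "s \<le> 1"
    and le: "\<And>t w. t \<in> {0..s} \<Longrightarrow> norm (left_coords x w) \<le> K * norm (left_coords (\<gamma> t) w)" and K: "K \<ge> 0"
  shows "norm (left_coords x (\<gamma> s - \<gamma> 0)) \<le> K * L"
proof -
  obtain S where S: "finite S" "\<gamma> C1_differentiable_on ({0..1} - S)" and cont: "continuous_on {0..1} \<gamma>"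
    using \<gamma> unfolding valid_path_def piecewise_C1_differentiable_on_def by blast
  let ?\<gamma>' = "\<lambda>t. vector_derivative \<gamma> (at t)"
  have "(?\<gamma>' has_integral (\<gamma> s - \<gamma> 0)) {0..s}"
  proof (rule fundamental_theorem_of_calculus_interior_strong[OF S(1)])
    show "(\<gamma> has_vector_derivative ?\<gamma>' t) (at t)" if "t \<in> {0<..<s} - S" for t
      using S(2) that s by (auto simp: C1_differentiable_on_eq vector_derivative_works)
    show "continuous_on {0..s} \<gamma>" using cont s by (auto intro: continuous_on_subset)
  qed (use s in auto)
  then have int: "((left_coords x \<circ> ?\<gamma>') has_integral left_coords x (\<gamma> s - \<gamma> 0)) {0..s}"
    by (rule has_integral_linear) (simp add: linear_left_coords linear_conv_bounded_linear[symmetric])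
  let ?h = "\<lambda>t. norm (left_coords (\<gamma> t) (?\<gamma>' t))"
  have h: "(?h has_integral L) {0..1}" using L by (simp add: riem_length_def)
  then have hs: "?h integrable_on {0..s}"
    using s by (auto intro: integrable_subinterval_real has_integral_integrable)
  have "norm (left_coords x (\<gamma> s - \<gamma> 0)) = norm (integral {0..s} (left_coords x \<circ> ?\<gamma>'))"
    using int by (simp add: integral_unique)
  also have "\<dots> \<le> integral {0..s} (\<lambda>t. K * ?h t)"
    using int hs le by (intro integral_norm_bound_integral) (auto intro: has_integral_integrable integrable_on_mult_right)
  also have "\<dots> = K * integral {0..s} ?h" by simp
  also have "\<dots> \<le> K * integral {0..1} ?h"
    using hs h s K by (intro mult_left_mono integral_subset_le) (auto intro: has_integral_integrable)
  also have "\<dots> = K * L" using h by (simp add: integral_unique)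
  finally show ?thesis .
qed

text \<open>The upper bound comes from the segment. For the lower bound, a curve that stays in the region where the
  metric is almost constant is, up to the factor \<open>K\<close>, at least as long as its chord; a curve that
  leaves this region is, up to the same factor, at least as long as its chord up to the exit, which
  exceeds the distance of \<open>y\<close> and \<open>z\<close>.\<close>

theorem riem_dist_near:
  fixes x :: "'n::finite heis"
  assumes K: "K > 1"
  obtains \<delta> where "\<delta> > 0"
    "\<And>y z. y \<in> ball x \<delta> \<Longrightarrow> z \<in> ball x \<delta> \<Longrightarrow> riem_dist y z \<le> K * norm (left_coords x (y - z))"
    "\<And>y z. y \<in> ball x \<delta> \<Longrightarrow> z \<in> ball x \<delta> \<Longrightarrow> norm (left_coords x (y - z)) \<le> K * riem_dist y z"
proof -
  obtain \<eta> where \<eta>: "\<eta> > 0" "\<And>y w. y \<in> ball x \<eta> \<Longrightarrow> norm (left_coords y w) \<le> K * norm (left_coords x w)"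
    "\<And>y w. y \<in> ball x \<eta> \<Longrightarrow> norm (left_coords x w) \<le> K * norm (left_coords y w)"
    using left_coords_norm_near[OF K] by blast
  obtain c where c: "c > 0" "\<And>w :: 'n heis. norm w \<le> c * norm (left_coords x w)"
    using left_coords_bounded_below by blast
  obtain C where C: "C > 0" "\<And>w. norm (left_coords x w) \<le> C * norm w"
    using linear_bounded_pos[OF linear_left_coords[of x]] by blast
  \<comment> \<open>The second bound makes points in the ball closer to each other, in the metric at \<open>x\<close>, than
    to the sphere of radius \<open>\<eta> / 2\<close>.\<close>
  define \<delta> where "\<delta> = min (\<eta> / 4) (\<eta> / (8 * C * c))"
  have \<delta>: "\<delta> > 0" "\<delta> \<le> \<eta> / 4" "8 * C * c * \<delta> \<le> \<eta>"
    using \<eta>(1) C(1) c(1) by (auto simp: \<delta>_def min_def field_simps)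
  have sym: "norm (left_coords x (y - z)) = norm (left_coords x (z - y))" for y z
    by (metis linear_diff[OF linear_left_coords] norm_minus_commute)
  have nonneg: "0 \<le> L" if "riem_length \<gamma> L" for \<gamma> :: "real \<Rightarrow> 'n heis" and L
    using that unfolding riem_length_def by (rule has_integral_nonneg) simp
  show thesis
  proof (rule that[OF \<delta>(1)])
    fix y z assume yz: "y \<in> ball x \<delta>" "z \<in> ball x \<delta>"
    let ?P = "{L. \<exists>\<gamma>. valid_path \<gamma> \<and> pathstart \<gamma> = y \<and> pathfinish \<gamma> = z \<and> riem_length \<gamma> L}"
    obtain L where L: "riem_length (linepath y z) L"
      "\<And>C. (\<And>u. u \<in> closed_segment y z \<Longrightarrow> norm (left_coords u (z - y)) \<le> C) \<Longrightarrow> L \<le> C"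
      using riem_length_segment by blast
    have LP: "L \<in> ?P" using L(1) by (auto intro!: exI[of _ "linepath y z"])
    have "closed_segment y z \<subseteq> ball x \<eta>"
      using yz \<delta> \<eta>(1) by (intro closed_segment_subset convex_ball) auto
    then have "L \<le> K * norm (left_coords x (z - y))"
      using \<eta>(2) by (intro L(2)) auto
    moreover have "riem_dist y z \<le> L"
      unfolding riem_dist_riem_length using LP nonneg by (intro cInf_lower bdd_belowI[of _ 0]) auto
    ultimately show "riem_dist y z \<le> K * norm (left_coords x (y - z))"
      by (simp add: sym)
    have "norm (left_coords x (z - y)) / K \<le> L'" if "L' \<in> ?P" for L'
    proof -
      obtain \<gamma> where \<gamma>: "valid_path \<gamma>" "\<gamma> 0 = y" "\<gamma> 1 = z" "riem_length \<gamma> L'"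
        using \<open>L' \<in> ?P\<close> by (auto simp: pathstart_def pathfinish_def)
      have cont: "continuous_on {0..1} \<gamma>"
        using \<gamma>(1) by (simp add: valid_path_def piecewise_C1_differentiable_on_def)
      have "norm (left_coords x (z - y)) \<le> K * L'"
      proof (cases "\<forall>t\<in>{0..1}. dist x (\<gamma> t) < \<eta> / 2")
        case True
        have "norm (left_coords x (\<gamma> 1 - \<gamma> 0)) \<le> K * L'"
        proof (rule riem_length_lower_bound[OF \<gamma>(1,4)])
          fix t :: real and w assume "t \<in> {0..1}"
          then have "\<gamma> t \<in> ball x \<eta>" using True \<eta>(1) by fastforce
          then show "norm (left_coords x w) \<le> K * norm (left_coords (\<gamma> t) w)" by (rule \<eta>(3))
        qed (use K in auto)
        then show ?thesis by (simp add: \<gamma>)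
      next
        case False
        \<comment> \<open>The minimum of \<open>E\<close> is the first exit time from the ball of radius \<open>\<eta> / 2\<close>.\<close>
        define E where "E = {t\<in>{0..1}. \<eta> / 2 \<le> dist x (\<gamma> t)}"
        have contd: "continuous_on {0..1} (\<lambda>t. dist x (\<gamma> t))"
          using cont by (intro continuous_intros)
        have "closed E"
          unfolding E_def by (rule continuous_on_closed_Collect_le[OF continuous_on_const contd closed_real_atLeastAtMost])
        moreover have "bounded E"
          by (rule bounded_subset[of "{0..1}"]) (auto simp: E_def)
        ultimately have "compact E" by (simp add: compact_eq_bounded_closed)
        moreover have "E \<noteq> {}" using False by (auto simp: E_def not_less)
        ultimately obtain s where s: "s \<in> E" "\<And>t. t \<in> E \<Longrightarrow> s \<le> t"
          using compact_attains_inf[of E] by metis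
        have s01: "0 \<le> s" "s \<le> 1" "\<eta> / 2 \<le> dist x (\<gamma> s)" using s(1) by (auto simp: E_def)
        have "dist x (\<gamma> 0) \<le> \<eta> / 2" using yz \<delta> \<gamma>(2) by simp
        then obtain s' where s': "0 \<le> s'" "s' \<le> s" "dist x (\<gamma> s') = \<eta> / 2"
          using IVT'[of "\<lambda>t. dist x (\<gamma> t)" 0 "\<eta> / 2" s] s01 continuous_on_subset[OF contd, of "{0..s}"] by auto
        then have "s' = s" using s(2)[of s'] s01 by (auto simp: E_def)
        have near: "\<gamma> t \<in> ball x \<eta>" if "t \<in> {0..s}" for t
        proof (cases "t = s")
          case True then show ?thesis using s'(3) \<open>s' = s\<close> \<eta>(1) by simp
        next
          case False
          then have "t \<notin> E" using that s(2)[of t] by auto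
          then show ?thesis using that s01 \<eta>(1) by (auto simp: E_def)
        qed
        have "\<eta> / 2 - \<delta> \<le> norm (\<gamma> s - \<gamma> 0)"
          using s01(3) yz(1) \<gamma>(2) dist_triangle[of x "\<gamma> s" y]
          by (simp add: dist_norm norm_minus_commute)
        then have "\<eta> / 4 \<le> norm (\<gamma> s - \<gamma> 0)" using \<delta>(2) by simp
        also have "\<dots> \<le> c * norm (left_coords x (\<gamma> s - \<gamma> 0))" by (rule c(2))
        finally have 1: "\<eta> / 4 \<le> c * norm (left_coords x (\<gamma> s - \<gamma> 0))" .
        have "norm (z - y) \<le> 2 * \<delta>" using yz dist_triangle2[of z y x]
          by (simp add: dist_norm norm_minus_commute)
        then have "norm (left_coords x (z - y)) \<le> C * (2 * \<delta>)"
          using C by (meson mult_left_mono order_trans less_imp_le)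
        then have "c * norm (left_coords x (z - y)) \<le> c * (C * (2 * \<delta>))"
          using c(1) by simp
        also have "\<dots> \<le> \<eta> / 4" using \<delta>(3) by (simp add: mult_ac)
        also note 1
        finally have "norm (left_coords x (z - y)) \<le> norm (left_coords x (\<gamma> s - \<gamma> 0))"
          using c(1) by simp
        also have "\<dots> \<le> K * L'"
          using near \<eta>(3) K s01 by (intro riem_length_lower_bound[OF \<gamma>(1,4)]) auto
        finally show ?thesis .
      qed
      then show ?thesis using K by (simp add: field_simps)
    qed
    then have "norm (left_coords x (z - y)) / K \<le> riem_dist y z"
      unfolding riem_dist_riem_length using LP by (intro cInf_greatest) auto
    then show "norm (left_coords x (y - z)) \<le> K * riem_dist y z"
      using K by (simp add: field_simps sym)
  qed
qed

section \<open>C1 submanifolds near a point\<close>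

text \<open>Strict differentiability: the bound holds for pairs of points near \<open>a\<close>, by the mean value inequality for
  \<open>f\<close> minus its derivative at \<open>a\<close>.\<close>

lemma C1_near_linear:
  fixes f :: "'a::euclidean_space \<Rightarrow> 'b::euclidean_space"
  assumes V: "open V" "a \<in> V" and f: "\<And>x. x \<in> V \<Longrightarrow> (f has_derivative blinfun_apply (f' x)) (at x)"
    and cont: "continuous_on V f'" and \<epsilon>: "\<epsilon> > 0"
  obtains \<delta> where "\<delta> > 0" "ball a \<delta> \<subseteq> V"
    "\<And>x y. x \<in> ball a \<delta> \<Longrightarrow> y \<in> ball a \<delta> \<Longrightarrow>
       norm (f x - f y - blinfun_apply (f' a) (x - y)) \<le> \<epsilon> * norm (x - y)"
proof -
  have "isCont f' a" using V cont by (simp add: continuous_on_eq_continuous_at)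
  then obtain d where d: "d > 0" "\<And>x. dist x a < d \<Longrightarrow> dist (f' x) (f' a) < \<epsilon>"
    using \<epsilon> unfolding continuous_at_eps_delta by metis
  obtain e where e: "e > 0" "ball a e \<subseteq> V" using V openE by blast
  define \<delta> where "\<delta> = min d e"
  have \<delta>: "\<delta> > 0" "ball a \<delta> \<subseteq> V" using d e by (auto simp: \<delta>_def)
  have blinfun_diff: "blinfun_apply (f' z - f' a) = (\<lambda>h. blinfun_apply (f' z) h - blinfun_apply (f' a) h)" for z
    by (simp add: fun_eq_iff blinfun.diff_left)
  have "norm (f x - f y - blinfun_apply (f' a) (x - y)) \<le> \<epsilon> * norm (x - y)"
    if "x \<in> ball a \<delta>" "y \<in> ball a \<delta>" for x y
  proof -
    let ?g = "\<lambda>x. f x - blinfun_apply (f' a) x"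
    have "norm (?g x - ?g y) \<le> \<epsilon> * norm (x - y)"
    proof (rule differentiable_bound[OF convex_ball _ _ that])
      fix z assume z: "z \<in> ball a \<delta>"
      then have "(?g has_derivative (\<lambda>h. blinfun_apply (f' z) h - blinfun_apply (f' a) h)) (at z)"
        using \<delta> by (intro has_derivative_diff f bounded_linear_imp_has_derivative blinfun.bounded_linear_right) auto
      then show "(?g has_derivative blinfun_apply (f' z - f' a)) (at z within ball a \<delta>)"
        unfolding blinfun_diff by (rule has_derivative_at_withinI)
      show "onorm (blinfun_apply (f' z - f' a)) \<le> \<epsilon>"
        using d(2)[of z] z by (simp add: \<delta>_def dist_norm norm_blinfun.rep_eq[symmetric] norm_minus_commute less_imp_le)
    qed
    then show ?thesis by (simp add: blinfun.diff_right algebra_simps)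
  qed
  with \<delta> that show thesis by blast
qed

text \<open>A straightening chart around \<open>x\<close>, centred at the origin and reduced to the data used later: a
  parametrization \<open>\<psi>\<close> with injective derivative and a Lipschitz inverse \<open>\<zeta>\<close>.\<close>

lemma C1_submanifold_parametrization:
  fixes M :: "'a::euclidean_space set"
  assumes M: "C1_submanifold p \<Omega> M" and x: "x \<in> M"
  obtains S V :: "'a set" and \<psi> \<zeta> :: "'a \<Rightarrow> 'a" and \<psi>' and C r
  where "subspace S" "dim S = p" "open V" "0 \<in> V" "\<psi> 0 = x" "\<zeta> x = 0" "\<psi> ` (V \<inter> S) \<subseteq> M"
    "\<forall>a\<in>V. (\<psi> has_derivative blinfun_apply (\<psi>' a)) (at a)" "continuous_on V \<psi>'"
    "inj (blinfun_apply (\<psi>' 0))"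
    "C > 0" "r > 0" "\<forall>q\<in>M \<inter> ball x r. \<zeta> q \<in> V \<inter> S \<and> \<psi> (\<zeta> q) = q"
    "\<forall>q\<in>ball x r. \<forall>q'\<in>ball x r. norm (\<zeta> q - \<zeta> q') \<le> C * norm (q - q')"
proof -
  obtain U V S :: "'a set" and \<phi> \<psi> where UV: "open U" "x \<in> U" "U \<subseteq> \<Omega>" "open V"
    and hom: "homeomorphism U V \<phi> \<psi>" and C1: "C1_on U \<phi>" "C1_on V \<psi>"
    and S: "subspace S" "dim S = p" and img: "\<phi> ` (U \<inter> M) = V \<inter> S"
    using bspec[OF conjunct2[OF M[unfolded C1_submanifold_def]] x] by (elim exE conjE) metis
  have inv: "\<And>u. u \<in> U \<Longrightarrow> \<psi> (\<phi> u) = u" "\<And>v. v \<in> V \<Longrightarrow> \<phi> (\<psi> v) = v"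
    "\<And>u. u \<in> U \<Longrightarrow> \<phi> u \<in> V" "\<And>v. v \<in> V \<Longrightarrow> \<psi> v \<in> U"
    using hom by (auto simp: homeomorphism_def)
  obtain \<phi>' where \<phi>': "\<And>u. u \<in> U \<Longrightarrow> (\<phi> has_derivative blinfun_apply (\<phi>' u)) (at u)" "continuous_on U \<phi>'"
    using C1(1) unfolding C1_on_def by blast
  obtain \<psi>' where \<psi>': "\<And>v. v \<in> V \<Longrightarrow> (\<psi> has_derivative blinfun_apply (\<psi>' v)) (at v)" "continuous_on V \<psi>'"
    using C1(2) unfolding C1_on_def by blast
  define a where "a = \<phi> x"
  have a: "a \<in> V" "a \<in> S" "\<psi> a = x"
    using img x UV inv by (auto simp: a_def)
  define V0 where "V0 = (\<lambda>b. a + b) -` V"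
  define \<psi>0 where "\<psi>0 b = \<psi> (a + b)" for b
  define \<zeta> where "\<zeta> q = \<phi> q - a" for q
  obtain r where r: "r > 0" "ball x r \<subseteq> U"
    and r_near: "\<And>q q'. q \<in> ball x r \<Longrightarrow> q' \<in> ball x r \<Longrightarrow>
       norm (\<phi> q - \<phi> q' - blinfun_apply (\<phi>' x) (q - q')) \<le> 1 * norm (q - q')"
    using C1_near_linear[OF UV(1,2) \<phi>' zero_less_one] by blast
  define C where "C = norm (\<phi>' x) + 1"
  show thesis
  proof (rule that[of S V0 \<psi>0 \<zeta> "\<lambda>b. \<psi>' (a + b)" C r])
    show "open V0"
      unfolding V0_def by (intro open_vimage UV continuous_intros)
    show "0 \<in> V0" "\<psi>0 0 = x" "\<zeta> x = 0"
      using a by (auto simp: V0_def \<psi>0_def \<zeta>_def a_def)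
    show "\<psi>0 ` (V0 \<inter> S) \<subseteq> M"
    proof safe
      fix b assume "b \<in> V0" "b \<in> S"
      then have "a + b \<in> V \<inter> S" using a S by (auto simp: V0_def subspace_add)
      then obtain u where "u \<in> U \<inter> M" "a + b = \<phi> u" using img by blast
      then show "\<psi>0 b \<in> M" using inv by (auto simp: \<psi>0_def)
    qed
    show "\<forall>b\<in>V0. (\<psi>0 has_derivative blinfun_apply (\<psi>' (a + b))) (at b)"
    proof
      fix b assume that: "b \<in> V0"
      have "((\<lambda>b. \<psi> (a + b)) has_derivative (\<lambda>h. blinfun_apply (\<psi>' (a + b)) (0 + h))) (at b)"
        using that by (intro has_derivative_compose[of "\<lambda>b. a + b" "\<lambda>h. 0 + h" b UNIV \<psi>]
            has_derivative_add has_derivative_const has_derivative_ident \<psi>') (auto simp: V0_def)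
      then show "(\<psi>0 has_derivative blinfun_apply (\<psi>' (a + b))) (at b)" by (simp add: \<psi>0_def[abs_def])
    qed
    show "continuous_on V0 (\<lambda>b. \<psi>' (a + b))"
      by (rule continuous_on_compose2[OF \<psi>'(2)]) (auto simp: V0_def intro!: continuous_intros)
    have "((\<lambda>v. \<phi> (\<psi> v)) has_derivative (\<lambda>h. blinfun_apply (\<phi>' x) (blinfun_apply (\<psi>' a) h))) (at a)"
      using \<phi>'(1)[OF UV(2)] a by (intro has_derivative_compose[OF \<psi>'(1)]) auto
    moreover have "((\<lambda>v. \<phi> (\<psi> v)) has_derivative (\<lambda>h. h)) (at a)"
      using has_derivative_transform_within_open[OF has_derivative_ident UV(4) a(1), of "\<lambda>v. \<phi> (\<psi> v)"] inv by simp
    ultimately have "blinfun_apply (\<phi>' x) (blinfun_apply (\<psi>' a) h) = h" for h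
      using has_derivative_unique by metis
    then show "inj (blinfun_apply (\<psi>' (a + 0)))"
      by (simp add: inj_on_def) metis
    show "C > 0" by (simp add: C_def add_nonneg_pos)
    show "\<forall>q\<in>M \<inter> ball x r. \<zeta> q \<in> V0 \<inter> S \<and> \<psi>0 (\<zeta> q) = q"
    proof
      fix q assume that: "q \<in> M \<inter> ball x r"
      have q: "q \<in> U" using that r by blast
      then have "\<phi> q \<in> V \<inter> S" using img that by blast
      then show "\<zeta> q \<in> V0 \<inter> S \<and> \<psi>0 (\<zeta> q) = q"
        using a S inv(1)[OF q] by (auto simp: \<zeta>_def V0_def \<psi>0_def subspace_diff)
    qed
    show "\<forall>q\<in>ball x r. \<forall>q'\<in>ball x r. norm (\<zeta> q - \<zeta> q') \<le> C * norm (q - q')"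
    proof (intro ballI)
      fix q q' assume that: "q \<in> ball x r" "q' \<in> ball x r"
      have "norm (blinfun_apply (\<phi>' x) (q - q')) \<le> norm (\<phi>' x) * norm (q - q')"
        by (rule norm_blinfun)
      then show "norm (\<zeta> q - \<zeta> q') \<le> C * norm (q - q')"
        using r_near[OF that] norm_triangle_sub[of "\<phi> q - \<phi> q'" "blinfun_apply (\<phi>' x) (q - q')"]
        by (simp add: \<zeta>_def C_def algebra_simps)
    qed
  qed (use S r in auto)
qed

lemma span_eq_of_dim:
  fixes S :: "'a::euclidean_space set"
  assumes "subspace S" "S \<subseteq> span B" "finite B" "card B \<le> dim S"
  shows "S = span B"
proof -
  have "dim (span B) \<le> card B" using assms(3) by (simp add: dim_le_card')
  then show ?thesis
    using assms by (intro subspace_dim_equal) auto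
qed

text \<open>The tangent space contains the image \<open>D S\<close> of the model space under the derivative of the
  parametrization, by differentiating images of segments, and its dimension is no larger. So \<open>D\<close>
  maps differences in \<open>S\<close> to tangent vectors, and these are close to the chords.

  For the second claim the parametrization is composed with a right inverse of \<open>\<Phi> \<circ> D\<close> and extended to the
  whole space by the identity on a complement of the range of \<open>\<Phi>\<close>. The extension has derivative
  the identity at the origin, so its image is a neighbourhood of the origin.\<close>

theorem C1_submanifold_local:
  fixes M :: "'a::euclidean_space set"
  assumes M: "C1_submanifold p \<Omega> M" and x: "x \<in> M"
    and T: "tangent_space M x = span B" "finite B" "card B \<le> p"
  shows "\<epsilon> > 0 \<Longrightarrow> \<exists>\<delta>>0. \<forall>q\<in>M \<inter> ball x \<delta>. \<forall>q'\<in>M \<inter> ball x \<delta>.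
       \<exists>\<tau>\<in>tangent_space M x. norm (q - q' - \<tau>) \<le> \<epsilon> * norm (q - q')"
    and "linear (\<Phi> :: 'a \<Rightarrow> 'b::euclidean_space) \<Longrightarrow> range \<Phi> \<subseteq> \<Phi> ` tangent_space M x \<Longrightarrow> \<delta> > 0 \<Longrightarrow>
       \<exists>\<delta>'>0. \<forall>v\<in>range \<Phi>. norm v < \<delta>' \<longrightarrow> (\<exists>q\<in>M \<inter> ball x \<delta>. \<Phi> (q - x) = v)"
proof -
  obtain S V :: "'a set" and \<psi> \<zeta> :: "'a \<Rightarrow> 'a" and \<psi>' and C r
  where S: "subspace S" "dim S = p" and V: "open V" "0 \<in> V" and base: "\<psi> 0 = x" "\<zeta> x = 0"
    and sub: "\<psi> ` (V \<inter> S) \<subseteq> M"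
    and \<psi>'_all: "\<forall>a\<in>V. (\<psi> has_derivative blinfun_apply (\<psi>' a)) (at a)" and cont\<psi>': "continuous_on V \<psi>'"
    and inj: "inj (blinfun_apply (\<psi>' 0))"
    and C: "C > 0" and r: "r > 0" and \<zeta>_all: "\<forall>q\<in>M \<inter> ball x r. \<zeta> q \<in> V \<inter> S \<and> \<psi> (\<zeta> q) = q"
    and lip_all: "\<forall>q\<in>ball x r. \<forall>q'\<in>ball x r. norm (\<zeta> q - \<zeta> q') \<le> C * norm (q - q')"
    by (rule C1_submanifold_parametrization[OF M x])
  note \<psi>' = bspec[OF \<psi>'_all] cont\<psi>' and \<zeta> = bspec[OF \<zeta>_all] and lip = bspec[OF bspec[OF lip_all]]
  let ?D = "blinfun_apply (\<psi>' 0)"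
  have linD: "linear ?D" by (simp add: linear_conv_bounded_linear blinfun.bounded_linear_right)
  have "?D ` S \<subseteq> tangent_space M x"
  proof safe
    fix s assume s: "s \<in> S"
    have "open ((\<lambda>t::real. t *\<^sub>R s) -` V)"
      by (intro open_vimage V continuous_intros)
    moreover have "0 \<in> (\<lambda>t::real. t *\<^sub>R s) -` V" using V by simp
    ultimately obtain e where e: "e > 0" "ball 0 e \<subseteq> (\<lambda>t::real. t *\<^sub>R s) -` V"
      using openE by blast
    then have inV: "t *\<^sub>R s \<in> V" if "t \<in> {-e<..<e}" for t
      using that by (auto simp: subset_iff)
    have deriv: "((\<lambda>t. \<psi> (t *\<^sub>R s)) has_vector_derivative blinfun_apply (\<psi>' (t *\<^sub>R s)) s) (at t)" if "t \<in> {-e<..<e}" for t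
    proof -
      have "((\<lambda>t. \<psi> (t *\<^sub>R s)) has_derivative (\<lambda>h. blinfun_apply (\<psi>' (t *\<^sub>R s)) (h *\<^sub>R s))) (at t)"
        using \<psi>'(1)[OF inV[OF that]]
        by (intro has_derivative_compose[of "\<lambda>t. t *\<^sub>R s" "\<lambda>h. h *\<^sub>R s" t UNIV \<psi>])
          (auto intro!: derivative_eq_intros)
      then show ?thesis by (simp add: has_vector_derivative_def blinfun.scaleR_right)
    qed
    have "continuous_on {-e<..<e} (\<lambda>t. \<psi>' (t *\<^sub>R s))"
      using inV by (intro continuous_on_compose2[OF \<psi>'(2)] continuous_intros) auto
    then have "continuous_on {-e<..<e} (\<lambda>t. blinfun_apply (\<psi>' (t *\<^sub>R s)) s)"
      by (intro continuous_intros)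
    with deriv have "(\<lambda>t. \<psi> (t *\<^sub>R s)) C1_differentiable_on {-e<..<e}"
      unfolding C1_differentiable_on_def by (intro exI[of _ "\<lambda>t. blinfun_apply (\<psi>' (t *\<^sub>R s)) s"] conjI ballI)
    moreover have "(\<lambda>t. \<psi> (t *\<^sub>R s)) ` {-e<..<e} \<subseteq> M"
      using inV s S sub by (auto simp: image_subset_iff subspace_scale)
    moreover have "((\<lambda>t. \<psi> (t *\<^sub>R s)) has_vector_derivative ?D s) (at 0)"
      using deriv[of 0] e by simp
    ultimately show "?D s \<in> tangent_space M x"
      unfolding tangent_space_def using e base by (auto intro!: exI[of _ "\<lambda>t. \<psi> (t *\<^sub>R s)"])
  qed
  moreover have "subspace (?D ` S)" using linD S(1) by (rule linear_subspace_image)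
  moreover have "dim (?D ` S) = p"
    using dim_image_eq[OF linD, of S] inj S by (simp add: inj_on_subset)
  ultimately have DS: "?D ` S = tangent_space M x"
    using T span_eq_of_dim[of "?D ` S" B] by simp
  show "\<exists>\<delta>>0. \<forall>q\<in>M \<inter> ball x \<delta>. \<forall>q'\<in>M \<inter> ball x \<delta>.
       \<exists>\<tau>\<in>tangent_space M x. norm (q - q' - \<tau>) \<le> \<epsilon> * norm (q - q')" if "\<epsilon> > 0"
  proof -
    have "\<epsilon> / C > 0" using that C by simp
    then obtain \<eta> where \<eta>: "\<eta> > 0" "ball 0 \<eta> \<subseteq> V" "\<And>a b. a \<in> ball 0 \<eta> \<Longrightarrow> b \<in> ball 0 \<eta> \<Longrightarrow>
       norm (\<psi> a - \<psi> b - ?D (a - b)) \<le> \<epsilon> / C * norm (a - b)"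
      using C1_near_linear[OF V \<psi>'] by blast
    define \<delta> where "\<delta> = min r (\<eta> / C)"
    have \<delta>: "\<delta> > 0" "\<delta> \<le> r" "C * \<delta> \<le> \<eta>"
      using r \<eta>(1) C by (auto simp: \<delta>_def min_def field_simps)
    have near: "\<zeta> q \<in> ball 0 \<eta>" if "q \<in> M \<inter> ball x \<delta>" for q
    proof -
      have "norm (\<zeta> q - \<zeta> x) \<le> C * norm (q - x)"
        using that r \<delta> by (intro lip) auto
      also have "\<dots> < C * \<delta>" using that C by (auto simp: dist_norm norm_minus_commute)
      finally show ?thesis using \<delta>(3) by (simp add: base)
    qed
    show ?thesis
    proof (intro exI[of _ \<delta>] conjI ballI)
      fix q q' assume q: "q \<in> M \<inter> ball x \<delta>" "q' \<in> M \<inter> ball x \<delta>"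
      then have q': "q \<in> M \<inter> ball x r" "q' \<in> M \<inter> ball x r" using \<delta>(2) by auto
      have "norm (q - q' - ?D (\<zeta> q - \<zeta> q')) \<le> \<epsilon> / C * norm (\<zeta> q - \<zeta> q')"
        using \<eta>(3)[OF near[OF q(1)] near[OF q(2)]] \<zeta>[OF q'(1)] \<zeta>[OF q'(2)] by simp
      also have "\<dots> \<le> \<epsilon> / C * (C * norm (q - q'))"
        using q' \<open>\<epsilon> / C > 0\<close> by (intro mult_left_mono lip) auto
      also have "\<dots> = \<epsilon> * norm (q - q')" using C by simp
      finally have "norm (q - q' - ?D (\<zeta> q - \<zeta> q')) \<le> \<epsilon> * norm (q - q')" .
      moreover have "?D (\<zeta> q - \<zeta> q') \<in> tangent_space M x"
        unfolding DS[symmetric] using \<zeta> q' S by (intro imageI subspace_diff) auto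
      ultimately show "\<exists>\<tau>\<in>tangent_space M x. norm (q - q' - \<tau>) \<le> \<epsilon> * norm (q - q')" by blast
    qed (use \<delta> in auto)
  qed
  show "\<exists>\<delta>'>0. \<forall>v\<in>range \<Phi>. norm v < \<delta>' \<longrightarrow> (\<exists>q\<in>M \<inter> ball x \<delta>. \<Phi> (q - x) = v)"
    if \<Phi>: "linear \<Phi>" "range \<Phi> \<subseteq> \<Phi> ` tangent_space M x" and "\<delta> > 0"
  proof -
    have lin2: "linear (\<lambda>a. \<Phi> (?D a))" using linear_compose[OF linD \<Phi>(1)] by (simp add: o_def)
    obtain A where A: "range A \<subseteq> S" "linear A" "\<And>v. v \<in> (\<lambda>a. \<Phi> (?D a)) ` S \<Longrightarrow> \<Phi> (?D (A v)) = v"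
      using linear_exists_right_inverse_on[OF lin2 S(1)] by auto
    have A3: "\<Phi> (?D (A v)) = v" if "v \<in> range \<Phi>" for v
      using \<Phi>(2) that A(3)[of v] DS by (auto simp: image_image[symmetric])
    have subR: "subspace (range \<Phi>)" using \<Phi>(1) by (simp add: linear_subspace_image)
    obtain P where P: "range P \<subseteq> range \<Phi>" "linear P" "\<And>v. v \<in> range \<Phi> \<Longrightarrow> P v = v"
      using linear_exists_right_inverse_on[OF linear_ident subR] by auto
    \<comment> \<open>On \<open>range \<Phi>\<close> this is the parametrization seen through \<open>\<Phi>\<close>; across it, the identity.\<close>
    define F where "F v = \<Phi> (\<psi> (A (P v)) - x) + (v - P v)" for v
    define W where "W = (\<lambda>v. A (P v)) -` V"
    have linAP: "linear (\<lambda>v. A (P v))" using linear_compose[OF P(2) A(2)] by (simp add: o_def)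
    have W: "open W" "0 \<in> W"
    proof -
      show "open W" unfolding W_def
        using linAP by (intro open_vimage V linear_continuous_on) (simp add: linear_conv_bounded_linear)
      show "0 \<in> W" using V linear_0[OF linAP] by (simp add: W_def)
    qed
    have derF: "(F has_derivative (\<lambda>h. \<Phi> (blinfun_apply (\<psi>' (A (P v))) (A (P h)) - 0) + (h - P h))) (at v)"
      if "v \<in> W" for v
      unfolding F_def
    proof (intro has_derivative_add has_derivative_diff has_derivative_ident linear_imp_has_derivative P(2)
        bounded_linear.has_derivative[of \<Phi>] has_derivative_const)
      show "bounded_linear \<Phi>" using \<Phi>(1) by (simp add: linear_conv_bounded_linear)
      show "((\<lambda>v. \<psi> (A (P v))) has_derivative (\<lambda>h. blinfun_apply (\<psi>' (A (P v))) (A (P h)))) (at v)"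
        using that by (intro has_derivative_compose[OF linear_imp_has_derivative[OF linAP]] \<psi>')
          (simp add: W_def)
    qed
    have "continuous_on W F"
      by (rule has_derivative_continuous_on) (rule has_derivative_at_withinI[OF derF])
    have F0: "F 0 = 0" using linear_0[OF linAP] linear_0[OF P(2)] linear_0[OF \<Phi>(1)] by (simp add: F_def base)
    have "(F has_derivative id) (at 0)"
    proof -
      have "\<Phi> (blinfun_apply (\<psi>' (A (P 0))) (A (P h)) - 0) + (h - P h) = id h" for h
        using A3[of "P h"] P(1) linear_0[OF linAP] by (simp add: image_subset_iff)
      then have "(\<lambda>h. \<Phi> (blinfun_apply (\<psi>' (A (P 0))) (A (P h)) - 0) + (h - P h)) = id" by (rule ext)
      then show ?thesis using derF[OF W(2)] by simp
    qed
    have "isCont (\<lambda>v. \<psi> (A (P v))) 0"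
    proof (rule isCont_o2[where f = "\<lambda>v. A (P v)" and g = \<psi>])
      show "isCont (\<lambda>v. A (P v)) 0"
        using linAP by (simp add: linear_continuous_at linear_conv_bounded_linear)
      show "isCont \<psi> (A (P 0))"
        using \<psi>'(1)[OF V(2)] unfolding linear_0[OF linAP] by (rule has_derivative_continuous)
    qed
    then obtain \<eta> where \<eta>: "\<eta> > 0" "\<And>v. dist v 0 < \<eta> \<Longrightarrow> dist (\<psi> (A (P v))) (\<psi> (A (P 0))) < \<delta>"
      using \<open>\<delta> > 0\<close> unfolding continuous_at_eps_delta by metis
    define N where "N = W \<inter> ball 0 \<eta>"
    have N: "open N" "0 \<in> N" using W \<eta>(1) by (auto simp: N_def)
    have "F 0 \<in> interior (F ` N)"
    proof (rule sussmann_open_mapping[OF W(1) \<open>continuous_on W F\<close> W(2) \<open>(F has_derivative id) (at 0)\<close>])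
      show "bounded_linear (id :: 'b \<Rightarrow> 'b)" by (simp add: id_def bounded_linear_ident)
      show "N \<subseteq> W" by (simp add: N_def)
      show "0 \<in> interior N" using N by (simp add: interior_open)
    qed simp
    then obtain \<delta>' where \<delta>': "\<delta>' > 0" "ball 0 \<delta>' \<subseteq> F ` N"
      unfolding F0 mem_interior by blast
    show ?thesis
    proof (intro exI[of _ \<delta>'] conjI ballI impI)
      fix v assume v: "v \<in> range \<Phi>" "norm v < \<delta>'"
      then have "v \<in> ball 0 \<delta>'" by simp
      then obtain w where w: "w \<in> N" "F w = v" using \<delta>'(2) by blast
      define q where "q = \<psi> (A (P w))"
      \<comment> \<open>A preimage of a point of \<open>range \<Phi>\<close> lies in \<open>range \<Phi>\<close> itself.\<close>
      have "w = v - \<Phi> (q - x) + P w" using w(2) by (simp add: F_def q_def algebra_simps)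
      moreover have "v - \<Phi> (q - x) + P w \<in> range \<Phi>"
        using subR v(1) P(1) by (intro subspace_add subspace_diff) auto
      ultimately have "P w = w" using P(3) by metis
      then have "\<Phi> (q - x) = v" using w(2) by (simp add: F_def q_def)
      moreover have "q \<in> M"
      proof -
        have "A (P w) \<in> S" using A(1) by blast
        moreover have "A (P w) \<in> V" using w(1) by (simp add: N_def W_def)
        ultimately show ?thesis using sub unfolding q_def by blast
      qed
      moreover have "q \<in> ball x \<delta>"
        using \<eta>(2)[of w] w(1) linear_0[OF linAP] by (simp add: q_def N_def base dist_commute)
      ultimately show "\<exists>q\<in>M \<inter> ball x \<delta>. \<Phi> (q - x) = v" by blast
    qed (rule \<delta>'(1))
  qed
qed

section \<open>The vertical part of a simple vector\<close>

lemma linear_wedge_left: "linear (\<lambda>v. wedge v \<alpha>)"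
  by (rule linearI) (simp_all add: wedge_ext1 algebra_simps sum.distrib scaleR_sum_right)

lemma linear_contract_left: "linear (\<lambda>v. contract v \<alpha>)"
  by (rule linearI) (simp_all add: contract_int1 algebra_simps sum.distrib scaleR_sum_right)

lemma linear_contract: "linear (contract v)"
  by (rule linearI)
    (simp_all add: vec_eq_iff contract_def algebra_simps sum.distrib sum_distrib_left)

lemma wedge_self: "wedge v (wedge v \<alpha>) = 0"
  using wedge_wedge[of v v \<alpha>] by (simp add: vec_eq_iff)

lemma contract_anticommute: "contract v (contract w \<beta>) = - contract w (contract v \<beta>)"
proof -
  have "inner \<alpha> (contract v (contract w \<beta>)) = inner \<alpha> (- contract w (contract v \<beta>))" for \<alpha>
    using wedge_wedge[of w v \<alpha>] by (simp flip: inner_wedge_contract)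
  then show ?thesis using vector_eq_ldot by blast
qed

lemma contract_self: "contract v (contract v \<alpha>) = 0"
  using contract_anticommute[of v v \<alpha>] by (simp add: vec_eq_iff)

lemma wedges_Cons: "wedges (v # vs) = wedge v (wedges vs)"
  by (simp add: wedges_def)

lemma wedge_wedges_span:
  assumes "v \<in> span (set vs)"
  shows "wedge v (wedges vs) = 0"
proof -
  have "wedge v (wedges vs) = 0" if "v \<in> set vs" for v
    using that
  proof (induction vs)
    case (Cons w vs)
    show ?case
    proof (cases "v = w")
      case False
      then have "wedge v (wedges vs) = 0" using Cons by simp
      then show ?thesis by (simp add: wedges_Cons wedge_wedge[of v w] linear_0[OF linear_wedge])
    qed (simp add: wedges_Cons wedge_self)
  qed simp
  then have "set vs \<subseteq> {v. wedge v (wedges vs) = 0}" by auto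
  moreover have "subspace {v. wedge v (wedges vs) = 0}"
    by (rule linear_subspace_kernel[OF linear_wedge_left])
  ultimately have "span (set vs) \<subseteq> {v. wedge v (wedges vs) = 0}" by (rule span_minimal)
  then show ?thesis using assms by blast
qed

lemma contract_wedges_orthogonal:
  assumes "\<And>w. w \<in> set vs \<Longrightarrow> v \<bullet> w = 0"
  shows "contract v (wedges vs) = 0"
  using assms
proof (induction vs)
  case Nil
  show ?case by (simp add: wedges_def vec_eq_iff contract_def axis_def)
next
  case (Cons w vs)
  then show ?case by (simp add: wedges_Cons contract_wedge linear_0[OF linear_wedge])
qed

lemma inner_wedge_wedge:
  "inner (wedge v \<alpha>) (wedge v \<alpha>) = (v \<bullet> v) * inner \<alpha> \<alpha> - inner (contract v \<alpha>) (contract v \<alpha>)"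
proof -
  have "inner (wedge v \<alpha>) (wedge v \<alpha>) = inner \<alpha> (contract v (wedge v \<alpha>))"
    by (rule inner_wedge_contract)
  also have "\<dots> = (v \<bullet> v) * inner \<alpha> \<alpha> - inner \<alpha> (wedge v (contract v \<alpha>))"
    by (simp add: contract_wedge inner_diff_right)
  also have "inner \<alpha> (wedge v (contract v \<alpha>)) = inner (contract v \<alpha>) (contract v \<alpha>)"
    by (simp add: inner_commute[of \<alpha>] inner_wedge_contract)
  finally show ?thesis .
qed

lemma inner_wedges_orthonormal:
  assumes "distinct vs" "orthonormal (set vs)"
  shows "inner (wedges vs) (wedges vs) = 1"
  using assms
proof (induction vs)
  case Nil
  show ?case by (simp add: wedges_def inner_axis_axis)
next
  case (Cons v vs)
  have "contract v (wedges vs) = 0"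
    using Cons.prems by (intro contract_wedges_orthogonal) (auto simp: orthonormal_def)
  moreover have "inner (wedges vs) (wedges vs) = 1"
    using Cons by (simp add: orthonormal_def)
  moreover have "v \<bullet> v = 1" using Cons.prems by (simp add: orthonormal_def)
  ultimately show ?case by (simp add: wedges_Cons inner_wedge_wedge)
qed

text \<open>The orthonormal list \<open>vs\<close> spans a tangent space, \<open>e\<close> is the vertical direction and \<open>y\<close> its orthogonal
  projection to that space.\<close>

locale wedge_projection =
  fixes vs :: "(real ^ 'i::{finite,linorder}) list" and e y :: "real ^ ('i::{finite,linorder})"
  assumes distinct: "distinct vs" and orthonormal: "orthonormal (set vs)"
    and unit: "e \<bullet> e = 1" and y: "y \<in> span (set vs)"
    and perp: "\<And>t. t \<in> span (set vs) \<Longrightarrow> (e - y) \<bullet> t = 0"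
begin

abbreviation \<sigma> where "\<sigma> \<equiv> wedges vs"

lemma inner_e: "t \<in> span (set vs) \<Longrightarrow> t \<bullet> e = t \<bullet> y"
  using perp[of t] by (simp add: inner_diff_left inner_commute[of t])

lemma contract_perp:
  assumes "\<And>t. t \<in> span (set vs) \<Longrightarrow> z \<bullet> t = 0"
  shows "contract z \<sigma> = 0"
  using assms by (intro contract_wedges_orthogonal) (simp add: span_base)

lemma contract_e: "contract e \<sigma> = contract y \<sigma>"
  using contract_perp[OF perp] linear_diff[OF linear_contract_left, of e y \<sigma>] by simp

lemma norm_contract: "norm (contract y \<sigma>) = norm y"
proof -
  have "inner (contract y \<sigma>) (contract y \<sigma>) = y \<bullet> y"
    using inner_wedge_wedge[of y \<sigma>] wedge_wedges_span[OF y] inner_wedges_orthonormal[OF distinct orthonormal]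
    by simp
  then show ?thesis by (simp add: norm_eq_sqrt_inner)
qed

text \<open>Contraction by \<open>e\<close> is contraction by \<open>y\<close>, and \<open>y \<and> \<sigma> = 0\<close>, so \<open>contract e \<sigma>\<close> has norm
  \<open>\<bar>y\<bar> \<bar>\<sigma>\<bar> = \<bar>y\<bar>\<close>; as a second contraction by \<open>e\<close> gives \<open>0\<close>, multiplication by \<open>e\<close> preserves
  this norm.\<close>

lemma norm_wedge_contract: "norm (wedge e (contract e \<sigma>)) = norm y"
proof -
  have "inner (wedge e (contract e \<sigma>)) (wedge e (contract e \<sigma>)) = inner (contract e \<sigma>) (contract e \<sigma>)"
    by (simp add: inner_wedge_wedge unit contract_self)
  then show ?thesis
    using norm_contract by (simp add: norm_eq_sqrt_inner contract_e)
qed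

text \<open>For the harder inclusion, let \<open>z\<close> be the component of \<open>v\<close> orthogonal to the space on the right. Its
  projection to the tangent space is a multiple of \<open>y\<close>, so contraction of \<open>contract e \<sigma> = contract y \<sigma>\<close>
  by \<open>z\<close> amounts to a second contraction by \<open>y\<close> and vanishes. Then \<open>\<bar>z \<and> \<tau>\<bar> = \<bar>z\<bar> \<bar>\<tau>\<bar>\<close>, and
  \<open>z \<and> \<tau> = 0\<close> forces \<open>z = 0\<close>.\<close>

lemma kernel_wedge_contract:
  assumes "y \<noteq> 0"
  shows "{v. wedge v (wedge e (contract e \<sigma>)) = 0} = span (insert e (span (set vs) \<inter> {w. w \<bullet> e = 0}))"
proof
  let ?\<tau> = "wedge e (contract e \<sigma>)" and ?L = "insert e (span (set vs) \<inter> {w. w \<bullet> e = 0})"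
  have "wedge w ?\<tau> = 0" if "w \<in> span (set vs)" "w \<bullet> e = 0" for w
  proof -
    have "wedge w (contract e \<sigma>) = 0"
      using contract_wedge[of e w \<sigma>] that wedge_wedges_span[OF that(1)]
      by (simp add: inner_commute linear_0[OF linear_contract])
    then show ?thesis by (simp add: wedge_wedge[of w e] linear_0[OF linear_wedge])
  qed
  then have "?L \<subseteq> {v. wedge v ?\<tau> = 0}"
    using wedge_self by blast
  moreover have "subspace {v. wedge v ?\<tau> = 0}"
    by (rule linear_subspace_kernel[OF linear_wedge_left])
  ultimately show kernel: "span ?L \<subseteq> {v. wedge v ?\<tau> = 0}"
    by (rule span_minimal)
  show "{v. wedge v ?\<tau> = 0} \<subseteq> span ?L"
  proof safe
    fix v assume v: "wedge v ?\<tau> = 0"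
    obtain l z where l: "l \<in> span ?L" and z: "\<And>w. w \<in> span ?L \<Longrightarrow> orthogonal z w" and vlz: "v = l + z"
      using orthogonal_subspace_decomp_exists[of ?L v] by metis
    have ze: "z \<bullet> e = 0" using z[of e] by (simp add: orthogonal_def span_base)
    define c where "c = (z \<bullet> y) / (y \<bullet> y)"
    \<comment> \<open>\<open>c y\<close> is the projection of \<open>z\<close> to the tangent space.\<close>
    have zt: "(z - c *\<^sub>R y) \<bullet> t = 0" if t: "t \<in> span (set vs)" for t
    proof -
      define w where "w = t - ((t \<bullet> y) / (y \<bullet> y)) *\<^sub>R y"
      have w: "w \<in> span (set vs)" using t y by (simp add: w_def span_diff span_scale)
      have "w \<bullet> y = 0" using assms by (simp add: w_def inner_diff_left)
      then have "z \<bullet> w = 0"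
        using z[of w] w inner_e[OF w] by (simp add: orthogonal_def span_base)
      then show ?thesis
        by (simp add: w_def c_def inner_diff_left inner_diff_right inner_commute)
    qed
    have "contract z \<sigma> = contract (c *\<^sub>R y) \<sigma>"
      using contract_perp[OF zt] linear_diff[OF linear_contract_left, of z "c *\<^sub>R y" \<sigma>] by simp
    also have "\<dots> = c *\<^sub>R contract y \<sigma>" by (rule linear_scale[OF linear_contract_left])
    finally have "contract y (contract z \<sigma>) = 0"
      by (simp add: linear_scale[OF linear_contract] contract_self)
    then have "contract z (contract e \<sigma>) = 0"
      by (simp add: contract_e contract_anticommute[of z y])
    then have "contract z ?\<tau> = 0"
      by (simp add: contract_wedge ze linear_0[OF linear_wedge])
    moreover have "wedge z ?\<tau> = 0"
      using v kernel l linear_add[OF linear_wedge_left, of l z ?\<tau>] by (auto simp: vlz)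
    ultimately have "(z \<bullet> z) * inner ?\<tau> ?\<tau> = 0"
      using inner_wedge_wedge[of z ?\<tau>] by simp
    moreover have "inner ?\<tau> ?\<tau> \<noteq> 0"
      using norm_wedge_contract assms by (metis inner_eq_zero_iff norm_eq_zero)
    ultimately have "z = 0" by simp
    then show "v \<in> span ?L" using l vlz by simp
  qed
qed

end

abbreviation Zvec :: "'n::finite heis" where "Zvec \<equiv> axis HZ 1"

lemma wedge_Z_vertical: "\<alpha> \<in> vertical k \<Longrightarrow> wedge Zvec \<alpha> = 0"
proof -
  assume \<alpha>: "\<alpha> \<in> vertical k"
  have "vertical k \<subseteq> {\<alpha>. wedge Zvec \<alpha> = 0}"
    unfolding vertical_def
    by (rule span_minimal) (auto intro!: wedge_wedges_span span_base linear_subspace_kernel[OF linear_wedge])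
  then show ?thesis using \<alpha> by blast
qed

lemma wedge_vertical:
  fixes \<alpha> :: "real ^ 'n::{finite,linorder} hidx set"
  assumes "\<alpha> \<in> vertical k"
  shows "wedge v \<alpha> \<in> vertical (Suc k)"
proof -
  have gen: "wedge (axis i 1) (wedges (map (\<lambda>j. axis j 1) js @ [axis HZ 1])) \<in> vertical (Suc k)"
    if js: "HZ \<notin> set js" "length js + 1 = k" for js and i :: "'n hidx"
  proof (cases "i = HZ")
    case True
    have "wedges (map (\<lambda>j. axis j 1) js @ [axis HZ 1]) \<in> vertical k"
      unfolding vertical_def using js by (intro span_base) blast
    then show ?thesis
      using True by (simp add: wedge_Z_vertical vertical_def span_zero)
  next
    case False
    then show ?thesis
      unfolding vertical_def using js by (intro span_base CollectI exI[of _ "i # js"]) (auto simp: wedges_Cons)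
  qed
  have "vertical k \<subseteq> {\<alpha>. wedge (axis i 1) \<alpha> \<in> vertical (Suc k)}" for i :: "'n hidx"
    unfolding vertical_def[of k]
  proof (rule span_minimal)
    show "subspace {\<alpha>. wedge (axis i 1) \<alpha> \<in> vertical (Suc k)}"
      using linear_subspace_vimage[OF linear_wedge, of "vertical (Suc k)"]
      by (simp add: vertical_def[of "Suc k"] vimage_def)
  qed (use gen in auto)
  then have "(v $ i) *\<^sub>R wedge (axis i 1) \<alpha> \<in> vertical (Suc k)" for i
    using assms unfolding vertical_def by (intro span_scale) blast
  then have "(\<Sum>i\<in>UNIV. (v $ i) *\<^sub>R wedge (axis i 1) \<alpha>) \<in> vertical (Suc k)"
    unfolding vertical_def by (intro span_sum)
  moreover have "wedge v \<alpha> = (\<Sum>i\<in>UNIV. (v $ i) *\<^sub>R wedge (axis i 1) \<alpha>)"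
  proof -
    have "v = (\<Sum>i\<in>UNIV. (v $ i) *\<^sub>R axis i 1)"
      using basis_expansion[of v] by (simp add: scalar_mult_eq_scaleR)
    then have "wedge v \<alpha> = wedge (\<Sum>i\<in>UNIV. (v $ i) *\<^sub>R axis i 1) \<alpha>" by simp
    then show ?thesis by (simp add: linear_sum[OF linear_wedge_left] linear_scale[OF linear_wedge_left])
  qed
  ultimately show ?thesis by simp
qed

lemma wedge_Z_wedges: "wedge Zvec (wedges vs) \<in> vertical (Suc (length vs))"
proof (induction vs)
  case Nil
  show ?case
    unfolding vertical_def by (intro span_base CollectI exI[of _ "[]"]) (auto simp: wedges_def)
next
  case (Cons v vs)
  have "wedge v (wedge Zvec (wedges vs)) \<in> vertical (Suc (length (v # vs)))"
    using wedge_vertical[OF Cons.IH] by simp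
  then show ?case
    by (simp add: wedges_Cons wedge_wedge[of Zvec v] vertical_def span_neg)
qed

lemma wedge_contract_Z_wedges:
  fixes vs :: "'n::{finite,linorder} heis list"
  shows "wedge Zvec (contract Zvec (wedges vs)) \<in> vertical (length vs)"
proof (induction vs)
  case Nil
  have "contract (Zvec :: 'n heis) (wedges []) = 0" by (rule contract_wedges_orthogonal) simp
  then show ?case by (simp add: linear_0[OF linear_wedge] vertical_def span_zero)
next
  case (Cons v vs)
  have "wedge Zvec (contract Zvec (wedges (v # vs)))
      = (Zvec \<bullet> v) *\<^sub>R wedge Zvec (wedges vs) + wedge v (wedge Zvec (contract Zvec (wedges vs)))"
    by (simp add: wedges_Cons contract_wedge linear_diff[OF linear_wedge] linear_scale[OF linear_wedge]
        wedge_wedge[of Zvec v])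
  moreover have "(Zvec \<bullet> v) *\<^sub>R wedge Zvec (wedges vs) \<in> vertical (length (v # vs))"
    using wedge_Z_wedges[of vs] by (simp add: vertical_def span_scale)
  moreover have "wedge v (wedge Zvec (contract Zvec (wedges vs))) \<in> vertical (length (v # vs))"
    using wedge_vertical[OF Cons.IH] by simp
  ultimately show ?case by (simp add: vertical_def span_add)
qed

text \<open>\<open>contract Z (wedge Z \<sigma>) + wedge Z (contract Z \<sigma>) = \<sigma>\<close>, and the two terms are the parts of \<open>\<sigma>\<close> without
  and with the factor \<open>Z\<close>.\<close>

lemma orth_proj_vertical:
  "orth_proj (vertical (length vs)) (wedges vs) = wedge Zvec (contract Zvec (wedges vs))"
proof -
  let ?\<tau> = "wedge Zvec (contract Zvec (wedges vs))" and ?V = "vertical (length vs)"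
  have "wedges vs - ?\<tau> = contract Zvec (wedge Zvec (wedges vs))"
    by (simp add: contract_wedge inner_axis_axis)
  then have perp: "inner (wedges vs - ?\<tau>) w = 0" if "w \<in> ?V" for w
    using wedge_Z_vertical[OF that] by (simp add: inner_commute[of _ w] flip: inner_wedge_contract)
  show ?thesis unfolding orth_proj_def
  proof (rule the_equality)
    show "?\<tau> \<in> ?V \<and> (\<forall>w\<in>?V. inner (wedges vs - ?\<tau>) w = 0)"
      using wedge_contract_Z_wedges perp by blast
    fix u assume u: "u \<in> ?V \<and> (\<forall>w\<in>?V. inner (wedges vs - u) w = 0)"
    have "u - ?\<tau> \<in> ?V"
      using u wedge_contract_Z_wedges[of vs] by (simp add: vertical_def span_diff)
    then have "inner (wedges vs - u) (u - ?\<tau>) = 0" "inner (wedges vs - ?\<tau>) (u - ?\<tau>) = 0"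
      using u perp by blast+
    then have "inner (u - ?\<tau>) (u - ?\<tau>) = 0" by (simp add: inner_diff_left)
    then show "u = ?\<tau>" by simp
  qed
qed

section \<open>Homogeneous distances\<close>

lemma inner_Zvec: "v \<bullet> Zvec = v $ HZ"
  by (simp add: inner_axis)

text \<open>A dilation is a homothety after a stretch of the vertical direction: this is where the exponent
  \<open>p + 1\<close> comes from.\<close>

lemma hdil_eq_stretch: "hdil r v = r *\<^sub>R stretch Zvec r v"
proof -
  have "hdil r v = r *\<^sub>R (v + ((r - 1) * v $ HZ) *\<^sub>R Zvec)"
    by (simp add: vec_eq_iff hidx_all hdil_def axis_def power2_eq_square algebra_simps)
  then show ?thesis by (simp add: stretch_def inner_Zvec)
qed

lemma linear_stretch: "linear (stretch e s)"
  by (rule linearI) (simp_all add: stretch_def inner_add_left algebra_simps)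

lemma linear_hdil: "linear (hdil r)"
  using linear_compose_scale_right[OF linear_stretch] by (simp add: hdil_eq_stretch[abs_def])

lemma hdil_inner_Z: "hdil r v \<bullet> Zvec = r\<^sup>2 * (v \<bullet> Zvec)"
  by (simp add: inner_Zvec hdil_def)

lemma hdil_horizontal: "v \<bullet> Zvec = 0 \<Longrightarrow> hdil r v = r *\<^sub>R v"
  by (simp add: hdil_eq_stretch stretch_def)

lemma hdil_hdil: "hdil r (hdil s v) = hdil (r * s) v"
  by (simp add: vec_eq_iff hidx_all hdil_def power_mult_distrib)

lemma hdil_1: "hdil 1 v = v"
  by (simp add: vec_eq_iff hidx_all hdil_def)

lemma norm_hdil_le:
  fixes v :: "'n::finite heis"
  assumes "0 \<le> r"
  shows "norm (hdil r v) \<le> (2 * r + r\<^sup>2) * norm v"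
proof -
  have "hdil r v = r *\<^sub>R v + ((r\<^sup>2 - r) * (v \<bullet> Zvec)) *\<^sub>R Zvec"
    by (simp add: hdil_eq_stretch stretch_def power2_eq_square algebra_simps)
  then have "norm (hdil r v) \<le> norm (r *\<^sub>R v) + norm (((r\<^sup>2 - r) * (v \<bullet> Zvec)) *\<^sub>R (Zvec :: 'n heis))"
    by (simp only:) (rule norm_triangle_ineq)
  also have "norm (r *\<^sub>R v) = r * norm v" using assms by simp
  also have "norm (((r\<^sup>2 - r) * (v \<bullet> Zvec)) *\<^sub>R (Zvec :: 'n heis)) = \<bar>r\<^sup>2 - r\<bar> * \<bar>v \<bullet> Zvec\<bar>"
    by (simp add: abs_mult)
  also have "\<bar>r\<^sup>2 - r\<bar> * \<bar>v \<bullet> Zvec\<bar> \<le> (r\<^sup>2 + r) * norm v"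
    using assms Cauchy_Schwarz_ineq2[of v Zvec]
    by (intro mult_mono) (auto simp: abs_le_iff)
  finally show ?thesis by (simp add: algebra_simps)
qed

lemma hmul_left_coords: "hmul x (left_coords x (y - x)) = y"
  using left_field_left_coords[of x "y - x"] by (simp add: left_field_eq)

locale homogeneous_dist =
  fixes \<rho> :: "'n::finite heis \<Rightarrow> 'n heis \<Rightarrow> real"
  assumes hom: "homogeneous_distance \<rho>"
begin

lemma metric: "Metric_space UNIV \<rho>"
  using hom by (simp add: homogeneous_distance_def)

lemma dist_from_origin: "\<rho> x y = \<rho> 0 (left_coords x (y - x))"
proof -
  have "hmul x 0 = x" by (simp add: vec_eq_iff hidx_all hmul_nth)
  then show ?thesis
    using hom hmul_left_coords[of x y] unfolding homogeneous_distance_def by metis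
qed

lemma hball_eq: "hball \<rho> x r = {y. \<rho> 0 (left_coords x (y - x)) < r}"
  by (simp add: Metric_space.mball_def[OF metric] flip: dist_from_origin)

lemma dist_hdil: "r > 0 \<Longrightarrow> \<rho> 0 (hdil r y) = r * \<rho> 0 y"
  using hom linear_0[OF linear_hdil] unfolding homogeneous_distance_def by metis

lemma continuous_on_dist: "continuous_on S (\<rho> 0)"
proof -
  have "continuous_on UNIV (\<lambda>y. case (0, y) of (x, y) \<Rightarrow> \<rho> x y)"
    using hom unfolding homogeneous_distance_def
    by (intro continuous_on_compose2[of UNIV "\<lambda>(x, y). \<rho> x y" UNIV "\<lambda>y. (0, y)"])
      (auto intro!: continuous_intros)
  then have "continuous_on UNIV (\<rho> 0)" by simp
  then show ?thesis by (rule continuous_on_subset) simp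
qed

text \<open>A point far from the origin can be dilated into the Euclidean unit sphere, on which the distance to the
  origin is bounded below by compactness.\<close>

lemma unit_ball_bounded:
  obtains R where "R > 0" "\<And>v. \<rho> 0 v < 1 \<Longrightarrow> norm v \<le> R"
proof -
  have "sphere 0 1 \<noteq> ({} :: 'n heis set)"
    using norm_axis_1[of "HZ :: 'n hidx"] by (metis empty_iff mem_sphere_0)
  then obtain a :: "'n heis" where a: "norm a = 1" "\<And>v. norm v = 1 \<Longrightarrow> \<rho> 0 a \<le> \<rho> 0 v"
    using continuous_attains_inf[OF compact_sphere _ continuous_on_dist, of 0 1] by auto
  define m where "m = \<rho> 0 a"
  have "a \<noteq> 0" using a(1) by auto
  then have m: "m > 0"
    using Metric_space.mdist_pos_less[OF metric, of 0 a] by (simp add: m_def)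
  have small: "norm v \<le> 1" if v: "\<rho> 0 v < m" for v
  proof (rule ccontr)
    assume "\<not> norm v \<le> 1"
    moreover have "continuous_on {0..1} (\<lambda>s. norm (hdil s v))"
      unfolding hdil_eq_stretch stretch_def by (intro continuous_intros)
    moreover have "norm (hdil 0 v) = 0" by (simp add: hdil_eq_stretch)
    ultimately obtain s where s: "0 \<le> s" "s \<le> 1" "norm (hdil s v) = 1"
      using IVT'[of "\<lambda>s. norm (hdil s v)" 0 1 1] by (auto simp: hdil_1)
    then have "s > 0" using \<open>norm (hdil 0 v) = 0\<close> by (cases "s = 0") auto
    have "m \<le> \<rho> 0 (hdil s v)" using a(2)[OF s(3)] by (simp add: m_def)
    also have "\<dots> = s * \<rho> 0 v" by (rule dist_hdil[OF \<open>s > 0\<close>])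
    also have "\<dots> \<le> \<rho> 0 v"
      using s Metric_space.nonneg[OF metric] by (intro mult_left_le_one_le) auto
    finally show False using v by simp
  qed
  define R where "R = 2 * (1 / m) + (1 / m)\<^sup>2"
  show thesis
  proof (rule that[of R])
    show "R > 0" using m by (simp add: R_def add_pos_pos)
    fix v assume v: "\<rho> 0 v < 1"
    have "norm (hdil m v) \<le> 1"
      using v m by (intro small) (simp add: dist_hdil)
    have "v = hdil (1 / m) (hdil m v)" using m by (simp add: hdil_hdil hdil_1)
    then have "norm v \<le> R * norm (hdil m v)"
      using norm_hdil_le[of "1 / m" "hdil m v"] m by (simp add: R_def)
    also have "\<dots> \<le> R * 1"
      using \<open>norm (hdil m v) \<le> 1\<close> \<open>R > 0\<close> by (intro mult_left_mono) auto
    finally show "norm v \<le> R" by simp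
  qed
qed

lemma hausdorff_ball_subgroup:
  assumes B: "orthonormal B" "Zvec \<in> B" and s: "s > 0"
  shows "hausdorff dist p (span B \<inter> {v. \<rho> 0 v < s})
       = ennreal (s ^ (p + 1)) * hausdorff dist p (span B \<inter> {v. \<rho> 0 v < 1})"
proof -
  let ?A = "span B \<inter> {v. \<rho> 0 v < 1}"
  have "open {v. \<rho> 0 v < 1}"
    using continuous_on_dist[of UNIV] by (intro open_Collect_less continuous_on_const) 
  then have A: "openin (top_of_set (span B)) ?A" by (rule openin_open_Int)
  have in_span: "hdil r v \<in> span B" if "v \<in> span B" for r v
    using that B by (simp add: hdil_eq_stretch span_scale stretch_in_span)
  have "span B \<inter> {v. \<rho> 0 v < s} = (\<lambda>v. s *\<^sub>R v) ` stretch Zvec s ` ?A"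
  proof -
    have "span B \<inter> {v. \<rho> 0 v < s} = hdil s ` ?A"
    proof safe
      fix v assume v: "v \<in> span B" "\<rho> 0 v < s"
      have "v = hdil s (hdil (1 / s) v)" using s by (simp add: hdil_hdil hdil_1)
      moreover have "hdil (1 / s) v \<in> ?A" using v s in_span by (simp add: dist_hdil)
      ultimately show "v \<in> hdil s ` ?A" by blast
    qed (use s in_span in \<open>auto simp: dist_hdil\<close>)
    then show ?thesis by (simp add: image_image hdil_eq_stretch)
  qed
  also have "hausdorff dist p \<dots> = ennreal (s ^ p) * hausdorff dist p (stretch Zvec s ` ?A)"
    using s by (intro hausdorff_scaled_isometry) (simp_all add: dist_norm flip: scaleR_diff_right)
  also have "hausdorff dist p (stretch Zvec s ` ?A) = ennreal s * hausdorff dist p ?A"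
    by (rule hausdorff_stretch[OF B s A])
  also have "ennreal (s ^ p) * (ennreal s * hausdorff dist p ?A) = ennreal (s ^ (p + 1)) * hausdorff dist p ?A"
    using s by (simp add: ennreal_mult mult_ac)
  finally show ?thesis .
qed

end

section \<open>The tangent space at a transverse point\<close>

lemma le_of_small_error:
  fixes a b K :: real
  assumes "a \<le> b + (1 - 1 / K) * a" "K > 1"
  shows "a \<le> K * b"
proof -
  have "(1 / K) * a \<le> b" using assms(1) by (simp add: algebra_simps)
  then show ?thesis using assms(2) by (simp add: field_simps)
qed

text \<open>\<open>vs\<close> is an orthonormal basis of the tangent space \<open>T\<close> in left invariant coordinates, and \<open>B\<close> one of the vertical
  subgroup \<open>L\<close> spanned by \<open>Z\<close> and the horizontal vectors of \<open>T\<close>.\<close>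

locale transverse_tangent =
  fixes \<Omega> M :: "'n::{finite,linorder} heis set" and x :: "'n heis" and vs :: "'n heis list" and B :: "'n heis set"
  assumes submanifold: "C1_submanifold (length vs) \<Omega> M" and x: "x \<in> M"
    and distinct_vs: "distinct vs" and orthonormal_vs: "orthonormal (set vs)"
    and tangent: "left_coords x ` tangent_space M x = span (set vs)"
    and transverse: "\<not> span (set vs) \<subseteq> {w. w \<bullet> Zvec = 0}"
    and B: "orthonormal B" "Zvec \<in> B"
    and span_B: "span B = span (insert Zvec (span (set vs) \<inter> {w. w \<bullet> Zvec = 0}))"
begin

text \<open>The orthogonal projection of the vertical direction to the tangent space.\<close>

definition y where "y = (\<Sum>b\<in>set vs. (Zvec \<bullet> b) *\<^sub>R b)"

definition \<kappa> where "\<kappa> = norm y"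

definition proj :: "'n heis \<Rightarrow> 'n heis" where "proj v = (\<Sum>b\<in>B. (v \<bullet> b) *\<^sub>R b)"

text \<open>The stretch makes up for the contraction of the direction \<open>y\<close> under \<open>proj\<close>, so that tangent vectors
  keep their length.\<close>

definition flat :: "'n heis \<Rightarrow> 'n heis" where "flat v = stretch Zvec (1 / \<kappa>) (proj v)"

definition \<xi> :: "'n heis \<Rightarrow> 'n heis" where "\<xi> q = left_coords x (q - x)"

lemma y_in_span: "y \<in> span (set vs)"
  unfolding y_def by (rule sum_scaleR_in_span)

lemma Z_minus_y_perp:
  assumes "t \<in> span (set vs)"
  shows "(Zvec - y) \<bullet> t = 0"
proof -
  have "(Zvec - y) \<bullet> b = 0" if "b \<in> set vs" for b
    using orthonormal_coords[OF orthonormal_vs that, of "\<lambda>b. Zvec \<bullet> b"] by (simp add: y_def inner_diff_left)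
  then have "span (set vs) \<subseteq> {t. (Zvec - y) \<bullet> t = 0}"
    by (intro span_minimal subspace_hyperplane) auto
  then show ?thesis using assms by blast
qed

sublocale wedge_projection vs Zvec y
  by unfold_locales (use distinct_vs orthonormal_vs y_in_span Z_minus_y_perp in \<open>auto simp: inner_axis_axis\<close>)

lemma kappa_pos: "\<kappa> > 0"
proof -
  obtain t where "t \<in> span (set vs)" "t \<bullet> Zvec \<noteq> 0" using transverse by blast
  then have "y \<noteq> 0" using inner_e[of t] by auto
  then show ?thesis by (simp add: \<kappa>_def)
qed

lemma y_inner: "y \<bullet> y = \<kappa>\<^sup>2" "y \<bullet> Zvec = \<kappa>\<^sup>2"
  using inner_e[OF y_in_span] by (simp_all add: \<kappa>_def power2_norm_eq_inner)

lemma linear_proj: "linear proj"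
  by (rule linearI) (simp_all add: proj_def inner_add_left algebra_simps sum.distrib scaleR_sum_right)

lemma proj_in: "proj v \<in> span B"
  unfolding proj_def by (rule sum_scaleR_in_span)

lemma proj_id: "v \<in> span B \<Longrightarrow> proj v = v"
  unfolding proj_def using orthonormal_expansion[OF B(1)] by metis

lemma proj_Z: "proj v \<bullet> Zvec = v \<bullet> Zvec"
  unfolding proj_def by (rule orthonormal_coords[OF B])

lemma linear_flat: "linear flat"
  using linear_compose[OF linear_proj linear_stretch[of Zvec "1 / \<kappa>"]] by (simp add: flat_def[abs_def] o_def)

lemma proj_y: "proj y = \<kappa>\<^sup>2 *\<^sub>R Zvec"
proof -
  have "(y - \<kappa>\<^sup>2 *\<^sub>R Zvec) \<bullet> l = 0" if "l \<in> insert Zvec (span (set vs) \<inter> {w. w \<bullet> Zvec = 0})" for l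
  proof -
    have "(y - \<kappa>\<^sup>2 *\<^sub>R Zvec) \<bullet> l = l \<bullet> y - \<kappa>\<^sup>2 * (l \<bullet> Zvec)"
      by (simp add: inner_diff_left inner_commute[of l])
    also have "\<dots> = 0"
      using that inner_e[of l] y_inner(2) by (auto simp: inner_axis_axis inner_commute[of Zvec y])
    finally show ?thesis .
  qed
  then have "span B \<subseteq> {l. (y - \<kappa>\<^sup>2 *\<^sub>R Zvec) \<bullet> l = 0}"
    unfolding span_B by (intro span_minimal subspace_hyperplane) auto
  then have "(y - \<kappa>\<^sup>2 *\<^sub>R Zvec) \<bullet> b = 0" if "b \<in> B" for b
    using that span_base by blast
  then have "proj (y - \<kappa>\<^sup>2 *\<^sub>R Zvec) = 0" by (simp add: proj_def)
  moreover have "proj Zvec = Zvec" using B by (simp add: proj_id span_base)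
  ultimately show ?thesis by (simp add: linear_diff[OF linear_proj] linear_scale[OF linear_proj])
qed

text \<open>The component along \<open>y\<close> carries the vertical coordinate of \<open>t\<close>, and the projection to \<open>L\<close> replaces
  it by a multiple of \<open>Z\<close> with the same vertical coordinate.\<close>

lemma tangent_decomposition:
  assumes t: "t \<in> span (set vs)"
  obtains w where "w \<bullet> Zvec = 0" "w \<bullet> y = 0" "t = w + ((t \<bullet> Zvec) / \<kappa>\<^sup>2) *\<^sub>R y"
    "proj t = w + (t \<bullet> Zvec) *\<^sub>R Zvec"
proof -
  define w where "w = t - ((t \<bullet> Zvec) / \<kappa>\<^sup>2) *\<^sub>R y"
  have w: "w \<in> span (set vs)" using t y_in_span by (simp add: w_def span_diff span_scale)
  have wZ: "w \<bullet> Zvec = 0" using kappa_pos by (simp add: w_def inner_diff_left y_inner)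
  have "w \<in> span B" unfolding span_B using w wZ by (intro span_base) auto
  moreover have t_eq: "t = w + ((t \<bullet> Zvec) / \<kappa>\<^sup>2) *\<^sub>R y" by (simp add: w_def)
  ultimately have "proj t = w + (t \<bullet> Zvec) *\<^sub>R Zvec"
    using linear_add[OF linear_proj, of w "((t \<bullet> Zvec) / \<kappa>\<^sup>2) *\<^sub>R y"] kappa_pos
    by (simp add: linear_scale[OF linear_proj] proj_y proj_id)
  then show thesis using that wZ inner_e[OF w] t_eq by metis
qed

lemma norm_flat_tangent:
  assumes t: "t \<in> span (set vs)"
  shows "norm (flat t) = norm t"
proof -
  obtain w where w: "w \<bullet> Zvec = 0" "w \<bullet> y = 0" "t = w + ((t \<bullet> Zvec) / \<kappa>\<^sup>2) *\<^sub>R y"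
    "proj t = w + (t \<bullet> Zvec) *\<^sub>R Zvec"
    using tangent_decomposition[OF t] by blast
  define c where "c = t \<bullet> Zvec"
  have "proj t = w + c *\<^sub>R Zvec" unfolding c_def by (rule w(4))
  then have "flat t = w + (c / \<kappa>) *\<^sub>R Zvec"
    unfolding flat_def stretch_def by (simp add: inner_add_left w(1) inner_axis_axis algebra_simps)
  then have "flat t \<bullet> flat t = w \<bullet> w + (c / \<kappa>)\<^sup>2"
    using w(1) by (simp add: inner_add_left inner_add_right inner_commute[of Zvec] inner_axis_axis power2_eq_square)
  moreover have "t \<bullet> t = w \<bullet> w + (c / \<kappa>\<^sup>2)\<^sup>2 * \<kappa>\<^sup>2"
  proof -
    have t_eq: "t = w + (c / \<kappa>\<^sup>2) *\<^sub>R y" unfolding c_def by (rule w(3))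
    have "(w + a *\<^sub>R y) \<bullet> (w + a *\<^sub>R y) = w \<bullet> w + a\<^sup>2 * (y \<bullet> y)" for a
      using w(2) by (simp add: inner_add_left inner_add_right inner_commute[of y w] power2_eq_square)
    from this[of "c / \<kappa>\<^sup>2"] show ?thesis unfolding t_eq[symmetric] y_inner .
  qed
  moreover have "(c / \<kappa>)\<^sup>2 = (c / \<kappa>\<^sup>2)\<^sup>2 * \<kappa>\<^sup>2"
    using kappa_pos by (simp add: field_simps power2_eq_square)
  ultimately show ?thesis by (simp add: norm_eq_sqrt_inner)
qed

lemma tangent_span:
  obtains b where "tangent_space M x = span b" "finite b" "card b \<le> length vs"
proof
  have "tangent_space M x = (\<lambda>v. left_field v x) ` left_coords x ` tangent_space M x"
    by (simp add: image_image left_field_left_coords)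
  also have "\<dots> = span ((\<lambda>v. left_field v x) ` set vs)"
    unfolding tangent by (rule linear_span_image[OF linear_left_field, symmetric])
  finally show "tangent_space M x = span ((\<lambda>v. left_field v x) ` set vs)" .
  show "card ((\<lambda>v. left_field v x) ` set vs) \<le> length vs"
    by (meson List.finite_set card_image_le card_length order_trans)
qed simp

lemma near_tangent:
  assumes "\<eta> > 0"
  obtains \<delta> where "\<delta> > 0" "\<And>q q'. q \<in> M \<inter> ball x \<delta> \<Longrightarrow> q' \<in> M \<inter> ball x \<delta> \<Longrightarrow>
    \<exists>t\<in>span (set vs). norm (left_coords x (q - q') - t) \<le> \<eta> * norm (left_coords x (q - q'))"
proof -
  obtain c where c: "c > 0" "\<And>w :: 'n heis. norm w \<le> c * norm (left_coords x w)"
    using left_coords_bounded_below by blast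
  obtain C where C: "C > 0" "\<And>w. norm (left_coords x w) \<le> C * norm w"
    using linear_bounded_pos[OF linear_left_coords] by blast
  obtain b where b: "tangent_space M x = span b" "finite b" "card b \<le> length vs"
    by (rule tangent_span)
  have "\<eta> / (C * c) > 0" using assms C c by simp
  then obtain \<delta> where \<delta>: "\<delta> > 0" "\<forall>q\<in>M \<inter> ball x \<delta>. \<forall>q'\<in>M \<inter> ball x \<delta>.
       \<exists>\<tau>\<in>tangent_space M x. norm (q - q' - \<tau>) \<le> \<eta> / (C * c) * norm (q - q')"
    using C1_submanifold_local(1)[OF submanifold x b] by blast
  show thesis
  proof (rule that[OF \<delta>(1)])
    fix q q' assume "q \<in> M \<inter> ball x \<delta>" "q' \<in> M \<inter> ball x \<delta>"
    then obtain \<tau> where \<tau>: "\<tau> \<in> tangent_space M x" "norm (q - q' - \<tau>) \<le> \<eta> / (C * c) * norm (q - q')"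
      using \<delta>(2) by blast
    have "norm (left_coords x (q - q') - left_coords x \<tau>) \<le> C * norm (q - q' - \<tau>)"
      using C(2)[of "q - q' - \<tau>"] by (simp add: linear_diff[OF linear_left_coords])
    also have "\<dots> \<le> C * (\<eta> / (C * c) * norm (q - q'))"
      using \<tau>(2) C(1) by (intro mult_left_mono) auto
    also have "\<dots> = \<eta> / c * norm (q - q')" using C(1) by simp
    also have "\<dots> \<le> \<eta> / c * (c * norm (left_coords x (q - q')))"
      using c assms by (intro mult_left_mono) auto
    also have "\<dots> = \<eta> * norm (left_coords x (q - q'))" using c(1) by simp
    finally show "\<exists>t\<in>span (set vs). norm (left_coords x (q - q') - t) \<le> \<eta> * norm (left_coords x (q - q'))"
      using \<tau>(1) unfolding tangent[symmetric] by blast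
  qed
qed

text \<open>A chord of the submanifold is close to a tangent vector, whose length \<open>flat\<close> preserves.\<close>

lemma flat_almost_isometric:
  assumes K: "K > 1"
  obtains \<delta> where "\<delta> > 0"
    "\<And>q q'. q \<in> M \<inter> ball x \<delta> \<Longrightarrow> q' \<in> M \<inter> ball x \<delta> \<Longrightarrow>
       norm (left_coords x (q - q')) \<le> K * norm (flat (left_coords x (q - q')))"
    "\<And>q q'. q \<in> M \<inter> ball x \<delta> \<Longrightarrow> q' \<in> M \<inter> ball x \<delta> \<Longrightarrow>
       norm (flat (left_coords x (q - q'))) \<le> K * norm (left_coords x (q - q'))"
proof -
  obtain C where C: "C > 0" "\<And>w. norm (flat w) \<le> C * norm w"
    using linear_bounded_pos[OF linear_flat] by blast
  define \<mu> where "\<mu> = 1 - 1 / K"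
  have \<mu>: "\<mu> > 0" "\<mu> \<le> K - 1" using K one_minus_inverse_le[OF K] by (auto simp: \<mu>_def)
  have "\<mu> / (1 + C) > 0" using \<mu> C by (simp add: add_pos_pos)
  then obtain \<delta> where \<delta>: "\<delta> > 0" "\<And>q q'. q \<in> M \<inter> ball x \<delta> \<Longrightarrow> q' \<in> M \<inter> ball x \<delta> \<Longrightarrow>
    \<exists>t\<in>span (set vs). norm (left_coords x (q - q') - t) \<le> \<mu> / (1 + C) * norm (left_coords x (q - q'))"
    using near_tangent by blast
  have main: "\<bar>norm w - norm (flat w)\<bar> \<le> \<mu> * norm w"
    if "t \<in> span (set vs)" "norm (w - t) \<le> \<mu> / (1 + C) * norm w" for w t
  proof -
    have "norm (flat w - flat t) \<le> C * norm (w - t)"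
      using C(2)[of "w - t"] by (simp add: linear_diff[OF linear_flat])
    moreover have "\<bar>norm (flat w) - norm (flat t)\<bar> \<le> norm (flat w - flat t)" "\<bar>norm w - norm t\<bar> \<le> norm (w - t)"
      by (rule norm_triangle_ineq3)+
    ultimately have "\<bar>norm w - norm (flat w)\<bar> \<le> (1 + C) * norm (w - t)"
      using norm_flat_tangent[OF that(1)] by (simp add: algebra_simps)
    also have "\<dots> \<le> (1 + C) * (\<mu> / (1 + C) * norm w)"
      using that(2) C(1) by (intro mult_left_mono) auto
    also have "\<dots> = \<mu> * norm w" using C(1) by simp
    finally show ?thesis .
  qed
  show thesis
  proof (rule that[OF \<delta>(1)])
    fix q q' assume q: "q \<in> M \<inter> ball x \<delta>" "q' \<in> M \<inter> ball x \<delta>"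
    let ?w = "left_coords x (q - q')"
    have le: "\<bar>norm ?w - norm (flat ?w)\<bar> \<le> \<mu> * norm ?w" using \<delta>(2)[OF q] main by blast
    then show "norm ?w \<le> K * norm (flat ?w)"
      using K by (intro le_of_small_error) (auto simp: \<mu>_def abs_le_iff)
    have "norm (flat ?w) \<le> norm ?w + (K - 1) * norm ?w"
      using le mult_right_mono[OF \<mu>(2), of "norm ?w"] by (simp add: abs_le_iff)
    then show "norm (flat ?w) \<le> K * norm ?w" by (simp add: algebra_simps)
  qed
qed

text \<open>On tangent vectors the displacement under \<open>proj\<close> is proportional to the vertical coordinate, which is of order \<open>r\<^sup>2\<close>
  in the ball of radius \<open>r\<close>; the rest is controlled by the distance to the tangent space.\<close>

lemma proj_error:
  obtains C where "C > 0" "\<And>\<eta>. \<eta> > 0 \<Longrightarrow> \<exists>\<delta>>0. \<forall>q\<in>M \<inter> ball x \<delta>.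
    norm (\<xi> q - proj (\<xi> q)) \<le> C * \<bar>\<xi> q \<bullet> Zvec\<bar> + \<eta> * norm (\<xi> q)"
proof -
  define z0 where "z0 = (1 / \<kappa>\<^sup>2) *\<^sub>R y - Zvec"
  have z0: "t - proj t = (t \<bullet> Zvec) *\<^sub>R z0" if t: "t \<in> span (set vs)" for t
  proof -
    obtain w where "t = w + ((t \<bullet> Zvec) / \<kappa>\<^sup>2) *\<^sub>R y" "proj t = w + (t \<bullet> Zvec) *\<^sub>R Zvec"
      using tangent_decomposition[OF t] by blast
    then have "t - proj t = (w + ((t \<bullet> Zvec) / \<kappa>\<^sup>2) *\<^sub>R y) - (w + (t \<bullet> Zvec) *\<^sub>R Zvec)" by simp
    then show ?thesis by (simp add: z0_def scaleR_diff_right)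
  qed
  \<comment> \<open>\<open>J\<close> vanishes on the tangent space, so it is small on the submanifold.\<close>
  define J where "J v = v - proj v - (v \<bullet> Zvec) *\<^sub>R z0" for v
  have linJ: "linear J"
    by (rule linearI) (simp_all add: J_def linear_add[OF linear_proj] linear_scale[OF linear_proj]
        inner_add_left algebra_simps)
  obtain C where C: "C > 0" "\<And>w. norm (J w) \<le> C * norm w"
    using linear_bounded_pos[OF linJ] by blast
  show thesis
  proof (rule that[of "norm z0 + 1"])
    show "norm z0 + 1 > 0" by (simp add: add_nonneg_pos)
    fix \<eta> :: real assume "\<eta> > 0"
    then have "\<eta> / C > 0" using C by simp
    then obtain \<delta> where \<delta>: "\<delta> > 0" "\<And>q q'. q \<in> M \<inter> ball x \<delta> \<Longrightarrow> q' \<in> M \<inter> ball x \<delta> \<Longrightarrow>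
      \<exists>t\<in>span (set vs). norm (left_coords x (q - q') - t) \<le> \<eta> / C * norm (left_coords x (q - q'))"
      using near_tangent by blast
    show "\<exists>\<delta>>0. \<forall>q\<in>M \<inter> ball x \<delta>. norm (\<xi> q - proj (\<xi> q)) \<le> (norm z0 + 1) * \<bar>\<xi> q \<bullet> Zvec\<bar> + \<eta> * norm (\<xi> q)"
    proof (intro exI[of _ \<delta>] conjI ballI \<delta>(1))
      fix q assume q: "q \<in> M \<inter> ball x \<delta>"
      obtain t where t: "t \<in> span (set vs)" "norm (\<xi> q - t) \<le> \<eta> / C * norm (\<xi> q)"
        using \<delta>(2)[OF q, of x] x \<delta>(1) by (auto simp: \<xi>_def)
      have "J t = 0" using z0[OF t(1)] by (simp add: J_def)
      then have "J (\<xi> q) = J (\<xi> q - t)" by (simp add: linear_diff[OF linJ])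
      then have "norm (J (\<xi> q)) \<le> C * (\<eta> / C * norm (\<xi> q))"
        using C(2)[of "\<xi> q - t"] mult_left_mono[OF t(2), of C] C(1) by simp
      then have 1: "norm (J (\<xi> q)) \<le> \<eta> * norm (\<xi> q)" using C(1) by simp
      have "\<xi> q - proj (\<xi> q) = (\<xi> q \<bullet> Zvec) *\<^sub>R z0 + J (\<xi> q)" by (simp add: J_def)
      then have "norm (\<xi> q - proj (\<xi> q)) \<le> norm ((\<xi> q \<bullet> Zvec) *\<^sub>R z0) + norm (J (\<xi> q))"
        by (simp only:) (rule norm_triangle_ineq)
      also have "norm ((\<xi> q \<bullet> Zvec) *\<^sub>R z0) \<le> (norm z0 + 1) * \<bar>\<xi> q \<bullet> Zvec\<bar>"
        by (simp add: algebra_simps)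
      finally show "norm (\<xi> q - proj (\<xi> q)) \<le> (norm z0 + 1) * \<bar>\<xi> q \<bullet> Zvec\<bar> + \<eta> * norm (\<xi> q)"
        using 1 by simp
    qed
  qed
qed

lemma proj_locally_onto:
  assumes "\<delta> > 0"
  obtains \<delta>' where "\<delta>' > 0" "\<And>v. v \<in> span B \<Longrightarrow> norm v < \<delta>' \<Longrightarrow> \<exists>q\<in>M \<inter> ball x \<delta>. proj (\<xi> q) = v"
proof -
  let ?\<Phi> = "\<lambda>w. proj (left_coords x w)"
  have lin: "linear ?\<Phi>" using linear_compose[OF linear_left_coords linear_proj] by (simp add: o_def)
  obtain b where b: "tangent_space M x = span b" "finite b" "card b \<le> length vs"
    by (rule tangent_span)
  have img: "?\<Phi> ` tangent_space M x = proj ` span (set vs)"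
    by (simp add: image_image[symmetric] tangent)
  have sub: "span B \<subseteq> proj ` span (set vs)"
    unfolding span_B
  proof (rule span_minimal)
    show "subspace (proj ` span (set vs))" by (intro linear_subspace_image linear_proj subspace_span)
    have "Zvec = proj ((1 / \<kappa>\<^sup>2) *\<^sub>R y)"
      using kappa_pos by (simp add: linear_scale[OF linear_proj] proj_y)
    then have "Zvec \<in> proj ` span (set vs)"
      using y_in_span by (metis imageI span_scale)
    moreover have "w \<in> proj ` span (set vs)" if w: "w \<in> span (set vs)" "w \<bullet> Zvec = 0" for w
    proof -
      have "w \<in> span B" unfolding span_B using w by (intro span_base) auto
      then show ?thesis using w(1) proj_id by (metis imageI)
    qed
    ultimately show "insert Zvec (span (set vs) \<inter> {w. w \<bullet> Zvec = 0}) \<subseteq> proj ` span (set vs)" by auto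
  qed
  have range: "range ?\<Phi> \<subseteq> ?\<Phi> ` tangent_space M x"
    using sub proj_in unfolding img by blast
  obtain \<delta>' where \<delta>': "\<delta>' > 0" "\<forall>v\<in>range ?\<Phi>. norm v < \<delta>' \<longrightarrow> (\<exists>q\<in>M \<inter> ball x \<delta>. ?\<Phi> (q - x) = v)"
    using C1_submanifold_local(2)[OF submanifold x b lin range assms] by blast
  have "span B \<subseteq> range ?\<Phi>"
    using sub unfolding img[symmetric] by blast
  then show thesis using that[OF \<delta>'(1)] \<delta>'(2) unfolding \<xi>_def by blast
qed

end

section \<open>Comparison with homogeneous balls of the vertical subgroup\<close>

text \<open>Multiplication by \<open>a\<close> is continuous at \<open>1\<close>, also for \<open>a = \<infinity>\<close>.\<close>

lemma ennreal_power_near_1: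
  fixes a b :: ennreal
  assumes "a < b"
  obtains l where "l > 1" "ennreal (l ^ m) * a < b"
proof -
  have "((\<lambda>l::real. ennreal (l ^ m) * a) \<longlongrightarrow> ennreal (1 ^ m) * a) (at_right 1)"
    by (intro tendsto_mult_ennreal tendsto_ennrealI tendsto_intros) auto
  then have "\<forall>\<^sub>F l in at_right (1::real). ennreal (l ^ m) * a < b"
    using assms by (intro order_tendstoD) auto
  moreover have "\<forall>\<^sub>F l in at_right (1::real). l > 1"
    by (simp add: eventually_at_filter)
  ultimately have "\<forall>\<^sub>F l in at_right (1::real). l > 1 \<and> ennreal (l ^ m) * a < b"
    by eventually_elim simp
  then show thesis using that eventually_happens'[OF trivial_limit_at_right_real] by blast
qed

lemma tendsto_of_multiplicative_bounds:
  fixes f :: "'a \<Rightarrow> ennreal"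
  assumes "\<And>l. l > 1 \<Longrightarrow> \<forall>\<^sub>F r in F. f r \<le> ennreal (l ^ m) * a \<and> a \<le> ennreal (l ^ m) * f r"
  shows "(f \<longlongrightarrow> a) F"
proof (rule order_tendstoI)
  fix c assume "c < a"
  then obtain l where l: "l > 1" "ennreal (l ^ m) * c < a" by (rule ennreal_power_near_1)
  show "\<forall>\<^sub>F r in F. c < f r"
    using assms[OF l(1)]
  proof eventually_elim
    case (elim r)
    show "c < f r"
    proof (rule ccontr)
      assume "\<not> c < f r"
      then have "ennreal (l ^ m) * f r \<le> ennreal (l ^ m) * c" by (intro mult_left_mono) auto
      then show False using elim l(2) by auto
    qed
  qed
next
  fix c assume "a < c"
  then obtain l where l: "l > 1" "ennreal (l ^ m) * a < c" by (rule ennreal_power_near_1)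
  show "\<forall>\<^sub>F r in F. f r < c"
    using assms[OF l(1)] by eventually_elim (use l(2) in auto)
qed

context transverse_tangent
begin

lemma flat_xi_diff: "flat (\<xi> q) - flat (\<xi> q') = flat (left_coords x (q - q'))"
proof -
  have "\<xi> q - \<xi> q' = left_coords x (q - q')"
    unfolding \<xi>_def linear_diff[OF linear_left_coords, symmetric] by simp
  then show ?thesis by (simp flip: linear_diff[OF linear_flat])
qed

context
  fixes \<rho> :: "'n heis \<Rightarrow> 'n heis \<Rightarrow> real"
  assumes \<rho>: "homogeneous_distance \<rho>"
begin

interpretation homogeneous_dist \<rho>
  by unfold_locales (rule \<rho>)

lemma mem_hball: "q \<in> hball \<rho> x r \<longleftrightarrow> \<rho> 0 (\<xi> q) < r"
  by (simp add: hball_eq \<xi>_def)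

text \<open>The ball of radius \<open>r\<close> has size \<open>r\<close> in general but \<open>r\<^sup>2\<close> in the vertical direction.\<close>

lemma anisotropic_bound:
  obtains R where "R > 0" "\<And>r v. 0 < r \<Longrightarrow> r \<le> 1 \<Longrightarrow> \<rho> 0 v < r \<Longrightarrow>
    norm (hdil (1 / r) v) \<le> R \<and> norm v \<le> 3 * R * r \<and> \<bar>v \<bullet> Zvec\<bar> \<le> R * r\<^sup>2"
proof -
  obtain R where R: "R > 0" "\<And>v. \<rho> 0 v < 1 \<Longrightarrow> norm v \<le> R"
    using unit_ball_bounded by blast
  show thesis
  proof (rule that[OF R(1)])
    fix r :: real and v assume r: "0 < r" "r \<le> 1" and v: "\<rho> 0 v < r"
    define a where "a = hdil (1 / r) v"
    have a: "norm a \<le> R" using v r by (intro R(2)) (simp add: a_def dist_hdil)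
    have va: "v = hdil r a" using r by (simp add: a_def hdil_hdil hdil_1)
    have "2 * r + r\<^sup>2 \<le> 3 * r" using r by (simp add: power2_eq_square mult_left_le)
    then have "norm v \<le> 3 * r * R"
      unfolding va using r a R(1) by (intro order_trans[OF norm_hdil_le] mult_mono) auto
    moreover have "\<bar>a \<bullet> Zvec\<bar> \<le> R"
      using Cauchy_Schwarz_ineq2[of a Zvec] a by simp
    then have "\<bar>v \<bullet> Zvec\<bar> \<le> r\<^sup>2 * R"
      unfolding va hdil_inner_Z abs_mult using r by (simp add: mult_left_mono)
    ultimately show "norm (hdil (1 / r) v) \<le> R \<and> norm v \<le> 3 * R * r \<and> \<bar>v \<bullet> Zvec\<bar> \<le> R * r\<^sup>2"
      using a by (simp add: a_def mult_ac)
  qed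
qed

lemma eventually_hball_subset:
  assumes "\<delta> > 0"
  shows "\<forall>\<^sub>F r in at_right 0. hball \<rho> x r \<subseteq> ball x \<delta>"
proof -
  obtain R where R: "R > 0" "\<And>r v. 0 < r \<Longrightarrow> r \<le> 1 \<Longrightarrow> \<rho> 0 v < r \<Longrightarrow>
    norm (hdil (1 / r) v) \<le> R \<and> norm v \<le> 3 * R * r \<and> \<bar>v \<bullet> Zvec\<bar> \<le> R * r\<^sup>2"
    by (rule anisotropic_bound) blast
  obtain c where c: "c > 0" "\<And>w :: 'n heis. norm w \<le> c * norm (left_coords x w)"
    using left_coords_bounded_below by blast
  define r0 where "r0 = min 1 (\<delta> / (3 * R * c))"
  have r0: "r0 > 0" "r0 \<le> 1" "3 * R * c * r0 \<le> \<delta>"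
    using assms R(1) c(1) by (auto simp: r0_def min_def field_simps)
  have "hball \<rho> x r \<subseteq> ball x \<delta>" if r: "0 < r" "r < r0" for r
  proof
    fix q assume "q \<in> hball \<rho> x r"
    then have "norm (\<xi> q) \<le> 3 * R * r" using R(2)[of r "\<xi> q"] r r0 by (simp add: mem_hball)
    then have "c * norm (\<xi> q) \<le> c * (3 * R * r)" using c(1) by (intro mult_left_mono) auto
    moreover have "c * (3 * R * r) < c * (3 * R * r0)" using r R(1) c(1) by simp
    moreover have "norm (q - x) \<le> c * norm (\<xi> q)" unfolding \<xi>_def by (rule c(2))
    ultimately have "norm (q - x) < \<delta>" using r0(3) by (simp add: mult_ac)
    then show "q \<in> ball x \<delta>" by (simp add: dist_norm norm_minus_commute)
  qed
  then show ?thesis using eventually_at_right_real[OF r0(1)] by (auto elim!: eventually_mono)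
qed

text \<open>Dilating by \<open>1 / r\<close> turns a horizontal displacement of size \<open>\<omega> r\<close> into one of size \<open>\<omega>\<close>, so uniform
  continuity of the distance on a fixed compact set applies.\<close>

lemma horizontal_perturbation:
  assumes "\<epsilon> > 0"
  obtains \<omega> where "\<omega> > 0" "\<And>r a b. 0 < r \<Longrightarrow> r \<le> 1 \<Longrightarrow> \<rho> 0 a < r \<Longrightarrow> (b - a) \<bullet> Zvec = 0 \<Longrightarrow>
    norm (b - a) \<le> \<omega> * r \<Longrightarrow> \<rho> 0 b \<le> \<rho> 0 a + \<epsilon> * r"
proof -
  obtain R where R: "R > 0" "\<And>r v. 0 < r \<Longrightarrow> r \<le> 1 \<Longrightarrow> \<rho> 0 v < r \<Longrightarrow>
    norm (hdil (1 / r) v) \<le> R \<and> norm v \<le> 3 * R * r \<and> \<bar>v \<bullet> Zvec\<bar> \<le> R * r\<^sup>2"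
    by (rule anisotropic_bound) blast
  have "uniformly_continuous_on (cball 0 (R + 1)) (\<rho> 0)"
    by (rule compact_uniformly_continuous[OF continuous_on_dist compact_cball])
  then obtain \<eta> where \<eta>: "\<eta> > 0" "\<And>u v. u \<in> cball 0 (R + 1) \<Longrightarrow> v \<in> cball 0 (R + 1) \<Longrightarrow> dist v u < \<eta> \<Longrightarrow>
      dist (\<rho> 0 v) (\<rho> 0 u) < \<epsilon>"
    unfolding uniformly_continuous_on_def using assms by metis
  define \<omega> where "\<omega> = min 1 (\<eta> / 2)"
  have \<omega>: "\<omega> > 0" "\<omega> \<le> 1" "\<omega> < \<eta>" using \<eta>(1) by (auto simp: \<omega>_def)
  show thesis
  proof (rule that[OF \<omega>(1)])
    fix r :: real and a b
    assume r: "0 < r" "r \<le> 1" and a: "\<rho> 0 a < r" and Z: "(b - a) \<bullet> Zvec = 0" and small: "norm (b - a) \<le> \<omega> * r"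
    let ?a = "hdil (1 / r) a" and ?b = "hdil (1 / r) b"
    have "?b - ?a = (1 / r) *\<^sub>R (b - a)"
      using hdil_horizontal[OF Z] by (simp add: linear_diff[OF linear_hdil])
    then have "norm (?b - ?a) = norm (b - a) / r" using r by simp
    also have "\<dots> \<le> \<omega>" using small r by (simp add: pos_divide_le_eq)
    finally have "norm (?b - ?a) \<le> \<omega>" .
    moreover have "norm ?a \<le> R" using R(2)[OF r a] by simp
    moreover have "norm ?b \<le> norm ?a + norm (?b - ?a)" by (rule norm_triangle_sub)
    ultimately have "dist (\<rho> 0 ?b) (\<rho> 0 ?a) < \<epsilon>"
      using \<omega> by (intro \<eta>(2)) (auto simp: dist_norm)
    then have "\<rho> 0 ?b \<le> \<rho> 0 ?a + \<epsilon>" by (simp add: dist_real_def)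
    then show "\<rho> 0 b \<le> \<rho> 0 a + \<epsilon> * r" using r by (simp add: dist_hdil field_simps)
  qed
qed

text \<open>For points in question the displacement by \<open>proj\<close> is horizontal and at most \<open>\<omega> r\<close>: the vertical coordinate
  contributes \<open>O(r\<^sup>2)\<close>, and tangency contributes \<open>o(r)\<close>. The second inclusion also needs that
  \<open>proj\<close> maps the submanifold onto a neighbourhood of the origin in \<open>L\<close>.\<close>

lemma proj_ball_sandwich:
  assumes l: "l > 1"
  shows "\<forall>\<^sub>F r in at_right 0. proj ` \<xi> ` (M \<inter> hball \<rho> x r) \<subseteq> span B \<inter> {v. \<rho> 0 v < l * r} \<and>
           span B \<inter> {v. \<rho> 0 v < r / l} \<subseteq> proj ` \<xi> ` (M \<inter> hball \<rho> x r)"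
proof -
  obtain R where R: "R > 0" "\<And>r v. 0 < r \<Longrightarrow> r \<le> 1 \<Longrightarrow> \<rho> 0 v < r \<Longrightarrow>
    norm (hdil (1 / r) v) \<le> R \<and> norm v \<le> 3 * R * r \<and> \<bar>v \<bullet> Zvec\<bar> \<le> R * r\<^sup>2"
    by (rule anisotropic_bound) blast
  define \<epsilon> where "\<epsilon> = 1 - 1 / l"
  have \<epsilon>: "\<epsilon> > 0" "1 + \<epsilon> \<le> l" "1 / l + \<epsilon> = 1"
    using l one_minus_inverse_le[OF l] by (auto simp: \<epsilon>_def)
  obtain \<omega> where \<omega>: "\<omega> > 0" "\<And>r a b. 0 < r \<Longrightarrow> r \<le> 1 \<Longrightarrow> \<rho> 0 a < r \<Longrightarrow> (b - a) \<bullet> Zvec = 0 \<Longrightarrow>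
    norm (b - a) \<le> \<omega> * r \<Longrightarrow> \<rho> 0 b \<le> \<rho> 0 a + \<epsilon> * r"
    using horizontal_perturbation[OF \<epsilon>(1)] by blast
  obtain S where S: "S > 0" "\<And>v :: 'n heis. norm (stretch Zvec (1 / \<kappa>) v) \<le> S * norm v"
    using linear_bounded_pos[OF linear_stretch] by blast
  define G where "G = 3 * R + 2 * S * (3 * R)"
  have G: "G > 0" "3 * R \<le> G" "2 * S * (3 * R) \<le> G"
    using R(1) S(1) by (auto simp: G_def add_pos_pos)
  obtain C where C: "C > 0" and err: "\<And>\<eta>. \<eta> > 0 \<Longrightarrow> \<exists>\<delta>>0. \<forall>q\<in>M \<inter> ball x \<delta>.
    norm (\<xi> q - proj (\<xi> q)) \<le> C * \<bar>\<xi> q \<bullet> Zvec\<bar> + \<eta> * norm (\<xi> q)"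
    by (rule proj_error) blast
  \<comment> \<open>\<open>G r\<close> bounds \<open>\<xi> q\<close> in both inclusions, so that the tangency error stays below \<open>\<omega> r / 2\<close>.\<close>
  define \<eta> where "\<eta> = \<omega> / (2 * G)"
  have "\<eta> > 0" using \<omega>(1) G(1) by (simp add: \<eta>_def)
  obtain \<delta>1 where \<delta>1: "\<delta>1 > 0" "\<forall>q\<in>M \<inter> ball x \<delta>1. norm (\<xi> q - proj (\<xi> q)) \<le> C * \<bar>\<xi> q \<bullet> Zvec\<bar> + \<eta> * norm (\<xi> q)"
    using err[OF \<open>\<eta> > 0\<close>] by blast
  obtain \<delta>2 where \<delta>2: "\<delta>2 > 0" "\<And>q q'. q \<in> M \<inter> ball x \<delta>2 \<Longrightarrow> q' \<in> M \<inter> ball x \<delta>2 \<Longrightarrow>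
       norm (left_coords x (q - q')) \<le> 2 * norm (flat (left_coords x (q - q')))"
    using flat_almost_isometric[of 2] by (metis one_less_numeral_iff semiring_norm(76))
  define \<delta> where "\<delta> = min \<delta>1 \<delta>2"
  have \<delta>: "\<delta> > 0" using \<delta>1 \<delta>2 by (simp add: \<delta>_def)
  obtain \<delta>' where \<delta>': "\<delta>' > 0" "\<And>v. v \<in> span B \<Longrightarrow> norm v < \<delta>' \<Longrightarrow> \<exists>q\<in>M \<inter> ball x \<delta>. proj (\<xi> q) = v"
    using proj_locally_onto[OF \<delta>] by blast
  define r0 where "r0 = min 1 (min (\<omega> / (2 * C * R)) (\<delta>' / (3 * R)))"
  have "r0 \<le> \<omega> / (2 * C * R)" "r0 \<le> \<delta>' / (3 * R)" by (auto simp: r0_def)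
  then have r0: "C * R * r0 \<le> \<omega> / 2" "3 * R * r0 \<le> \<delta>'" "r0 > 0" "r0 \<le> 1"
    using \<omega>(1) C R(1) \<delta>'(1) by (simp_all add: pos_le_divide_eq mult_ac) (simp_all add: r0_def)
  have horizontal: "(\<xi> q - proj (\<xi> q)) \<bullet> Zvec = 0" "(proj (\<xi> q) - \<xi> q) \<bullet> Zvec = 0" for q
    by (simp_all add: inner_diff_left proj_Z)
  have close: "norm (\<xi> q - proj (\<xi> q)) \<le> \<omega> * r"
    if q: "q \<in> M \<inter> ball x \<delta>" "norm (\<xi> q) \<le> G * r" "\<bar>\<xi> q \<bullet> Zvec\<bar> \<le> R * r\<^sup>2" and r: "0 < r" "r < r0" for q r
  proof -
    have "norm (\<xi> q - proj (\<xi> q)) \<le> C * \<bar>\<xi> q \<bullet> Zvec\<bar> + \<eta> * norm (\<xi> q)"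
      using \<delta>1(2) q(1) by (auto simp: \<delta>_def)
    also have "\<dots> \<le> C * (R * r\<^sup>2) + \<eta> * (G * r)"
      using C q(2,3) \<open>\<eta> > 0\<close> by (intro add_mono mult_left_mono) auto
    also have "C * (R * r\<^sup>2) \<le> C * R * r0 * r"
      using C R(1) r by (simp add: power2_eq_square)
    also have "\<dots> \<le> \<omega> / 2 * r"
      using r0(1) r by (intro mult_right_mono) auto
    also have "\<eta> * (G * r) = \<omega> / 2 * r"
      using G(1) by (simp add: \<eta>_def)
    finally show ?thesis by simp
  qed
  have main: "proj ` \<xi> ` (M \<inter> hball \<rho> x r) \<subseteq> span B \<inter> {v. \<rho> 0 v < l * r} \<and>
           span B \<inter> {v. \<rho> 0 v < r / l} \<subseteq> proj ` \<xi> ` (M \<inter> hball \<rho> x r)"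
    if r: "0 < r" "r < r0" and sub: "hball \<rho> x r \<subseteq> ball x \<delta>" for r
  proof
    have r1: "0 < r" "r \<le> 1" using r r0 by auto
    show "proj ` \<xi> ` (M \<inter> hball \<rho> x r) \<subseteq> span B \<inter> {v. \<rho> 0 v < l * r}"
    proof safe
      fix q assume q: "q \<in> M" "q \<in> hball \<rho> x r"
      show "proj (\<xi> q) \<in> span B" by (rule proj_in)
      have less: "\<rho> 0 (\<xi> q) < r" using q(2) by (simp add: mem_hball)
      have "norm (\<xi> q) \<le> 3 * R * r" using R(2)[OF r1 less] by simp
      also have "\<dots> \<le> G * r" using G(2) r by (intro mult_right_mono) auto
      finally have "norm (proj (\<xi> q) - \<xi> q) \<le> \<omega> * r"
        using close[of q r] q sub R(2)[OF r1 less] r by (auto simp: norm_minus_commute)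
      then have "\<rho> 0 (proj (\<xi> q)) \<le> \<rho> 0 (\<xi> q) + \<epsilon> * r"
        by (intro \<omega>(2)[OF r1 less] horizontal)
      also have "\<dots> < (1 + \<epsilon>) * r" using less by (simp add: algebra_simps)
      also have "\<dots> \<le> l * r" using \<epsilon>(2) r by (intro mult_right_mono) auto
      finally show "\<rho> 0 (proj (\<xi> q)) < l * r" .
    qed
    show "span B \<inter> {v. \<rho> 0 v < r / l} \<subseteq> proj ` \<xi> ` (M \<inter> hball \<rho> x r)"
    proof safe
      fix v assume v: "v \<in> span B" "\<rho> 0 v < r / l"
      have "r / l \<le> r" using r l by (simp add: field_simps)
      then have less: "\<rho> 0 v < r" using v(2) by simp
      have vR: "norm v \<le> 3 * R * r" "\<bar>v \<bullet> Zvec\<bar> \<le> R * r\<^sup>2" using R(2)[OF r1 less] by auto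
      have "3 * R * r < 3 * R * r0" using r R(1) by simp
      then have "norm v < \<delta>'" using vR(1) r0(2) by simp
      then obtain q where q: "q \<in> M \<inter> ball x \<delta>" "proj (\<xi> q) = v" using \<delta>'(2)[OF v(1)] by blast
      have "norm (\<xi> q) \<le> 2 * norm (flat (\<xi> q))"
        using \<delta>2(2)[of q x] q(1) x \<delta>2(1) by (auto simp: \<delta>_def \<xi>_def)
      also have "\<dots> \<le> 2 * (S * norm v)"
        unfolding flat_def q(2) by (intro mult_left_mono S(2)) auto
      also have "\<dots> \<le> 2 * (S * (3 * R * r))"
        using vR(1) S(1) by (intro mult_left_mono) auto
      also have "\<dots> = 2 * S * (3 * R) * r" by simp
      also have "\<dots> \<le> G * r" using G(3) r by (intro mult_right_mono) auto
      finally have "norm (\<xi> q - v) \<le> \<omega> * r"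
        using close[OF q(1) _ _ r] vR(2) q(2) proj_Z[of "\<xi> q"] by simp
      then have "\<rho> 0 (\<xi> q) \<le> \<rho> 0 v + \<epsilon> * r"
        using horizontal(1)[of q] by (intro \<omega>(2)[OF r1 less]) (simp_all add: q(2))
      also have "\<dots> < r / l + \<epsilon> * r" using v(2) by simp
      also have "\<dots> = (1 / l + \<epsilon>) * r" by (simp add: algebra_simps)
      finally have "\<rho> 0 (\<xi> q) < r" using \<epsilon>(3) by simp
      then show "v \<in> proj ` \<xi> ` (M \<inter> hball \<rho> x r)"
        using q by (auto simp: mem_hball)
    qed
  qed
  show ?thesis
    using eventually_at_right_real[OF r0(3)] eventually_hball_subset[OF \<delta>]
    by eventually_elim (use main in auto)
qed

lemma hausdorff_flat_ball:
  assumes "s > 0"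
  shows "hausdorff dist p (stretch Zvec (1 / \<kappa>) ` (span B \<inter> {v. \<rho> 0 v < s}))
       = ennreal (1 / \<kappa> * s ^ (p + 1)) * hausdorff dist p (span B \<inter> {v. \<rho> 0 v < 1})"
proof -
  have "open {v. \<rho> 0 v < s}"
    using continuous_on_dist[of UNIV] by (intro open_Collect_less continuous_on_const)
  then have "openin (top_of_set (span B)) (span B \<inter> {v. \<rho> 0 v < s})" by (rule openin_open_Int)
  then have "hausdorff dist p (stretch Zvec (1 / \<kappa>) ` (span B \<inter> {v. \<rho> 0 v < s}))
      = ennreal (1 / \<kappa>) * hausdorff dist p (span B \<inter> {v. \<rho> 0 v < s})"
    using kappa_pos by (intro hausdorff_stretch[OF B]) auto
  also have "\<dots> = ennreal (1 / \<kappa>) * (ennreal (s ^ (p + 1)) * hausdorff dist p (span B \<inter> {v. \<rho> 0 v < 1}))"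
    using hausdorff_ball_subgroup[OF B assms] by simp
  also have "\<dots> = ennreal (1 / \<kappa> * s ^ (p + 1)) * hausdorff dist p (span B \<inter> {v. \<rho> 0 v < 1})"
  proof -
    have "ennreal (1 / \<kappa> * s ^ (p + 1)) = ennreal (1 / \<kappa>) * ennreal (s ^ (p + 1))"
      using kappa_pos by (intro ennreal_mult') simp
    then show ?thesis by (simp only: mult.assoc)
  qed
  finally show ?thesis .
qed

lemma vol_flat_comparison:
  assumes l: "l > 1"
  shows "\<forall>\<^sub>F r in at_right 0.
    vol p (M \<inter> hball \<rho> x r) \<le> ennreal (l ^ (2 * p)) * hausdorff dist p ((flat \<circ> \<xi>) ` (M \<inter> hball \<rho> x r)) \<and>
    hausdorff dist p ((flat \<circ> \<xi>) ` (M \<inter> hball \<rho> x r)) \<le> ennreal (l ^ (2 * p)) * vol p (M \<inter> hball \<rho> x r)"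
proof -
  obtain \<delta>1 where \<delta>1: "\<delta>1 > 0"
    "\<And>y z. y \<in> ball x \<delta>1 \<Longrightarrow> z \<in> ball x \<delta>1 \<Longrightarrow> riem_dist y z \<le> l * norm (left_coords x (y - z))"
    "\<And>y z. y \<in> ball x \<delta>1 \<Longrightarrow> z \<in> ball x \<delta>1 \<Longrightarrow> norm (left_coords x (y - z)) \<le> l * riem_dist y z"
    using riem_dist_near[OF l] by blast
  obtain \<delta>2 where \<delta>2: "\<delta>2 > 0"
    "\<And>q q'. q \<in> M \<inter> ball x \<delta>2 \<Longrightarrow> q' \<in> M \<inter> ball x \<delta>2 \<Longrightarrow>
       norm (left_coords x (q - q')) \<le> l * norm (flat (left_coords x (q - q')))"
    "\<And>q q'. q \<in> M \<inter> ball x \<delta>2 \<Longrightarrow> q' \<in> M \<inter> ball x \<delta>2 \<Longrightarrow>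
       norm (flat (left_coords x (q - q'))) \<le> l * norm (left_coords x (q - q'))"
    using flat_almost_isometric[OF l] by blast
  obtain c where c: "c > 0" "\<And>w :: 'n heis. norm w \<le> c * norm (left_coords x w)"
    using left_coords_bounded_below by blast
  have "min \<delta>1 \<delta>2 > 0" using \<delta>1 \<delta>2 by simp
  from eventually_hball_subset[OF this] show ?thesis
  proof eventually_elim
    case (elim r)
    let ?E = "M \<inter> hball \<rho> x r" and ?f = "flat \<circ> \<xi>"
    have d: "dist (?f q) (?f q') = norm (flat (left_coords x (q - q')))" for q q'
      by (simp add: dist_norm flat_xi_diff)
    have mem: "q \<in> ball x \<delta>1" "q \<in> M \<inter> ball x \<delta>2" if "q \<in> ?E" for q
      using that elim by auto
    have l2: "(l\<^sup>2) ^ p = l ^ (2 * p)" by (simp add: power_mult)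
    have up: "riem_dist q q' \<le> l\<^sup>2 * dist (?f q) (?f q')" if "q \<in> ?E" "q' \<in> ?E" for q q'
    proof -
      have "riem_dist q q' \<le> l * norm (left_coords x (q - q'))"
        using mem that by (intro \<delta>1(2))
      also have "\<dots> \<le> l * (l * norm (flat (left_coords x (q - q'))))"
        using l mem that by (intro mult_left_mono \<delta>2(2)) auto
      finally show ?thesis unfolding d by (simp add: power2_eq_square mult_ac)
    qed
    have lo: "dist (?f q) (?f q') \<le> l\<^sup>2 * riem_dist q q'" if "q \<in> ?E" "q' \<in> ?E" for q q'
    proof -
      have "dist (?f q) (?f q') \<le> l * norm (left_coords x (q - q'))"
        unfolding d using mem that by (intro \<delta>2(3))
      also have "\<dots> \<le> l * (l * riem_dist q q')"
        using l mem that by (intro mult_left_mono \<delta>1(3)) auto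
      finally show ?thesis by (simp add: power2_eq_square mult_ac)
    qed
    have "inj_on ?f ?E"
    proof (rule inj_onI)
      fix q q' assume q: "q \<in> ?E" "q' \<in> ?E" "?f q = ?f q'"
      then have "norm (flat (left_coords x (q - q'))) = 0" using d[of q q'] by simp
      then have "norm (left_coords x (q - q')) \<le> 0" using \<delta>2(2)[OF mem(2)[OF q(1)] mem(2)[OF q(2)]] by simp
      then show "q = q'" using c(2)[of "q - q'"] by simp
    qed
    then show ?case
      unfolding vol_def l2[symmetric] using l up lo
      by (intro conjI hausdorff_le_of_expanding hausdorff_lipschitz_image) auto
  qed
qed

text \<open>The two almost isometries cost \<open>l ^ (2 * p)\<close> and the sandwich costs \<open>l ^ (p + 1)\<close>.\<close>

theorem density:
  "((\<lambda>r. vol p (M \<inter> hball \<rho> x r) / ennreal (r ^ (p + 1)))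
     \<longlongrightarrow> hausdorff dist p (span B \<inter> {v. \<rho> 0 v < 1}) / ennreal \<kappa>) (at_right 0)"
proof (rule tendsto_of_multiplicative_bounds[where m = "3 * p + 1"])
  fix l :: real assume l: "l > 1"
  let ?\<theta> = "hausdorff dist p (span B \<inter> {v. \<rho> 0 v < 1})"
  have div: "a / ennreal c = ennreal (1 / c) * a" if "c > 0" for a c
    using that by (simp add: divide_ennreal_def inverse_ennreal mult.commute inverse_eq_divide)
  show "\<forall>\<^sub>F r in at_right 0. vol p (M \<inter> hball \<rho> x r) / ennreal (r ^ (p + 1))
           \<le> ennreal (l ^ (3 * p + 1)) * (?\<theta> / ennreal \<kappa>) \<and>
        ?\<theta> / ennreal \<kappa> \<le> ennreal (l ^ (3 * p + 1)) * (vol p (M \<inter> hball \<rho> x r) / ennreal (r ^ (p + 1)))"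
    using proj_ball_sandwich[OF l] vol_flat_comparison[OF l, of p] eventually_at_right_less[of "0::real"]
  proof eventually_elim
    case (elim r)
    let ?E = "M \<inter> hball \<rho> x r"
    let ?F = "(flat \<circ> \<xi>) ` ?E"
    have r: "r > 0" using elim by simp
    have F: "?F = stretch Zvec (1 / \<kappa>) ` proj ` \<xi> ` ?E"
      by (simp add: image_image flat_def o_def)
    have "hausdorff dist p ?F \<le> hausdorff dist p (stretch Zvec (1 / \<kappa>) ` (span B \<inter> {v. \<rho> 0 v < l * r}))"
      unfolding F using elim by (intro hausdorff_mono image_mono) simp
    then have up: "hausdorff dist p ?F \<le> ennreal (1 / \<kappa> * (l * r) ^ (p + 1)) * ?\<theta>"
      using hausdorff_flat_ball[of "l * r"] l r by simp
    have "hausdorff dist p (stretch Zvec (1 / \<kappa>) ` (span B \<inter> {v. \<rho> 0 v < r / l})) \<le> hausdorff dist p ?F"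
      unfolding F using elim by (intro hausdorff_mono image_mono) simp
    then have lo: "ennreal (1 / \<kappa> * (r / l) ^ (p + 1)) * ?\<theta> \<le> hausdorff dist p ?F"
      using hausdorff_flat_ball[of "r / l"] l r by simp
    have exponent: "2 * p + (p + 1) = 3 * p + 1" by simp
    show ?case
    proof
      have "ennreal (1 / r ^ (p + 1)) * vol p ?E
          \<le> ennreal (1 / r ^ (p + 1)) * (ennreal (l ^ (2 * p)) * (ennreal (1 / \<kappa> * (l * r) ^ (p + 1)) * ?\<theta>))"
        using elim up by (meson mult_left_mono order_trans zero_le)
      also have "\<dots> = ennreal (1 / r ^ (p + 1) * (l ^ (2 * p) * (1 / \<kappa> * (l * r) ^ (p + 1)))) * ?\<theta>"
        using l r kappa_pos by (simp only: ennreal_mult' mult.assoc zero_le_divide_1_iff zero_le_power less_imp_le)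
      also have "1 / r ^ (p + 1) * (l ^ (2 * p) * (1 / \<kappa> * (l * r) ^ (p + 1))) = l ^ (3 * p + 1) * (1 / \<kappa>)"
        unfolding power_mult_distrib exponent[symmetric] power_add[of l "2 * p"] using r by simp
      also have "ennreal (l ^ (3 * p + 1) * (1 / \<kappa>)) = ennreal (l ^ (3 * p + 1)) * ennreal (1 / \<kappa>)"
        using l by (intro ennreal_mult') simp
      finally show "vol p ?E / ennreal (r ^ (p + 1)) \<le> ennreal (l ^ (3 * p + 1)) * (?\<theta> / ennreal \<kappa>)"
        using r kappa_pos by (simp only: div zero_less_power mult.assoc)
    next
      have "ennreal (l ^ (p + 1) / r ^ (p + 1)) * (ennreal (1 / \<kappa> * (r / l) ^ (p + 1)) * ?\<theta>)
          \<le> ennreal (l ^ (p + 1) / r ^ (p + 1)) * (ennreal (l ^ (2 * p)) * vol p ?E)"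
        using elim lo by (meson mult_left_mono order_trans zero_le)
      moreover have "ennreal (l ^ (p + 1) / r ^ (p + 1)) * (ennreal (1 / \<kappa> * (r / l) ^ (p + 1)) * ?\<theta>)
          = ennreal (1 / \<kappa>) * ?\<theta>"
      proof -
        have "l ^ (p + 1) / r ^ (p + 1) * (1 / \<kappa> * (r / l) ^ (p + 1)) = 1 / \<kappa>"
          unfolding power_divide using l r by simp
        then show ?thesis using l r kappa_pos by (simp flip: mult.assoc ennreal_mult')
      qed
      moreover have "ennreal (l ^ (p + 1) / r ^ (p + 1)) * (ennreal (l ^ (2 * p)) * vol p ?E)
          = ennreal (l ^ (3 * p + 1)) * (ennreal (1 / r ^ (p + 1)) * vol p ?E)"
      proof -
        have "l ^ (p + 1) / r ^ (p + 1) * l ^ (2 * p) = l ^ (3 * p + 1) * (1 / r ^ (p + 1))"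
          unfolding exponent[symmetric] power_add[of l "2 * p"] by simp
        moreover have "ennreal (l ^ (p + 1) / r ^ (p + 1)) * ennreal (l ^ (2 * p))
            = ennreal (l ^ (p + 1) / r ^ (p + 1) * l ^ (2 * p))"
          using l r by (intro ennreal_mult'[symmetric]) simp
        moreover have "ennreal (l ^ (3 * p + 1)) * ennreal (1 / r ^ (p + 1))
            = ennreal (l ^ (3 * p + 1) * (1 / r ^ (p + 1)))"
          using l by (intro ennreal_mult'[symmetric]) simp
        ultimately show ?thesis by (simp only: mult.assoc[symmetric])
      qed
      ultimately show "?\<theta> / ennreal \<kappa> \<le> ennreal (l ^ (3 * p + 1)) * (vol p ?E / ennreal (r ^ (p + 1)))"
        using r kappa_pos by (simp only: div zero_less_power)
    qed
  qed
qed

end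

end

section \<open>The density theorem\<close>

lemma orthonormal_list:
  fixes vs :: "'a::real_inner list"
  assumes "\<And>i j. i < length vs \<Longrightarrow> j < length vs \<Longrightarrow> vs ! i \<bullet> vs ! j = (if i = j then 1 else 0)"
  shows "distinct vs" and "orthonormal (set vs)"
proof -
  have eq: "i = j" if "i < length vs" "j < length vs" "vs ! i = vs ! j" for i j
  proof (rule ccontr)
    assume "i \<noteq> j"
    then have "vs ! i \<bullet> vs ! j = 0" using assms[OF that(1,2)] by simp
    moreover have "vs ! i \<bullet> vs ! i = 1" using assms[OF that(1,1)] by simp
    ultimately show False unfolding that(3) by simp
  qed
  then show "distinct vs" unfolding distinct_conv_nth by blast
  show "orthonormal (set vs)"
    unfolding orthonormal_def using assms by (auto simp: in_set_conv_nth)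
qed

text \<open>In the left invariant frame, \<open>t\<close> is the combination of the frame fields with coefficients \<open>left_coords x t\<close>.\<close>

lemma horizontal_if_left_coords:
  assumes "left_coords x t \<bullet> Zvec = 0"
  shows "t \<in> horizontal x"
proof -
  let ?v = "left_coords x t"
  have "?v = (\<Sum>i\<in>UNIV. (?v $ i) *\<^sub>R axis i 1)"
    using basis_expansion[of ?v] by (simp add: scalar_mult_eq_scaleR)
  then have "left_field ?v x = left_field (\<Sum>i\<in>UNIV. (?v $ i) *\<^sub>R axis i 1) x" by simp
  also have "\<dots> = (\<Sum>i\<in>UNIV. (?v $ i) *\<^sub>R left_field (axis i 1) x)"
    by (simp add: linear_sum[OF linear_left_field] linear_scale[OF linear_left_field])
  finally have t: "t = (\<Sum>i\<in>UNIV. (?v $ i) *\<^sub>R left_field (axis i 1) x)"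
    unfolding left_field_left_coords .
  have in_horizontal: "(?v $ i) *\<^sub>R left_field (axis i 1) x \<in> horizontal x" for i
  proof (cases "i = HZ")
    case True
    then show ?thesis using assms by (simp add: inner_Zvec horizontal_def span_zero)
  next
    case False
    then show ?thesis unfolding horizontal_def by (intro span_scale span_base) blast
  qed
  have "(\<Sum>i\<in>UNIV. (?v $ i) *\<^sub>R left_field (axis i 1) x) \<in> horizontal x"
    using in_horizontal unfolding horizontal_def by (rule span_sum)
  then show ?thesis by (simp only: t[symmetric])
qed

theorem theorem1p1:
  fixes \<Omega> M :: "'n::{finite,linorder} heis set"
    and \<rho> :: "'n heis \<Rightarrow> 'n heis \<Rightarrow> real"
    and p :: nat and x :: "'n heis"
    and \<tau> :: "real ^ 'n hidx set"
  assumes "open \<Omega>"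
    and "homogeneous_distance \<rho>"
    and "C1_submanifold p \<Omega> M"
    and "x \<in> M"
    and "transverse_at M x"
    and "vertical_tangent_pvector p M x \<tau>"
  shows "((\<lambda>r. vol p (M \<inter> hball \<rho> x r) / ennreal (r ^ (p + 1)))
           \<longlongrightarrow> metric_factor \<rho> p \<tau> / ennreal (norm \<tau>)) (at_right 0)"
proof -
  obtain ts where ts: "length ts = p" "span (set ts) = tangent_space M x"
      "\<And>i j. i < p \<Longrightarrow> j < p \<Longrightarrow> riem_metric x (ts ! i) (ts ! j) = (if i = j then 1 else 0)"
    and \<tau>: "\<tau> = orth_proj (vertical p) (wedges (map (left_coords x) ts))"
    using assms(6) unfolding vertical_tangent_pvector_def tangent_pvector_def by blast
  define vs where "vs = map (left_coords x) ts"
  have len: "length vs = p" by (simp add: vs_def ts)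
  have "vs ! i \<bullet> vs ! j = (if i = j then 1 else 0)" if "i < length vs" "j < length vs" for i j
    using ts(3)[of i j] that ts(1) by (simp add: vs_def riem_metric_def)
  note on = orthonormal_list[of vs, OF this]
  have tangent: "left_coords x ` tangent_space M x = span (set vs)"
    unfolding ts(2)[symmetric] vs_def by (simp add: linear_span_image[OF linear_left_coords])
  have transverse: "\<not> span (set vs) \<subseteq> {w. w \<bullet> Zvec = 0}"
    using assms(5) horizontal_if_left_coords unfolding transverse_at_def tangent[symmetric] by blast
  let ?W = "span (set vs) \<inter> {w. w \<bullet> Zvec = 0}"
  have "subspace {w :: 'n heis. w \<bullet> Zvec = 0}"
    using subspace_hyperplane[of Zvec] by (simp add: inner_commute)
  then have W: "subspace ?W" by (intro subspace_inter subspace_span)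
  obtain b where b: "b \<subseteq> ?W" "pairwise orthogonal b" "\<And>v. v \<in> b \<Longrightarrow> norm v = 1" "independent b" "span b = ?W"
    using orthonormal_basis_subspace[OF W] by metis
  have "orthonormal (insert Zvec b)"
    unfolding orthonormal_def
  proof (intro conjI ballI)
    show "finite (insert Zvec b)" using b(4) independent_imp_finite by blast
    fix v w assume "v \<in> insert Zvec b" "w \<in> insert Zvec b"
    moreover have "v \<bullet> Zvec = 0 \<and> Zvec \<bullet> v = 0 \<and> v \<bullet> v = 1" if "v \<in> b" for v
      using b(1) b(3)[OF that] that by (auto simp: inner_commute norm_eq_1)
    moreover have "v \<bullet> w = 0" if "v \<in> b" "w \<in> b" "v \<noteq> w"
      using b(2) that by (simp add: pairwise_def orthogonal_def)
    ultimately show "v \<bullet> w = (if v = w then 1 else 0)" by (auto simp: inner_axis_axis)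
  qed
  moreover have "span (insert Zvec b) = span (insert Zvec ?W)"
    unfolding span_insert using b(5) by (metis span_span)
  ultimately interpret transverse_tangent \<Omega> M x vs "insert Zvec b"
    using assms(3,4) len on tangent transverse by unfold_locales auto
  have \<tau>_eq: "\<tau> = wedge Zvec (contract Zvec (wedges vs))"
    unfolding \<tau> vs_def[symmetric] len[symmetric] by (rule orth_proj_vertical)
  have norm: "norm \<tau> = \<kappa>"
    unfolding \<tau>_eq \<kappa>_def by (rule norm_wedge_contract)
  have "y \<noteq> 0" using kappa_pos by (auto simp: \<kappa>_def)
  then have "{v. wedge v \<tau> = 0} = span (insert Zvec b)"
    unfolding \<tau>_eq span_B by (rule kernel_wedge_contract)
  moreover have "hball \<rho> 0 1 = {v. \<rho> 0 v < 1}"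
    using assms(2) by (simp add: Metric_space.mball_def homogeneous_distance_def)
  ultimately have "metric_factor \<rho> p \<tau> = hausdorff dist p (span (insert Zvec b) \<inter> {v. \<rho> 0 v < 1})"
    by (simp add: metric_factor_def)
  then show ?thesis
    using density[OF assms(2), of p] norm by simp
qed

end
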